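(* Let $n\ge1$, let $s$ be an integer with $0\le s\le\frac n2$, and let $f$ be a nonzero polynomial of degree at most $s$ on $\{0,1\}^n$. Then for every real $0 \le i \le \frac n2$, \[ \Pr\left\{|f| \ge \|f\|_2 \cdot 2^{\left(\tau\left(\frac sn, \frac in\right) - \frac12 H\left(\frac sn\right)\right) \cdot n}\right\} ~\le~ 2^{\left(H\left(\frac in\right) - 1\right) \cdot n}. \] Moreover, there are absolute constants $c_1,c_2>0$ such that for $f=K_s$: (i) for every integer $0 \le i \le \frac n2 - \sqrt{s(n-s)}$, \[ \Pr\left\{|K_s| \ge \sqrt{\frac{\binom ns}{2^{H\left(\frac sn\right) \cdot n}}} \cdot \|K_s\|_2 \cdot 2^{\left(\tau\left(\frac sn, \frac in\right) - \frac12 H\left(\frac sn\right)\right) \cdot n}\right\} ~\ge~ \frac{c_1}{\sqrt{\max(i,1)}} \cdot 2^{\left(H\left(\frac in\right) - 1\right) \cdot n}; \] (ii) between any two consecutive roots of the univariate polynomial $K_s$ there is an integer $i$ for which \[ \Pr\left\{|K_s| \ge \frac{c_2}{n^{5/2}} \cdot \|K_s\|_2 \cdot 2^{\left(\tau\left(\frac sn, \frac in\right) - \frac12 H\left(\frac sn\right)\right) \cdot n}\right\} ~\ge~ \frac{c_1}{\sqrt{i}} \cdot 2^{\left(H\left(\frac in\right) - 1\right) \cdot n}. \]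
   Context: Probabilities and norms are with respect to the uniform measure on $\{0,1\}^n$: $\|f\|_p=(2^{-n}\sum_x|f(x)|^p)^{1/p}$. Walsh characters $W_\alpha(y)=(-1)^{\sum\alpha_iy_i}$; a polynomial of degree at most $s$ is a linear combination of $W_\alpha$ with $|\alpha|\le s$. The Krawchouk polynomial $K_s=\sum_{|\alpha|=s}W_\alpha$ satisfies $K_s(x)=K_s(|x|)$ where, as a univariate polynomial, $K_s(t)=\sum_{k=0}^s(-1)^k\binom tk\binom{n-t}{s-k}$; its roots are the roots of this univariate polynomial. $H(t)=-t\log_2 t-(1-t)\log_2(1-t)$. For $0\le u\le \frac12$ and $0<v\le \frac12-\sqrt{u(1-u)}$, $I(u,v)=\log_2(1-u)+\frac a2\log_2(1-2u-b)+u\log_2\frac{a+b}{2(1-u)}-\frac12\log_2\left(2(1-u)-a^2-ab\right)$ with $a=1-2v$, $b=\sqrt{a^2-4u(1-u)}$; $I(u,0)=-1$. For $0\le x,y\le\frac12$: $\tau(x,y)=H(x)+I(y,x)-I(0,x)$ if $y\le\frac12-\sqrt{x(1-x)}$, else $\tau(x,y)=\frac{1+H(x)-H(y)}2$.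
   Formalization: The upper bound excludes s=0 with i<n/2, where it is false (f constant: τ(0,i/n)=0, so the probability is 1 but the bound is below 1); in (ii), for i>n/2, where τ is not defined, its second formula (1+H(x)-H(y))/2 is used. *)

theory Defs
  imports "HOL-Probability.Probability"
begin

definition cube :: "nat \<Rightarrow> (nat \<Rightarrow> nat) set" where
  "cube n = {..<n} \<rightarrow>\<^sub>E {0, 1}"

definition weight :: "nat \<Rightarrow> (nat \<Rightarrow> nat) \<Rightarrow> nat" where
  "weight n x = (\<Sum>j<n. x j)"

definition cube_prob :: "nat \<Rightarrow> ((nat \<Rightarrow> nat) \<Rightarrow> bool) \<Rightarrow> real" where
  "cube_prob n P = measure_pmf.prob (pmf_of_set (cube n)) {x. P x}"

definition cube_norm :: "nat \<Rightarrow> real \<Rightarrow> ((nat \<Rightarrow> nat) \<Rightarrow> real) \<Rightarrow> real" where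
  "cube_norm n p f = ((1 / 2 ^ n) * (\<Sum>x\<in>cube n. \<bar>f x\<bar> powr p)) powr (1 / p)"

definition walsh :: "nat \<Rightarrow> (nat \<Rightarrow> nat) \<Rightarrow> (nat \<Rightarrow> nat) \<Rightarrow> real" where
  "walsh n \<alpha> y = (-1) ^ (\<Sum>j<n. \<alpha> j * y j)"

definition poly_degree_le :: "nat \<Rightarrow> nat \<Rightarrow> ((nat \<Rightarrow> nat) \<Rightarrow> real) \<Rightarrow> bool" where
  "poly_degree_le n s f \<longleftrightarrow>
     (\<exists>c. \<forall>x\<in>cube n. f x = (\<Sum>\<alpha>\<in>{\<alpha>\<in>cube n. weight n \<alpha> \<le> s}. c \<alpha> * walsh n \<alpha> x))"

definition krawtchouk_cube :: "nat \<Rightarrow> nat \<Rightarrow> (nat \<Rightarrow> nat) \<Rightarrow> real" where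
  "krawtchouk_cube n s x = (\<Sum>\<alpha>\<in>{\<alpha>\<in>cube n. weight n \<alpha> = s}. walsh n \<alpha> x)"

definition krawtchouk :: "nat \<Rightarrow> nat \<Rightarrow> real \<Rightarrow> real" where
  "krawtchouk n s t = (\<Sum>k=0..s. (-1) ^ k * (t gchoose k) * ((real n - t) gchoose (s - k)))"

definition consecutive_roots :: "(real \<Rightarrow> real) \<Rightarrow> real \<Rightarrow> real \<Rightarrow> bool" where
  "consecutive_roots g r r' \<longleftrightarrow>
     r < r' \<and> g r = 0 \<and> g r' = 0 \<and> (\<forall>t. r < t \<and> t < r' \<longrightarrow> g t \<noteq> 0)"

(* Here and below, ln 0 = 0 yields the usual convention 0 * log 0 = 0. *)
definition bin_entropy :: "real \<Rightarrow> real" where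
  "bin_entropy t = - t * log 2 t - (1 - t) * log 2 (1 - t)"

definition I_fun :: "real \<Rightarrow> real \<Rightarrow> real" where
  "I_fun u v =
     (if v = 0 then -1
      else let a = 1 - 2 * v; b = sqrt (a\<^sup>2 - 4 * u * (1 - u))
           in log 2 (1 - u) + a / 2 * log 2 (1 - 2 * u - b)
              + u * log 2 ((a + b) / (2 * (1 - u)))
              - 1 / 2 * log 2 (2 * (1 - u) - a\<^sup>2 - a * b))"

(* For 1/2 < y <= 1 the second branch applies; since bin_entropy y = bin_entropy (1 - y), this
   extends the formula from the nominal domain 0 <= x, y <= 1/2 to arguments i/n with i > n/2. *)
definition tau :: "real \<Rightarrow> real \<Rightarrow> real" where
  "tau x y =
     (if y \<le> 1 / 2 - sqrt (x * (1 - x))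
      then bin_entropy x + I_fun y x - I_fun 0 x
      else (1 + bin_entropy x - bin_entropy y) / 2)"

end

theory Submission
  imports Defs "HOL-Computational_Algebra.Formal_Power_Series"
begin

text \<open>
  For \<open>y\<close> below the threshold, \<open>tau x y\<close> is the local minimum in \<open>z\<close> (at the smaller root of
  \<open>(1-x) z\<^sup>2 - (1-2y) z + x\<close>) of \<open>(1-y) log (1+z) + y log (1-z) - x log z\<close>, the saddle point exponent
  of the generating function \<open>(1+z)\<^bsup>n-i\<^esup> (1-z)\<^bsup>i\<^esup>\<close> of the \<open>K\<^sub>s(i)\<close>.

  Upper bound: writing \<open>f\<close> as the image of a polynomial under the noise operator \<open>T\<^sub>\<rho>\<close> costs at most
  \<open>\<rho>\<^bsup>-s\<^esup>\<close> in \<open>L\<^sub>2\<close>. The norm of \<open>T\<^sub>\<rho>\<close> from \<open>L\<^sub>2\<close> to \<open>L\<^sub>p\<close> is multiplicative (Minkowski), so it is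
  computed on two points, where it may well exceed 1. Markov's inequality for the \<open>p\<close>-th moment, with
  \<open>p\<close> and \<open>\<rho>\<close> optimized, gives exactly \<open>tau\<close>.

  Lower bounds: in the head, the difference equation in \<open>i\<close> shows that \<open>K\<^sub>s(i+1) / K\<^sub>s(i)\<close> is at least the
  larger root of the characteristic equation at \<open>i\<close>, which integrates to \<open>tau\<close>. Between consecutive
  roots \<open>r < r'\<close>, \<open>K\<^sub>s\<close> is orthogonal to \<open>K\<^sub>s / ((t-r) (t-r'))\<close>, so the integers between \<open>r\<close> and \<open>r'\<close> carry
  a polynomial fraction of the \<open>L\<^sub>2\<close> norm; as roots are at least 2 apart, an integer very close to a
  root can be exchanged for its neighbour.
\<close>

section \<open>Fourier analysis on the cube\<close>

text \<open>The extremal functions explain the parameters of the upper bound. With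
  \<open>t = sqrt (x / (1 - x))\<close> the product of all \<open>1 + t W_j\<close> has its L2 mass
  concentrated near degree \<open>x n = s\<close>, so for it the loss \<open>\<rho>^(-s)\<close> is
  exponentially sharp. Its noise image is the product of all \<open>1 + z W_j\<close> with
  \<open>z = \<rho> t\<close>, and \<open>p\<close> is the exponent for which the p-th moment of
  this image comes from points of weight near \<open>y n = i\<close>. At the threshold
  \<open>y = 1/2 - sqrt (x (1 - x))\<close> the two roots of the saddle quadratic merge,
  \<open>\<rho> = 1\<close> and \<open>p = 2\<close>: there the plain second moment takes over,
  which is the other branch of \<open>tau\<close>. At \<open>y = 0\<close> the exponent
  \<open>p\<close> becomes infinite and a bound on the maximum replaces it.

  Between roots the obstacle is that the orthogonality relation weighs an integer \<open>i\<close>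
  by \<open>K_s(i)^2 / ((i - r) (r' - i))\<close>, which may be far larger than
  \<open>K_s(i)^2\<close>. The exponent \<open>5/2\<close> is half of \<open>5 = 2 + 1 + 2\<close>:
  the weights outside the gap cost \<open>n^2\<close>, the number of integers inside costs
  \<open>n\<close>, and the exchange of neighbours costs \<open>n^2\<close>.\<close>

lemma finite_cube [simp]: "finite (cube n)"
  unfolding cube_def by (intro finite_PiE) auto

lemma card_cube: "card (cube n) = 2 ^ n"
  unfolding cube_def by (subst card_PiE) (auto simp: numeral_2_eq_2)

lemma sum_cube_0: "(\<Sum>x\<in>cube 0. F x) = F (\<lambda>_. undefined)"
  by (simp add: cube_def)

lemma cube_Suc: "cube (Suc n) = (\<lambda>(b, x). x(n := b)) ` ({0, 1} \<times> cube n)"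
proof -
  have "{..<Suc n} = insert n {..<n}" by auto
  then show ?thesis
    unfolding cube_def by (simp add: PiE_insert_eq)
qed

text \<open>Points of \<open>cube n\<close> are \<open>undefined\<close> at coordinate
  \<open>n\<close>, so a point of \<open>cube (Suc n)\<close> determines both its last bit and the
  rest. The inductions over the dimension rest on this split.\<close>

lemma sum_cube_Suc:
  "(\<Sum>x\<in>cube (Suc n). F x) = (\<Sum>x\<in>cube n. F (x(n := 0)) + F (x(n := 1)))"
proof -
  have "inj_on (\<lambda>(b, x). x(n := b)) ({0, 1::nat} \<times> cube n)"
  proof (rule inj_onI, clarify)
    fix b b' :: nat and x x' assume *: "x \<in> cube n" "x' \<in> cube n" "x(n := b) = x'(n := b')"
    have "x n = undefined" "x' n = undefined"
      using * unfolding cube_def by (auto simp: PiE_def extensional_def)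
    then have "x = x'"
      using *(3) by (metis fun_upd_triv fun_upd_upd)
    moreover have "b = b'"
      using *(3) by (metis fun_upd_same)
    ultimately show "b = b' \<and> x = x'" by simp
  qed
  then have "(\<Sum>x\<in>cube (Suc n). F x) = (\<Sum>(b, x)\<in>{0, 1} \<times> cube n. F (x(n := b)))"
    unfolding cube_Suc by (subst sum.reindex) (auto simp: case_prod_unfold)
  also have "\<dots> = (\<Sum>b\<in>{0, 1}. \<Sum>x\<in>cube n. F (x(n := b)))"
    by (simp add: sum.cartesian_product)
  finally show ?thesis
    by (simp add: sum.distrib)
qed

lemma weight_upd [simp]: "weight (Suc n) (x(n := b)) = weight n x + b"
  by (simp add: weight_def)

lemma walsh_upd [simp]:
  "walsh (Suc n) (\<alpha>(n := a)) (x(n := b)) = walsh n \<alpha> x * (-1) ^ (a * b)"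
  by (simp add: walsh_def power_add)

lemma weight_0 [simp]: "weight 0 x = 0" and walsh_0 [simp]: "walsh 0 \<alpha> x = 1"
  by (simp_all add: weight_def walsh_def)

text \<open>The two values of the last coordinate shift the weight by 0 and by 1, and Pascal's rule
  merges the two binomial sums.\<close>

lemma sum_cube_weight:
  fixes g :: "nat \<Rightarrow> real"
  shows "(\<Sum>x\<in>cube n. g (weight n x)) = (\<Sum>k\<le>n. real (n choose k) * g k)"
proof (induction n arbitrary: g)
  case 0
  then show ?case by (simp add: sum_cube_0 card_cube)
next
  case (Suc n)
  have "(\<Sum>x\<in>cube (Suc n). g (weight (Suc n) x))
      = (\<Sum>x\<in>cube n. g (weight n x)) + (\<Sum>x\<in>cube n. g (Suc (weight n x)))"
    by (simp add: sum_cube_Suc sum.distrib)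
  also have "\<dots> = (\<Sum>k\<le>n. real (n choose k) * g k) + (\<Sum>k\<le>n. real (n choose k) * g (Suc k))"
    using Suc.IH[of g] Suc.IH[of "\<lambda>k. g (Suc k)"] by simp
  also have "(\<Sum>k\<le>n. real (n choose k) * g k) = (\<Sum>k\<le>Suc n. real (n choose k) * g k)"
    by simp
  also have "\<dots> = g 0 + (\<Sum>k\<le>n. real (n choose Suc k) * g (Suc k))"
    by (subst sum.atMost_Suc_shift) simp
  also have "g 0 + (\<Sum>k\<le>n. real (n choose Suc k) * g (Suc k)) + (\<Sum>k\<le>n. real (n choose k) * g (Suc k))
     = g 0 + (\<Sum>k\<le>n. real (Suc n choose Suc k) * g (Suc k))"
    by (simp add: sum.distrib algebra_simps)
  also have "\<dots> = (\<Sum>k\<le>Suc n. real (Suc n choose k) * g k)"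
    by (subst sum.atMost_Suc_shift) simp
  finally show ?case .
qed

lemma card_weight: "card {x \<in> cube n. weight n x = k} = n choose k"
proof -
  have "real (card {x \<in> cube n. weight n x = k}) = (\<Sum>x\<in>cube n. if weight n x = k then 1 else 0)"
    by (simp add: sum.If_cases Int_def)
  also have "\<dots> = (\<Sum>j\<le>n. real (n choose j) * (if j = k then 1 else 0))"
    by (rule sum_cube_weight)
  also have "\<dots> = real (n choose k)"
    by (auto simp: if_distrib[of "\<lambda>x. _ * x"] sum.delta binomial_eq_0 cong: if_cong)
  finally show ?thesis by simp
qed

lemma cube_prob_eq: "cube_prob n P = real (card {x \<in> cube n. P x}) / 2 ^ n"
proof -
  have "cube n \<noteq> {}"
    using card_cube[of n] by auto
  then show ?thesis
    unfolding cube_prob_def by (simp add: measure_pmf_of_set card_cube Int_def)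
qed

lemma cube_norm_2: "cube_norm n 2 f = sqrt ((\<Sum>x\<in>cube n. (f x)\<^sup>2) / 2 ^ n)"
proof -
  have "\<bar>u\<bar> powr 2 = u\<^sup>2" for u :: real
    by (cases "u = 0") (simp_all add: powr_numeral)
  then show ?thesis
    unfolding cube_norm_def by (simp add: powr_half_sqrt sum_nonneg)
qed

definition walsh_sum :: "nat \<Rightarrow> ((nat \<Rightarrow> nat) \<Rightarrow> real) \<Rightarrow> (nat \<Rightarrow> nat) \<Rightarrow> real" where
  "walsh_sum n c x = (\<Sum>\<alpha>\<in>cube n. c \<alpha> * walsh n \<alpha> x)"

lemma walsh_sum_Suc:
  "walsh_sum (Suc n) c (x(n := b)) =
     walsh_sum n (\<lambda>\<alpha>. c (\<alpha>(n := 0))) x + (-1) ^ b * walsh_sum n (\<lambda>\<alpha>. c (\<alpha>(n := 1))) x"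
  unfolding walsh_sum_def
  by (simp add: sum_cube_Suc sum.distrib sum_distrib_left mult_ac)

text \<open>The two halves of the cube carry \<open>g + h\<close> and \<open>g - h\<close>, whose
  squares add up to \<open>2 g^2 + 2 h^2\<close>.\<close>

lemma parseval:
  "(\<Sum>x\<in>cube n. (walsh_sum n c x)\<^sup>2) = 2 ^ n * (\<Sum>\<alpha>\<in>cube n. (c \<alpha>)\<^sup>2)"
proof (induction n arbitrary: c)
  case 0
  then show ?case by (simp add: sum_cube_0 walsh_sum_def card_cube)
next
  case (Suc n)
  have "(\<Sum>x\<in>cube (Suc n). (walsh_sum (Suc n) c x)\<^sup>2)
      = (\<Sum>x\<in>cube n. 2 * (walsh_sum n (\<lambda>\<alpha>. c (\<alpha>(n := 0))) x)\<^sup>2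
                      + 2 * (walsh_sum n (\<lambda>\<alpha>. c (\<alpha>(n := 1))) x)\<^sup>2)"
    unfolding sum_cube_Suc walsh_sum_Suc
    by (intro sum.cong refl) (simp add: power2_eq_square algebra_simps)
  then show ?case
    by (simp add: sum.distrib sum_distrib_left[symmetric] Suc.IH sum_cube_Suc algebra_simps)
qed

lemma poly_degree_leE:
  assumes "poly_degree_le n s f"
  obtains c where "\<And>x. x \<in> cube n \<Longrightarrow> f x = walsh_sum n c x"
    and "\<And>\<alpha>. s < weight n \<alpha> \<Longrightarrow> c \<alpha> = 0"
proof -
  from assms obtain c where
    c: "\<And>x. x \<in> cube n \<Longrightarrow> f x = (\<Sum>\<alpha>\<in>{\<alpha>\<in>cube n. weight n \<alpha> \<le> s}. c \<alpha> * walsh n \<alpha> x)"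
    unfolding poly_degree_le_def by blast
  show ?thesis
  proof
    show "f x = walsh_sum n (\<lambda>\<alpha>. if weight n \<alpha> \<le> s then c \<alpha> else 0) x" if "x \<in> cube n" for x
      unfolding c[OF that] walsh_sum_def by (intro sum.mono_neutral_cong_left) auto
  qed auto
qed

lemma krawtchouk_cube_walsh_sum:
  "krawtchouk_cube n s = walsh_sum n (\<lambda>\<alpha>. if weight n \<alpha> = s then 1 else 0)"
  unfolding krawtchouk_cube_def walsh_sum_def
  by (intro ext sum.mono_neutral_cong_left) auto

lemma sum_krawtchouk_cube_sq:
  "(\<Sum>x\<in>cube n. (krawtchouk_cube n s x)\<^sup>2) = 2 ^ n * real (n choose s)"
proof -
  have "(\<Sum>\<alpha>\<in>cube n. (if weight n \<alpha> = s then 1 else 0 :: real)\<^sup>2) = real (n choose s)"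
    by (simp add: if_distrib[of "\<lambda>x. x\<^sup>2"] sum.If_cases Int_def card_weight cong: if_cong)
  then show ?thesis
    unfolding krawtchouk_cube_walsh_sum parseval by simp
qed

lemma sum_krawtchouk_cube: "0 < s \<Longrightarrow> (\<Sum>x\<in>cube n. krawtchouk_cube n s x) = 0"
  unfolding krawtchouk_cube_walsh_sum
proof (induction n)
  case 0
  then show ?case by (simp add: sum_cube_0 walsh_sum_def)
next
  case (Suc n)
  then show ?case
    by (simp add: sum_cube_Suc walsh_sum_Suc sum_distrib_left[symmetric])
qed

section \<open>Entropy estimates for binomial coefficients\<close>

lemma bin_entropy_ln: "bin_entropy x * ln 2 = - x * ln x - (1 - x) * ln (1 - x)"
  by (simp add: bin_entropy_def log_def diff_divide_distrib left_diff_distrib)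

lemma powr_2_eq_exp: "2 powr x = exp (x * ln 2)" for x :: real
  by (simp add: powr_def)

text \<open>Turns entropy bounds into statements about the expansion of
  \<open>(i + (n - i))^n\<close>. The convention \<open>0 ^ 0 = 1\<close> covers both ends.\<close>

lemma two_powr_entropy:
  assumes "i \<le> n" "0 < n"
  shows "2 powr (bin_entropy (real i / real n) * real n)
    = real n ^ n / (real i ^ i * real (n - i) ^ (n - i))"
proof (cases "i = 0 \<or> i = n")
  case True
  with assms show ?thesis by (auto simp: bin_entropy_def)
next
  case False
  with assms have i: "0 < i" "i < n" by auto
  have 1: "1 - real i / real n = real (n - i) / real n"
    using i by (simp add: of_nat_diff field_simps)
  have "bin_entropy (real i / real n) * real n * ln 2
      = - real i * ln (real i / real n) - real (n - i) * ln (real (n - i) / real n)"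
  proof -
    have "bin_entropy (real i / real n) * real n * ln 2 = (bin_entropy (real i / real n) * ln 2) * real n"
      by simp
    also have "\<dots> = - real i * ln (real i / real n) - real (n - i) * ln (real (n - i) / real n)"
      unfolding bin_entropy_ln 1 using i by (simp add: field_simps)
    finally show ?thesis .
  qed
  also have "\<dots> = real n * ln n - real i * ln i - real (n - i) * ln (real (n - i))"
    using i by (simp add: ln_div of_nat_diff algebra_simps)
  also have "\<dots> = ln (real n ^ n / (real i ^ i * real (n - i) ^ (n - i)))"
    using i by (simp add: ln_div ln_mult ln_realpow)
  finally show ?thesis
    unfolding powr_2_eq_exp using i by simp
qed

lemma entropy_denominator_pos: "0 < real i ^ i * real j ^ j"
  by (cases "i = 0"; cases "j = 0") auto

lemma binomial_le_entropy:
  assumes "i \<le> n" "0 < n"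
  shows "real (n choose i) \<le> 2 powr (bin_entropy (real i / real n) * real n)"
proof -
  have "real n ^ n = (real i + real (n - i)) ^ n"
    using assms by (simp add: of_nat_diff)
  also have "\<dots> = (\<Sum>k\<le>n. real (n choose k) * real i ^ k * real (n - i) ^ (n - k))"
    by (simp add: binomial_ring)
  also have "\<dots> \<ge> real (n choose i) * real i ^ i * real (n - i) ^ (n - i)"
    using assms by (intro member_le_sum) auto
  finally show ?thesis
    unfolding two_powr_entropy[OF assms]
    by (subst pos_le_divide_eq[OF entropy_denominator_pos]) (simp add: mult_ac)
qed

text \<open>As \<open>s \<le> n - s\<close>, replacing surplus factors \<open>s\<close> by
  \<open>n - s\<close> bounds each summand by the \<open>k\<close>-th term of the expansion of
  \<open>(s + (n - s))^n\<close>. The omitted term \<open>k = n\<close> is positive, hence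
  strictness, which later makes the tail event at \<open>i = 0\<close> empty.\<close>

lemma sum_binomial_less_entropy:
  assumes "0 < s" "real s \<le> real n / 2"
  shows "(\<Sum>k\<le>s. real (n choose k)) < 2 powr (bin_entropy (real s / real n) * real n)"
proof -
  from assms have s: "s < n" "s \<le> n - s" by auto
  have "(\<Sum>k\<le>s. real (n choose k)) * (real s ^ s * real (n - s) ^ (n - s))
      = (\<Sum>k\<le>s. real (n choose k) * (real s ^ s * real (n - s) ^ (n - s)))"
    by (rule sum_distrib_right)
  also have "\<dots> \<le> (\<Sum>k\<le>s. real (n choose k) * real s ^ k * real (n - s) ^ (n - k))"
  proof (intro sum_mono)
    fix k assume "k \<in> {..s}"
    then have k: "k \<le> s" by simp
    have "real s ^ s * real (n - s) ^ (n - s) = real s ^ k * (real s ^ (s - k) * real (n - s) ^ (n - s))"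
      using k by (simp add: power_add[symmetric] mult.assoc[symmetric])
    also have "\<dots> \<le> real s ^ k * (real (n - s) ^ (s - k) * real (n - s) ^ (n - s))"
      using s by (intro mult_left_mono mult_right_mono power_mono) auto
    also have "\<dots> = real s ^ k * real (n - s) ^ (n - k)"
      using s k by (simp add: power_add[symmetric])
    finally show "real (n choose k) * (real s ^ s * real (n - s) ^ (n - s))
        \<le> real (n choose k) * real s ^ k * real (n - s) ^ (n - k)"
      by (simp add: mult.assoc mult_left_mono)
  qed
  also have "\<dots> < (\<Sum>k\<le>n. real (n choose k) * real s ^ k * real (n - s) ^ (n - k))"
    using s assms by (intro sum_strict_mono2[where b = n]) auto
  also have "\<dots> = (real s + real (n - s)) ^ n"
    by (simp add: binomial_ring)
  also have "\<dots> = real n ^ n"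
    using s by (simp add: of_nat_diff)
  finally show ?thesis
    unfolding two_powr_entropy[OF less_imp_le[OF s(1)] less_trans[OF assms(1) s(1)]]
    by (subst pos_less_divide_eq[OF entropy_denominator_pos])
qed

section \<open>Stirling bounds and the lower entropy estimate\<close>

definition stirling_ratio :: "nat \<Rightarrow> real" where
  "stirling_ratio m = fact m * exp (real m) / real m ^ m"

lemma stirling_ratio_pos: "0 < stirling_ratio m"
  by (cases "m = 0") (auto simp: stirling_ratio_def)

lemma stirling_ratio_Suc:
  assumes "0 < m"
  shows "stirling_ratio (Suc m) = stirling_ratio m * (exp 1 / (1 + 1 / real m) ^ m)"
proof -
  have "1 + 1 / real m = real (Suc m) / real m"
    using assms by (simp add: field_simps)
  then have "(1 + 1 / real m) ^ m = real (Suc m) ^ m / real m ^ m"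
    by (simp only: power_divide)
  then show ?thesis
    using assms unfolding stirling_ratio_def by (simp add: exp_add add.commute[of 1])
qed

lemma incseq_stirling_ratio: "incseq stirling_ratio"
proof (rule incseq_SucI)
  fix m show "stirling_ratio m \<le> stirling_ratio (Suc m)"
  proof (cases "m = 0")
    case True
    then show ?thesis by (simp add: stirling_ratio_def)
  next
    case False
    then have "(1 + 1 / real m) ^ m \<le> exp 1"
      using exp_ge_one_plus_x_over_n_power_n[of m 1] by simp
    moreover have "0 < (1 + 1 / real m) ^ m" by (intro zero_less_power) (simp add: add_pos_nonneg)
    ultimately have "1 \<le> exp 1 / (1 + 1 / real m) ^ m"
      by simp
    then show ?thesis
      unfolding stirling_ratio_Suc[OF False[unfolded neq0_conv]]
      using mult_left_mono[of 1 "exp 1 / (1 + 1 / real m) ^ m" "stirling_ratio m"] stirling_ratio_pos[of m]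
      by (metis less_imp_le mult.right_neutral)
  qed
qed

lemma stirling_ratio_le: "stirling_ratio m \<le> exp 1 * sqrt (max (real m) 1)"
proof (induction m)
  case 0
  show ?case by (simp add: stirling_ratio_def)
next
  case (Suc m)
  show ?case
  proof (cases "m = 0")
    case True
    then show ?thesis by (simp add: stirling_ratio_def)
  next
    case False
    define r where "r = 1 + 1 / real m"
    have r: "r > 0" "r = real (Suc m) / real m"
      using False by (auto simp: r_def field_simps add_pos_nonneg)
    have ln_r: "ln r = ln (real (Suc m)) - ln (real m)"
      unfolding r(2) using False by (simp add: ln_div)
    \<comment> \<open>Midpoint rule for the convex function \<open>1 / u\<close> on
      \<open>[m, m + 1]\<close>: its integral is at least \<open>1 / (m + 1/2)\<close>.\<close>
    have "1 \<le> (real m + 1 / 2) * (ln (real (Suc m)) - ln (real m))"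
      using ln_inverse_approx_ge[of "real m" "real (Suc m)"] False by (simp add: field_simps)
    also have "\<dots> = real m * ln r + ln (sqrt r)"
      unfolding ln_r[symmetric] using r(1) by (simp add: ln_sqrt field_simps)
    finally have "exp 1 \<le> r ^ m * sqrt r"
    proof -
      assume "1 \<le> real m * ln r + ln (sqrt r)"
      then have "exp 1 \<le> exp (real m * ln r + ln (sqrt r))" by simp
      then show ?thesis using r(1) by (simp add: exp_add exp_of_nat_mult)
    qed
    then have "exp 1 / r ^ m \<le> sqrt r"
      using r(1) by (simp add: field_simps)
    then have "stirling_ratio (Suc m) \<le> stirling_ratio m * sqrt r"
      unfolding stirling_ratio_Suc[OF False[unfolded neq0_conv]] r_def[symmetric]
      using stirling_ratio_pos[of m] by (intro mult_left_mono) auto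
    also have "\<dots> \<le> (exp 1 * sqrt (real m)) * sqrt r"
      using Suc.IH False r(1) by (intro mult_right_mono) auto
    also have "\<dots> = exp 1 * sqrt (real (Suc m))"
      using False by (simp add: r(2) real_sqrt_divide)
    finally show ?thesis by simp
  qed
qed

text \<open>Monotonicity of \<open>stirling_ratio\<close> bounds the quotient of its values at
  \<open>n\<close> and \<open>n - i\<close> below by 1. Only the value at \<open>i\<close> costs
  anything, so the loss is of order \<open>sqrt i\<close> whatever \<open>n\<close> is.\<close>

lemma binomial_ge_entropy:
  assumes "i \<le> n" "0 < n"
  shows "exp (- 1) / sqrt (max (real i) 1) * 2 powr (bin_entropy (real i / real n) * real n)
    \<le> real (n choose i)"
proof -
  let ?E = "real n ^ n / (real i ^ i * real (n - i) ^ (n - i))"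
  have pos: "0 < real i ^ i" "0 < real (n - i) ^ (n - i)"
    by (cases "i = 0"; simp) (cases "n - i"; simp)
  have "fact m = stirling_ratio m * real m ^ m / exp (real m)" for m
    by (cases "m = 0") (simp_all add: stirling_ratio_def)
  note f = this
  have rearrange: "(a * p / e1) / ((b * q / e2) * (c * r / e3)) = a / (b * c) * (p / (q * r)) * (e2 * e3 / e1)"
    for a b c p q r e1 e2 e3 :: real
    by (simp add: divide_inverse mult_ac)
  have "real (n choose i) = fact n / (fact i * fact (n - i))"
    using assms by (simp add: binomial_fact)
  also have "\<dots> = stirling_ratio n / (stirling_ratio i * stirling_ratio (n - i)) * ?E
      * (exp (real i) * exp (real (n - i)) / exp (real n))"
    unfolding f by (rule rearrange)
  also have "exp (real i) * exp (real (n - i)) / exp (real n) = 1"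
    using assms by (simp only: exp_add[symmetric] of_nat_add[symmetric]) simp
  finally have eq: "real (n choose i) = stirling_ratio n / (stirling_ratio i * stirling_ratio (n - i)) * ?E"
    by simp
  have "1 / (exp 1 * sqrt (max (real i) 1)) \<le> 1 / stirling_ratio i"
    using stirling_ratio_pos[of i] stirling_ratio_le[of i] by (intro divide_left_mono mult_pos_pos) auto
  also have "\<dots> \<le> stirling_ratio n / (stirling_ratio i * stirling_ratio (n - i))"
  proof -
    have "1 \<le> stirling_ratio n / stirling_ratio (n - i)"
      using stirling_ratio_pos[of "n - i"] incseqD[OF incseq_stirling_ratio diff_le_self[of n i]]
      by (simp add: le_divide_eq_1_pos)
    then have "1 / stirling_ratio i \<le> (stirling_ratio n / stirling_ratio (n - i)) / stirling_ratio i"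
      using stirling_ratio_pos[of i] by (intro divide_right_mono) auto
    then show ?thesis by (simp only: divide_divide_eq_left mult.commute)
  qed
  finally have "1 / (exp 1 * sqrt (max (real i) 1)) * ?E
      \<le> stirling_ratio n / (stirling_ratio i * stirling_ratio (n - i)) * ?E"
    using pos by (intro mult_right_mono) auto
  moreover have "exp (- 1) / sqrt (max (real i) 1) = 1 / (exp 1 * sqrt (max (real i) 1))"
    by (simp add: exp_minus inverse_eq_divide)
  ultimately show ?thesis
    unfolding two_powr_entropy[OF assms] eq by (simp only:)
qed

section \<open>The saddle point form of \<open>tau\<close>\<close>

text \<open>The radicand equals the discriminant \<open>(1 - 2 * y)^2 - 4 * x * (1 - x)\<close> of
  the quadratic; it is written in the form of the \<open>b\<close> in
  \<open>I_fun y x\<close>.\<close>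

definition saddle :: "real \<Rightarrow> real \<Rightarrow> real" where
  "saddle x y = (1 - 2 * y - sqrt ((1 - 2 * x)\<^sup>2 - 4 * y * (1 - y))) / (2 * (1 - x))"

text \<open>At \<open>x = 1 / 2\<close> the region would shrink to \<open>y = 0\<close>, with the
  saddle at 1, where \<open>ln (1 - z)\<close> degenerates.\<close>

locale saddle_region =
  fixes x y :: real
  assumes x: "0 < x" "x < 1 / 2" and y: "0 \<le> y" "y \<le> 1 / 2 - sqrt (x * (1 - x))"
begin

abbreviation "z \<equiv> saddle x y"
abbreviation "b \<equiv> sqrt ((1 - 2 * x)\<^sup>2 - 4 * y * (1 - y))"

lemma xx_pos: "0 < x * (1 - x)" and y_less: "y < 1 / 2"
proof -
  show "0 < x * (1 - x)" using x by simp
  then have "0 < sqrt (x * (1 - x))" by simp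
  then show "y < 1 / 2" using y by linarith
qed

lemma disc: "4 * (x * (1 - x)) \<le> (1 - 2 * y)\<^sup>2"
proof -
  have "4 * (x * (1 - x)) = (2 * sqrt (x * (1 - x)))\<^sup>2"
    using xx_pos by (simp add: power_mult_distrib)
  also have "\<dots> \<le> (1 - 2 * y)\<^sup>2"
    using y xx_pos by (intro power_mono) auto
  finally show ?thesis .
qed

lemma b_sq: "b\<^sup>2 = (1 - 2 * y)\<^sup>2 - 4 * (x * (1 - x))" and b_nonneg: "0 \<le> b"
  using disc by (auto simp: power2_eq_square algebra_simps)

lemma z_eq: "2 * (1 - x) * z = 1 - 2 * y - b"
  using x by (simp add: saddle_def)

lemma quadratic: "(1 - x) * z\<^sup>2 - (1 - 2 * y) * z + x = 0"
proof -
  have "4 * (1 - x) * ((1 - x) * z\<^sup>2 - (1 - 2 * y) * z + x)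
      = (2 * (1 - x) * z)\<^sup>2 - 2 * (1 - 2 * y) * (2 * (1 - x) * z) + 4 * (x * (1 - x))"
    by (simp add: power2_eq_square algebra_simps)
  also have "\<dots> = b\<^sup>2 - (1 - 2 * y)\<^sup>2 + 4 * (x * (1 - x))"
    unfolding z_eq by (simp add: power2_eq_square algebra_simps)
  finally show ?thesis using b_sq x by simp
qed

lemma b_less: "b < 1 - 2 * y"
proof (rule power2_less_imp_less)
  show "b\<^sup>2 < (1 - 2 * y)\<^sup>2" using b_sq xx_pos by simp
qed (use y_less in simp)

lemma z_pos: "0 < z"
  unfolding saddle_def using b_less x by (intro divide_pos_pos) auto

text \<open>The roots have product \<open>x / (1 - x)\<close> and \<open>z\<close> is the smaller
  one. Later this says \<open>\<rho> \<le> 1\<close>.\<close>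

lemma z_sq_le: "(1 - x) * z\<^sup>2 \<le> x"
proof -
  have "(1 - x) * z\<^sup>2 * 2 = (1 - 2 * y - b) * z"
    unfolding z_eq[symmetric] by (simp add: power2_eq_square)
  also have "\<dots> \<le> (1 - 2 * y) * z"
    using z_pos b_nonneg by (intro mult_right_mono) auto
  also have "\<dots> = (1 - x) * z\<^sup>2 + x"
    using quadratic by simp
  finally show ?thesis by simp
qed

lemma z_less_1: "z < 1"
proof -
  have "z\<^sup>2 \<le> x / (1 - x)"
    using z_sq_le x by (simp add: field_simps)
  also have "\<dots> < 1\<^sup>2"
    using x by simp
  finally show ?thesis by (rule power2_less_imp_less) simp
qed

text \<open>On \<open>(0, z]\<close> the exponent \<open>(1-y) ln (1+t) + y ln (1-t) - x ln t\<close> decreases; here is the sign of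
  its derivative.\<close>

lemma quadratic_nonneg:
  assumes "0 < t" "t \<le> z"
  shows "0 \<le> (1 - x) * t\<^sup>2 - (1 - 2 * y) * t + x"
proof -
  have "0 \<le> (z - t) * (1 - 2 * y - (1 - x) * (z + t))"
  proof (rule mult_nonneg_nonneg)
    have "(1 - x) * (z + t) \<le> (1 - x) * (z + z)"
      using assms x by (intro mult_left_mono) auto
    also have "\<dots> = 1 - 2 * y - b" using z_eq by (simp add: algebra_simps)
    finally show "0 \<le> 1 - 2 * y - (1 - x) * (z + t)" using b_nonneg by linarith
  qed (use assms in simp)
  also have "\<dots> = (1 - x) * t\<^sup>2 - (1 - 2 * y) * t + x - ((1 - x) * z\<^sup>2 - (1 - 2 * y) * z + x)"
    by (simp add: power2_eq_square algebra_simps)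
  finally show ?thesis using quadratic by simp
qed

text \<open>By the quadratic equation every argument of a logarithm in \<open>I_fun y x\<close> is,
  up to constants, a product of powers of \<open>z\<close>, \<open>1 - z\<close>,
  \<open>1 - x\<close>, \<open>1 - y\<close> and \<open>A\<close>. After that the claim is linear in
  their logarithms.\<close>

lemma tau_eq: "tau x y * ln 2 = (1 - y) * ln (1 + z) + y * ln (1 - z) - x * ln z"
proof -
  define A where "A = (1 - y) / (1 + z)"
  have z: "0 < z" "z < 1" using z_pos z_less_1 by auto
  have A_pos: "0 < A" using z y_less by (simp add: A_def)
  have A1: "1 - y = A * (1 + z)" using z by (simp add: A_def)
  have A2: "2 * z * A = x + (1 - x) * z"
  proof -
    have "(1 + z) * (2 * z * A - (x + (1 - x) * z)) = 2 * z * (1 - y) - (x + (1 - x) * z) * (1 + z)"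
      using z by (simp add: A_def field_simps)
    also have "\<dots> = - ((1 - x) * z\<^sup>2 - (1 - 2 * y) * z + x)"
      by (simp add: power2_eq_square algebra_simps)
    finally show ?thesis using quadratic z by simp
  qed
  have A3: "1 - 2 * x + b = 2 * A * (1 - z)"
  proof -
    have bz: "b = 1 - 2 * y - 2 * (1 - x) * z" using z_eq by simp
    have "z * (1 - 2 * x + b - 2 * A * (1 - z)) = z * (1 - 2 * x + b) - 2 * z * A * (1 - z)"
      by (simp add: algebra_simps)
    also have "\<dots> = z * (2 - 2 * x - 2 * y - 2 * (1 - x) * z) - (x + (1 - x) * z) * (1 - z)"
      unfolding A2 bz by (simp add: algebra_simps)
    also have "\<dots> = - ((1 - x) * z\<^sup>2 - (1 - 2 * y) * z + x)"
      by (simp add: power2_eq_square algebra_simps)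
    finally show ?thesis using quadratic z by simp
  qed
  have A4: "2 * (1 - y) - (1 - 2 * x)\<^sup>2 - (1 - 2 * x) * b = 8 * z * A\<^sup>2"
  proof -
    have "2 * (1 - y) - (1 - 2 * x)\<^sup>2 - (1 - 2 * x) * b
        = 2 * (A * (1 + z)) - (1 - 2 * x) * (1 - 2 * x + b)"
      unfolding A1[symmetric] by (simp add: power2_eq_square algebra_simps)
    also have "\<dots> = 4 * A * (x + (1 - x) * z)"
      unfolding A3 by (simp add: algebra_simps)
    finally show ?thesis
      unfolding A2[symmetric] by (simp add: power2_eq_square algebra_simps)
  qed
  have ln8: "ln 8 = 3 * ln (2::real)"
    using ln_realpow[of "2::real" 3] by simp
  \<comment> \<open>At \<open>y = 0\<close> the square root \<open>b\<close> is
    \<open>1 - 2 * x\<close>, which makes the last argument \<open>8 x (1 - x)\<close>.\<close>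
  have I0: "I_fun 0 x * ln 2 = (1 / 2 - x) * (ln 2 + ln x) - 1 / 2 * (3 * ln 2 + ln x + ln (1 - x))"
  proof -
    have "I_fun 0 x * ln 2 = (1 / 2 - x) * ln (1 - (1 - 2 * x))
        - 1 / 2 * ln (2 - (1 - 2 * x)\<^sup>2 - (1 - 2 * x) * (1 - 2 * x))"
      using x by (simp add: I_fun_def Let_def log_def field_simps)
    moreover have "2 - (1 - 2 * x)\<^sup>2 - (1 - 2 * x) * (1 - 2 * x) = 2 ^ 3 * x * (1 - x)"
      by (simp add: power2_eq_square algebra_simps)
    moreover have "ln (2 ^ 3 * x * (1 - x)) = 3 * ln 2 + ln x + ln (1 - x)"
      using x ln8 by (simp add: ln_mult)
    moreover have "ln (1 - (1 - 2 * x)) = ln 2 + ln x"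
      using x by (simp add: ln_mult)
    ultimately show ?thesis by simp
  qed
  have I1: "I_fun y x * ln 2 = ln (1 - y) + (1 / 2 - x) * (ln 2 + ln (1 - x) + ln z)
      + y * (ln A + ln (1 - z) - ln (1 - y)) - 1 / 2 * (3 * ln 2 + ln z + 2 * ln A)"
  proof -
    have 1: "ln (1 - 2 * y - b) = ln 2 + ln (1 - x) + ln z"
      unfolding z_eq[symmetric] using x z by (simp add: ln_mult del: right_diff_distrib_numeral)
    have 2: "ln ((1 - 2 * x + b) / (2 * (1 - y))) = ln A + ln (1 - z) - ln (1 - y)"
      unfolding A3 using A_pos z y_less by (simp add: ln_mult ln_div del: right_diff_distrib_numeral)
    have 3: "ln (8 * z * A\<^sup>2) = 3 * ln 2 + ln z + 2 * ln A"
      using A_pos z ln8 by (simp add: ln_mult ln_realpow)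
    have "I_fun y x * ln 2 = ln (1 - y) + (1 / 2 - x) * ln (1 - 2 * y - b)
       + y * ln ((1 - 2 * x + b) / (2 * (1 - y))) - 1 / 2 * ln (8 * z * A\<^sup>2)"
      using x unfolding A4[symmetric] by (simp add: I_fun_def Let_def log_def field_simps)
    then show ?thesis unfolding 1 2 3 .
  qed
  have lnA: "ln A = ln (1 - y) - ln (1 + z)"
    unfolding A_def using z y_less by (simp add: ln_div)
  have "tau x y * ln 2 = bin_entropy x * ln 2 + I_fun y x * ln 2 - I_fun 0 x * ln 2"
    using y by (simp add: tau_def algebra_simps)
  then show ?thesis
    unfolding bin_entropy_ln I0 I1 lnA by (simp add: algebra_simps)
qed

end

lemma tau_0: 
  assumes "0 < x" "x \<le> 1 / 2"
  shows "tau x 0 = bin_entropy x"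
proof -
  have "x * (1 - x) \<le> (1 / 2)\<^sup>2"
    using sum_squares_ge_zero[of "x - 1 / 2" 0] by (simp add: power2_eq_square algebra_simps)
  then have "sqrt (x * (1 - x)) \<le> 1 / 2"
    by (intro real_le_lsqrt) auto
  then show ?thesis by (simp add: tau_def)
qed

section \<open>Moments of polynomials of bounded degree\<close>

lemma powr_convex_nonneg:
  fixes a b l r :: real
  assumes "0 \<le> a" "0 \<le> b" "0 \<le> l" "l \<le> 1" "1 \<le> r"
  shows "(l * a + (1 - l) * b) powr r \<le> l * a powr r + (1 - l) * b powr r"
proof -
  have le: "m powr r \<le> m" if "0 \<le> m" "m \<le> 1" for m :: real
    using powr_mono'[of 1 r m] that assms(5) by simp
  consider "a = 0" | "b = 0" | "0 < a" "0 < b"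
    using assms by linarith
  then show ?thesis
  proof cases
    case 1
    have "(1 - l) powr r * b powr r \<le> (1 - l) * b powr r"
      using le[of "1 - l"] assms by (intro mult_right_mono) auto
    with 1 assms show ?thesis by (simp add: powr_mult)
  next
    case 2
    have "l powr r * a powr r \<le> l * a powr r"
      using le[of l] assms by (intro mult_right_mono) auto
    with 2 assms show ?thesis by (simp add: powr_mult)
  next
    case 3
    then show ?thesis
      using convex_onD[OF powr_convex[OF assms(5)], of "1 - l" a b] assms by simp
  qed
qed

text \<open>\<open>U\<close> and \<open>V\<close> bound the r-norms of \<open>u\<close> and
  \<open>v\<close>; the normalisation \<open>K\<close> is kept apart so that it can serve as the
  constant of an induction. Convexity of \<open>powr r\<close> is applied to \<open>u / U\<close>
  and \<open>v / V\<close> with weights proportional to \<open>U\<close> and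
  \<open>V\<close>.\<close>

lemma minkowski_sum:
  fixes u v :: "'a \<Rightarrow> real"
  assumes "finite A" and u: "\<And>x. x \<in> A \<Longrightarrow> 0 \<le> u x" and v: "\<And>x. x \<in> A \<Longrightarrow> 0 \<le> v x"
    and r: "1 \<le> r" and UV: "0 \<le> U" "0 \<le> V"
    and U: "(\<Sum>x\<in>A. u x powr r) \<le> K * U powr r" and V: "(\<Sum>x\<in>A. v x powr r) \<le> K * V powr r"
  shows "(\<Sum>x\<in>A. (u x + v x) powr r) \<le> K * (U + V) powr r"
proof -
  have vanish: "w x = 0" if "(\<Sum>x\<in>A. w x powr r) \<le> K * 0 powr r" "x \<in> A" "\<And>x. x \<in> A \<Longrightarrow> 0 \<le> w x"
    for w :: "'a \<Rightarrow> real" and x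
  proof -
    have "(\<Sum>x\<in>A. w x powr r) = 0"
      using that(1) by (intro antisym sum_nonneg) auto
    then show ?thesis
      using that(2) \<open>finite A\<close> by (subst (asm) sum_nonneg_eq_0_iff) auto
  qed
  consider "U = 0" | "V = 0" | "0 < U" "0 < V"
    using UV by linarith
  then show ?thesis
  proof cases
    case 1
    then have "\<And>x. x \<in> A \<Longrightarrow> u x = 0" using vanish[of u] U u by auto
    with 1 V show ?thesis by simp
  next
    case 2
    then have "\<And>x. x \<in> A \<Longrightarrow> v x = 0" using vanish[of v] V v by auto
    with 2 U show ?thesis by simp
  next
    case 3
    define l where "l = U / (U + V)"
    have l: "0 \<le> l" "l \<le> 1" "1 - l = V / (U + V)"
      using 3 by (auto simp: l_def field_simps)
    have "(\<Sum>x\<in>A. (u x + v x) powr r)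
        \<le> (\<Sum>x\<in>A. (U + V) powr r * (l / U powr r * u x powr r + (1 - l) / V powr r * v x powr r))"
    proof (rule sum_mono)
      fix x assume x: "x \<in> A"
      have "u x + v x = (U + V) * (l * (u x / U) + (1 - l) * (v x / V))"
      proof -
        have "(U + V) * (l * (u x / U)) = u x"
          unfolding l_def using 3 by simp
        moreover have "(U + V) * ((1 - l) * (v x / V)) = v x"
          unfolding l(3) using 3 by simp
        ultimately show ?thesis by (simp only: distrib_left)
      qed
      then have "(u x + v x) powr r = (U + V) powr r * (l * (u x / U) + (1 - l) * (v x / V)) powr r"
        using 3 u[OF x] v[OF x] l by (simp add: powr_mult)
      also have "\<dots> \<le> (U + V) powr r * (l * (u x / U) powr r + (1 - l) * (v x / V) powr r)"
        using 3 u[OF x] v[OF x] l r by (intro mult_left_mono powr_convex_nonneg) auto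
      finally show "(u x + v x) powr r
          \<le> (U + V) powr r * (l / U powr r * u x powr r + (1 - l) / V powr r * v x powr r)"
        using 3 u[OF x] v[OF x] by (simp add: powr_divide)
    qed
    also have "\<dots> = (U + V) powr r * (l / U powr r * (\<Sum>x\<in>A. u x powr r)
        + (1 - l) / V powr r * (\<Sum>x\<in>A. v x powr r))"
      by (simp only: sum_distrib_left[symmetric] sum.distrib)
    also have "\<dots> \<le> (U + V) powr r * (l / U powr r * (K * U powr r) + (1 - l) / V powr r * (K * V powr r))"
      using U V l 3 by (intro mult_left_mono add_mono) auto
    also have "\<dots> = K * (U + V) powr r"
    proof -
      have "l / U powr r * (K * U powr r) = l * K" "(1 - l) / V powr r * (K * V powr r) = (1 - l) * K"
        using 3 by simp_all
      then show ?thesis by (simp only:) (simp add: algebra_simps)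
    qed
    finally show ?thesis .
  qed
qed

section \<open>The two-point inequality from L2 to Lp\<close>

lemma sinh_mult_ge:
  fixes q u :: real
  assumes "1 \<le> q" "0 \<le> u"
  shows "q * sinh u \<le> sinh (q * u)"
proof -
  have "sinh (q * 0) - q * sinh 0 \<le> sinh (q * u) - q * sinh u"
  proof (rule DERIV_nonneg_imp_nondecreasing[OF assms(2)])
    fix t :: real assume t: "0 \<le> t" "t \<le> u"
    have "((\<lambda>t. sinh (q * t) - q * sinh t) has_real_derivative q * (cosh (q * t) - cosh t)) (at t)"
      by (auto intro!: derivative_eq_intros simp: algebra_simps)
    moreover have "cosh t \<le> cosh (q * t)"
      using t assms mult_right_mono[of 1 q t] by (subst cosh_real_nonneg_le_iff) auto
    ultimately show "\<exists>D. ((\<lambda>t. sinh (q * t) - q * sinh t) has_real_derivative D) (at t) \<and> 0 \<le> D"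
      using assms by (intro exI[of _ "q * (cosh (q * t) - cosh t)"]) auto
  qed
  then show ?thesis by simp
qed

text \<open>The logarithmic derivative of \<open>tanh w\<close> is \<open>2 / sinh (2 * w)\<close>,
  so \<open>tanh u / tanh (q * u)\<close> is nondecreasing by \<open>sinh_mult_ge\<close>.\<close>

lemma tanh_ratio_mono:
  fixes q s t :: real
  assumes "1 \<le> q" "0 < s" "s \<le> t"
  shows "tanh s * tanh (q * t) \<le> tanh t * tanh (q * s)"
proof -
  have "ln (tanh s) - ln (tanh (q * s)) \<le> ln (tanh t) - ln (tanh (q * t))"
  proof (rule DERIV_nonneg_imp_nondecreasing[OF assms(3)])
    fix u :: real assume u: "s \<le> u" "u \<le> t"
    then have pos: "0 < u" "0 < q * u" using assms by auto
    have eq: "(1 - (tanh w)\<^sup>2) / tanh w = 2 / sinh (2 * w)" if "0 < w" for w :: real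
    proof -
      have "1 - (tanh w)\<^sup>2 = ((cosh w)\<^sup>2 - (sinh w)\<^sup>2) / (cosh w)\<^sup>2"
        by (simp add: tanh_def power_divide diff_divide_distrib)
      then have "1 - (tanh w)\<^sup>2 = 1 / (cosh w)\<^sup>2"
        by (simp add: cosh_square_eq)
      then show ?thesis
        using that unfolding sinh_double by (simp add: tanh_def power2_eq_square)
    qed
    have d: "((\<lambda>u. ln (tanh (k * u))) has_real_derivative k * ((1 - (tanh (k * u))\<^sup>2) / tanh (k * u))) (at u)"
      if "0 < k * u" for k
      using that by (auto intro!: derivative_eq_intros)
    have "((\<lambda>u. ln (tanh u) - ln (tanh (q * u))) has_real_derivative
        (1 - (tanh u)\<^sup>2) / tanh u - q * ((1 - (tanh (q * u))\<^sup>2) / tanh (q * u))) (at u)"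
      using DERIV_diff[OF d[of 1] d[OF pos(2)]] pos(1) by simp
    moreover have "0 \<le> 2 / sinh (2 * u) - q * (2 / sinh (2 * (q * u)))"
      using sinh_mult_ge[OF assms(1), of "2 * u"] pos by (simp add: field_simps mult_ac)
    ultimately show "\<exists>D. ((\<lambda>u. ln (tanh u) - ln (tanh (q * u))) has_real_derivative D) (at u) \<and> 0 \<le> D"
      unfolding eq[OF pos(1)] eq[OF pos(2)] by blast
  qed
  moreover have pos: "0 < tanh s" "0 < tanh t" "0 < tanh (q * s)" "0 < tanh (q * t)"
    using assms by auto
  ultimately have "ln (tanh s * tanh (q * t)) \<le> ln (tanh t * tanh (q * s))"
    by (simp add: ln_mult)
  then show ?thesis
    using pos by simp
qed

lemma tanh_artanh:
  fixes x :: real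
  assumes "- 1 < x" "x < 1"
  shows "tanh (artanh x) = x"
proof -
  have "exp (- 2 * artanh x) = (1 - x) / (1 + x)"
    using assms by (simp add: artanh_def exp_minus)
  then show ?thesis
    unfolding tanh_real_altdef using assms by (simp only: \<open>exp (- 2 * artanh x) = _\<close>) (simp add: field_simps)
qed

lemma power2_powr_half: "(x\<^sup>2) powr (p / 2) = \<bar>x\<bar> powr p" for x p :: real
proof (cases "x = 0")
  case False
  then have "x\<^sup>2 = \<bar>x\<bar> powr 2" by (simp add: powr_numeral)
  then show ?thesis by (simp only: powr_powr) simp
qed simp

text \<open>The operator with multipliers \<open>1, \<rho>\<close> from \<open>L\<^sub>2\<close> to \<open>L\<^sub>p\<close> on the two-point space attains its norm
  at \<open>1 + t W\<close> with \<open>\<rho> t = tanh \<theta>\<close>.\<close>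

locale two_point =
  fixes p \<rho> \<theta> :: real
  assumes p: "2 \<le> p" and \<rho>: "0 < \<rho>" "\<rho> \<le> 1" and \<theta>: "0 < \<theta>"
    and critical: "\<rho>\<^sup>2 * tanh ((p - 1) * \<theta>) = tanh \<theta>"
begin

text \<open>If \<open>\<rho> * v / u = tanh t\<close>, then \<open>u + \<rho> * v\<close> and
  \<open>u - \<rho> * v\<close> are proportional to \<open>exp t\<close> and
  \<open>exp (- t)\<close>, and \<open>u^2 + v^2\<close> is \<open>W t / \<rho>^2\<close> times the
  square of the same factor. So \<open>C\<close>, the p-th power of the two-point norm, is the value
  at \<open>\<theta>\<close> of
  \<open>cosh (p * t) / W t powr (p / 2) * \<rho> powr p\<close>.\<close>

definition W where "W t = \<rho>\<^sup>2 * (cosh t)\<^sup>2 + (sinh t)\<^sup>2"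
definition C where "C = cosh (p * \<theta>) / W \<theta> powr (p / 2) * \<rho> powr p"

lemma W_pos: "0 < W t"
  unfolding W_def using \<rho> by (intro add_pos_nonneg) auto

lemma C_pos: "0 < C"
  unfolding C_def using W_pos[of \<theta>] \<rho> by simp

lemma log_norm_deriv:
  "((\<lambda>t. ln (cosh (p * t)) - p / 2 * ln (W t)) has_real_derivative
     p * cosh t * cosh ((p - 1) * t) / (cosh (p * t) * W t) * (\<rho>\<^sup>2 * tanh ((p - 1) * t) - tanh t)) (at t)"
proof -
  define S K where "S = sinh ((p - 1) * t)" and "K = cosh ((p - 1) * t)"
  \<comment> \<open>Splitting off one \<open>t\<close> makes \<open>cosh^2 - sinh^2 = 1\<close>
    appear as a factor of the numerator.\<close>
  have "p * t = (p - 1) * t + t" by (simp add: algebra_simps)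
  then have sk: "sinh (p * t) = S * cosh t + K * sinh t" "cosh (p * t) = K * cosh t + S * sinh t"
    unfolding S_def K_def by (simp_all only: sinh_add cosh_add)
  have "((\<lambda>t. ln (cosh (p * t)) - p / 2 * ln (W t)) has_real_derivative
      p * sinh (p * t) / cosh (p * t) - p / 2 * ((2 * \<rho>\<^sup>2 * cosh t * sinh t + 2 * sinh t * cosh t) / W t)) (at t)"
  proof -
    have "(W has_real_derivative 2 * \<rho>\<^sup>2 * cosh t * sinh t + 2 * sinh t * cosh t) (at t)"
      unfolding W_def[abs_def] by (auto intro!: derivative_eq_intros simp: algebra_simps)
    from DERIV_chain2[OF DERIV_ln_divide[OF W_pos] this]
    have 1: "((\<lambda>t. ln (W t)) has_real_derivative
        (2 * \<rho>\<^sup>2 * cosh t * sinh t + 2 * sinh t * cosh t) / W t) (at t)" by simp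
    have 2: "((\<lambda>t. ln (cosh (p * t))) has_real_derivative p * sinh (p * t) / cosh (p * t)) (at t)"
      by (auto intro!: derivative_eq_intros)
    show ?thesis by (rule DERIV_diff[OF 2 DERIV_cmult[OF 1]])
  qed
  also have "p * sinh (p * t) / cosh (p * t) - p / 2 * ((2 * \<rho>\<^sup>2 * cosh t * sinh t + 2 * sinh t * cosh t) / W t)
      = p * (sinh (p * t) * W t - (\<rho>\<^sup>2 + 1) * sinh t * cosh t * cosh (p * t)) / (cosh (p * t) * W t)"
    using W_pos[of t] cosh_real_pos[of "p * t"] by (simp add: divide_simps) (simp add: algebra_simps)
  also have "sinh (p * t) * W t - (\<rho>\<^sup>2 + 1) * sinh t * cosh t * cosh (p * t)
      = ((cosh t)\<^sup>2 - (sinh t)\<^sup>2) * (\<rho>\<^sup>2 * cosh t * S - sinh t * K)"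
    unfolding sk W_def by (simp add: power2_eq_square algebra_simps)
  also have "(cosh t)\<^sup>2 - (sinh t)\<^sup>2 = 1"
    by (simp add: cosh_square_eq)
  also have "\<rho>\<^sup>2 * cosh t * S - sinh t * K
      = cosh t * cosh ((p - 1) * t) * (\<rho>\<^sup>2 * tanh ((p - 1) * t) - tanh t)"
    by (simp add: S_def K_def tanh_def right_diff_distrib)
  finally show ?thesis by (simp add: mult_ac)
qed

text \<open>\<open>tanh t / tanh ((p - 1) * t)\<close> is nondecreasing, as
  \<open>1 \<le> p - 1\<close>, and equals \<open>\<rho>^2\<close> at \<open>\<theta>\<close>. So
  the logarithm of the norm ratio increases up to \<open>\<theta>\<close> and decreases
  afterwards.\<close>

lemma sign_before: "0 < t \<Longrightarrow> t \<le> \<theta> \<Longrightarrow> tanh t \<le> \<rho>\<^sup>2 * tanh ((p - 1) * t)"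
  and sign_after: "\<theta> \<le> t \<Longrightarrow> \<rho>\<^sup>2 * tanh ((p - 1) * t) \<le> tanh t"
proof -
  have pos: "0 < tanh ((p - 1) * \<theta>)" using p \<theta> by simp
  show "tanh t \<le> \<rho>\<^sup>2 * tanh ((p - 1) * t)" if "0 < t" "t \<le> \<theta>"
  proof -
    have "tanh t * tanh ((p - 1) * \<theta>) \<le> (\<rho>\<^sup>2 * tanh ((p - 1) * t)) * tanh ((p - 1) * \<theta>)"
      using tanh_ratio_mono[of "p - 1" t \<theta>] p that unfolding critical[symmetric] by (simp add: mult_ac)
    then show ?thesis using pos by simp
  qed
  show "\<rho>\<^sup>2 * tanh ((p - 1) * t) \<le> tanh t" if "\<theta> \<le> t"
  proof -
    have "(\<rho>\<^sup>2 * tanh ((p - 1) * t)) * tanh ((p - 1) * \<theta>) \<le> tanh t * tanh ((p - 1) * \<theta>)"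
      using tanh_ratio_mono[of "p - 1" \<theta> t] p that \<theta> unfolding critical[symmetric] by (simp add: mult_ac)
    then show ?thesis using pos by simp
  qed
qed

lemma log_norm_max:
  assumes "0 \<le> t"
  shows "ln (cosh (p * t)) - p / 2 * ln (W t) \<le> ln (cosh (p * \<theta>)) - p / 2 * ln (W \<theta>)"
proof -
  have fac: "0 \<le> p * cosh u * cosh ((p - 1) * u) / (cosh (p * u) * W u)" for u
    using p W_pos[of u] by simp
  show ?thesis
  proof (cases "t \<le> \<theta>")
    case True
    show ?thesis
    proof (rule DERIV_nonneg_imp_nondecreasing[OF True])
      fix u assume "t \<le> u" "u \<le> \<theta>"
      then have "tanh u \<le> \<rho>\<^sup>2 * tanh ((p - 1) * u)"
        using sign_before[of u] assms by (cases "u = 0") auto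
      then have "0 \<le> \<rho>\<^sup>2 * tanh ((p - 1) * u) - tanh u" by simp
      from mult_nonneg_nonneg[OF fac[of u] this] log_norm_deriv[of u]
      show "\<exists>D. ((\<lambda>t. ln (cosh (p * t)) - p / 2 * ln (W t)) has_real_derivative D) (at u) \<and> 0 \<le> D"
        by blast
    qed
  next
    case False
    then have "\<theta> \<le> t" by simp
    then show ?thesis
    proof (rule DERIV_nonpos_imp_nonincreasing)
      fix u assume "\<theta> \<le> u" "u \<le> t"
      then have "\<rho>\<^sup>2 * tanh ((p - 1) * u) \<le> tanh u"
        by (intro sign_after)
      then have "\<rho>\<^sup>2 * tanh ((p - 1) * u) - tanh u \<le> 0" by simp
      from mult_nonneg_nonpos[OF fac[of u] this] log_norm_deriv[of u]
      show "\<exists>D. ((\<lambda>t. ln (cosh (p * t)) - p / 2 * ln (W t)) has_real_derivative D) (at u) \<and> D \<le> 0"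
        by blast
    qed
  qed
qed

lemma cosh_le: "0 \<le> t \<Longrightarrow> cosh (p * t) \<le> cosh (p * \<theta>) / W \<theta> powr (p / 2) * W t powr (p / 2)"
proof -
  assume "0 \<le> t"
  then have "exp (ln (cosh (p * t))) \<le> exp (ln (cosh (p * \<theta>)) - p / 2 * ln (W \<theta>) + p / 2 * ln (W t))"
    using log_norm_max[OF \<open>0 \<le> t\<close>] by (simp only: exp_le_cancel_iff)
  then show ?thesis
    using W_pos[of t] W_pos[of \<theta>] by (simp add: exp_add exp_diff powr_def)
qed

lemma ineq_ordered:
  assumes "0 < u" "0 \<le> v" "\<rho> * v < u"
  shows "(u + \<rho> * v) powr p + (u - \<rho> * v) powr p \<le> 2 * C * (u\<^sup>2 + v\<^sup>2) powr (p / 2)"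
proof -
  define z where "z = \<rho> * v / u"
  define t where "t = artanh z"
  have z: "0 \<le> z" "z < 1" using assms \<rho> by (auto simp: z_def)
  have tz: "tanh t = z" unfolding t_def using z by (intro tanh_artanh) auto
  then have t: "0 \<le> t" using z by (metis tanh_real_nonneg_iff)
  have z1: "1 + z = exp t / cosh t" "1 - z = exp (- t) / cosh t"
    unfolding tz[symmetric] cosh_plus_sinh[symmetric] cosh_minus_sinh[symmetric]
    by (simp_all add: tanh_def add_divide_distrib diff_divide_distrib)
  have e: "u + \<rho> * v = u * (exp t / cosh t)" "u - \<rho> * v = u * (exp (- t) / cosh t)"
    unfolding z1[symmetric] z_def using assms by (auto simp: field_simps)
  have "(u + \<rho> * v) powr p + (u - \<rho> * v) powr p
      = u powr p / cosh t powr p * (exp (p * t) + exp (- (p * t)))"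
    unfolding e using assms(1) by (simp add: powr_mult powr_divide exp_powr_real algebra_simps)
  also have "\<dots> = u powr p / cosh t powr p * (2 * cosh (p * t))"
  proof -
    have "exp (p * t) + exp (- (p * t)) = 2 * cosh (p * t)" by (simp add: cosh_def)
    then show ?thesis by (simp only:)
  qed
  also have "\<dots> \<le> u powr p / cosh t powr p * (2 * (cosh (p * \<theta>) / W \<theta> powr (p / 2) * W t powr (p / 2)))"
    using cosh_le[OF t] by (intro mult_left_mono) auto
  also have "\<dots> = 2 * (cosh (p * \<theta>) / W \<theta> powr (p / 2)) * (u powr p / cosh t powr p * W t powr (p / 2))"
    by (simp add: mult_ac)
  also have "u powr p / cosh t powr p * W t powr (p / 2) = ((u / cosh t)\<^sup>2 * W t) powr (p / 2)"
    using assms W_pos[of t] by (simp add: powr_mult power2_powr_half powr_divide)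
  also have "(u / cosh t)\<^sup>2 * W t = u\<^sup>2 * (\<rho>\<^sup>2 + (tanh t)\<^sup>2)"
    unfolding W_def tanh_def by (simp add: power_divide field_simps)
  also have "\<dots> = \<rho>\<^sup>2 * (u\<^sup>2 + v\<^sup>2)"
    unfolding tz z_def using assms by (simp add: power_divide power_mult_distrib field_simps)
  also have "\<dots> powr (p / 2) = \<rho> powr p * (u\<^sup>2 + v\<^sup>2) powr (p / 2)"
    using \<rho> by (simp add: powr_mult power2_powr_half)
  finally show ?thesis by (simp add: C_def mult_ac)
qed

text \<open>The boundary case \<open>\<rho> * v = u\<close>, in which the parameter \<open>t\<close>
  would be infinite. Here \<open>\<rho> = 1\<close> forces \<open>p = 2\<close> by
  \<open>critical\<close>, and both sides agree.\<close>

lemma ineq_diagonal: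
  assumes "\<rho> = 1" "0 \<le> u"
  shows "(u + u) powr p \<le> 2 * C * (u\<^sup>2 + u\<^sup>2) powr (p / 2)"
proof -
  have "tanh ((p - 1) * \<theta>) = tanh \<theta>" using critical assms by simp
  then have "(p - 1) * \<theta> = \<theta>" by simp
  then have p2: "p = 2" using \<theta> by simp
  have W1: "W \<theta> = cosh (2 * \<theta>)" by (simp only: W_def cosh_double) (simp add: assms(1))
  have C1: "C = 1" by (simp only: C_def W1) (simp add: assms(1) p2)
  have "(u + u) powr 2 = 4 * u\<^sup>2"
    using assms(2) by (cases "u = 0") (auto simp: powr_numeral power2_eq_square)
  then show ?thesis
    by (simp only: C1) (simp add: p2)
qed

lemma ineq_le:
  assumes "0 \<le> v" "v \<le> u"
  shows "(u + \<rho> * v) powr p + (u - \<rho> * v) powr p \<le> 2 * C * (u\<^sup>2 + v\<^sup>2) powr (p / 2)"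
proof (cases "\<rho> * v < u")
  case True
  then have "0 < u" using assms \<rho> by (cases "u = 0") auto
  with True assms show ?thesis by (intro ineq_ordered)
next
  case False
  have "\<rho> * v \<le> 1 * v" using \<rho> assms by (intro mult_right_mono) auto
  with False assms have v: "v = u" "\<rho> * v = u" by linarith+
  show ?thesis
  proof (cases "u = 0")
    case True
    with v show ?thesis using p by simp
  next
    case False
    with v have "\<rho> = 1" by simp
    moreover have "u + \<rho> * v = u + u" "u - \<rho> * v = 0" using v by auto
    ultimately show ?thesis using ineq_diagonal[of u] v(1) p assms by simp
  qed
qed

lemma ineq:
  "\<bar>a + \<rho> * b\<bar> powr p + \<bar>a - \<rho> * b\<bar> powr p \<le> 2 * C * (a\<^sup>2 + b\<^sup>2) powr (p / 2)"
proof -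
  define u v where "u = \<bar>a\<bar>" and "v = \<bar>b\<bar>"
  have uv: "0 \<le> u" "0 \<le> v" "a\<^sup>2 + b\<^sup>2 = u\<^sup>2 + v\<^sup>2" by (auto simp: u_def v_def)
  define c where "c = \<rho> * b"
  have \<rho>b: "\<bar>\<rho> * b\<bar> = \<rho> * v" using \<rho> by (simp add: v_def abs_mult)
  have "\<bar>a + \<rho> * b\<bar> powr p + \<bar>a - \<rho> * b\<bar> powr p = (u + \<rho> * v) powr p + \<bar>u - \<rho> * v\<bar> powr p"
  proof (cases "0 \<le> a * c")
    case True
    then have "\<bar>a + \<rho> * b\<bar> = u + \<rho> * v" "\<bar>a - \<rho> * b\<bar> = \<bar>u - \<rho> * v\<bar>"
      unfolding \<rho>b[symmetric] u_def c_def[symmetric] by (auto simp: zero_le_mult_iff)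
    then show ?thesis by simp
  next
    case False
    then have "\<bar>a - \<rho> * b\<bar> = u + \<rho> * v" "\<bar>a + \<rho> * b\<bar> = \<bar>u - \<rho> * v\<bar>"
      unfolding \<rho>b[symmetric] u_def c_def[symmetric] by (auto simp: not_le mult_less_0_iff)
    then show ?thesis by simp
  qed
  also have "\<dots> \<le> 2 * C * (u\<^sup>2 + v\<^sup>2) powr (p / 2)"
  proof (cases "v \<le> u")
    case True
    have "\<rho> * v \<le> 1 * v" using \<rho> uv by (intro mult_right_mono) auto
    then have "\<bar>u - \<rho> * v\<bar> = u - \<rho> * v" using True by simp
    then show ?thesis using ineq_le[OF uv(2) True] by simp
  next
    case False
    \<comment> \<open>For \<open>u < v\<close>, exchanging \<open>u\<close> and \<open>v\<close>
      keeps the right-hand side and decreases neither of the two bases on the left.\<close>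
    have "0 \<le> (1 - \<rho>) * (v - u)" "0 \<le> (1 - \<rho>) * (v + u)" "0 \<le> (1 + \<rho>) * (v - u)"
      using \<rho> uv False by (intro mult_nonneg_nonneg; simp)+
    then have le: "u + \<rho> * v \<le> v + \<rho> * u" "\<bar>u - \<rho> * v\<bar> \<le> v - \<rho> * u"
      by (simp_all add: algebra_simps abs_le_iff)
    have "(u + \<rho> * v) powr p + \<bar>u - \<rho> * v\<bar> powr p \<le> (v + \<rho> * u) powr p + (v - \<rho> * u) powr p"
      using powr_mono2[OF _ _ le(1), of p] powr_mono2[OF _ _ le(2), of p] p uv \<rho> by (intro add_mono) auto
    also have "\<dots> \<le> 2 * C * (v\<^sup>2 + u\<^sup>2) powr (p / 2)"
      using ineq_le[of u v] False uv by simp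
    finally show ?thesis by (simp add: add.commute)
  qed
  finally show ?thesis unfolding uv(3) .
qed

text \<open>The two-point inequality in the last coordinate leaves a sum of two squares under the
  power \<open>p / 2\<close>. Minkowski applies to these squares because
  \<open>1 \<le> p / 2\<close>, which is where \<open>2 \<le> p\<close> matters.\<close>

lemma noise_norm:
  "(\<Sum>x\<in>cube n. \<bar>walsh_sum n (\<lambda>\<alpha>. \<rho> ^ weight n \<alpha> * d \<alpha>) x\<bar> powr p)
    \<le> (2 * C) ^ n * (\<Sum>\<alpha>\<in>cube n. (d \<alpha>)\<^sup>2) powr (p / 2)"
proof (induction n arbitrary: d)
  case 0
  show ?case by (simp add: sum_cube_0 walsh_sum_def power2_powr_half card_cube)
next
  case (Suc n)
  define g0 where "g0 = walsh_sum n (\<lambda>\<alpha>. \<rho> ^ weight n \<alpha> * d (\<alpha>(n := 0)))"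
  define g1 where "g1 = walsh_sum n (\<lambda>\<alpha>. \<rho> ^ weight n \<alpha> * d (\<alpha>(n := 1)))"
  let ?S0 = "\<Sum>\<alpha>\<in>cube n. (d (\<alpha>(n := 0)))\<^sup>2" and ?S1 = "\<Sum>\<alpha>\<in>cube n. (d (\<alpha>(n := 1)))\<^sup>2"
  have g1': "walsh_sum n (\<lambda>\<alpha>. \<rho> ^ weight (Suc n) (\<alpha>(n := 1)) * d (\<alpha>(n := 1))) x = \<rho> * g1 x" for x
    unfolding g1_def walsh_sum_def by (simp add: sum_distrib_left mult_ac)
  have "(\<Sum>x\<in>cube (Suc n). \<bar>walsh_sum (Suc n) (\<lambda>\<alpha>. \<rho> ^ weight (Suc n) \<alpha> * d \<alpha>) x\<bar> powr p)
      = (\<Sum>x\<in>cube n. \<bar>g0 x + \<rho> * g1 x\<bar> powr p + \<bar>g0 x - \<rho> * g1 x\<bar> powr p)"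
    unfolding sum_cube_Suc walsh_sum_Suc g1' by (simp add: g0_def)
  also have "\<dots> \<le> (\<Sum>x\<in>cube n. 2 * C * ((g0 x)\<^sup>2 + (g1 x)\<^sup>2) powr (p / 2))"
    by (intro sum_mono ineq)
  also have "\<dots> = 2 * C * (\<Sum>x\<in>cube n. ((g0 x)\<^sup>2 + (g1 x)\<^sup>2) powr (p / 2))"
    by (simp add: sum_distrib_left)
  also have "\<dots> \<le> 2 * C * ((2 * C) ^ n * (?S0 + ?S1) powr (p / 2))"
  proof (intro mult_left_mono minkowski_sum)
    show "(\<Sum>x\<in>cube n. ((g0 x)\<^sup>2) powr (p / 2)) \<le> (2 * C) ^ n * ?S0 powr (p / 2)"
      unfolding power2_powr_half g0_def by (rule Suc.IH)
    show "(\<Sum>x\<in>cube n. ((g1 x)\<^sup>2) powr (p / 2)) \<le> (2 * C) ^ n * ?S1 powr (p / 2)"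
      unfolding power2_powr_half g1_def by (rule Suc.IH)
  qed (use p C_pos in \<open>auto intro: sum_nonneg\<close>)
  finally show ?case
    by (simp add: sum_cube_Suc sum.distrib mult_ac)
qed

end

lemma (in two_point) moment_bound:
  assumes deg: "\<And>\<alpha>. s < weight n \<alpha> \<Longrightarrow> c \<alpha> = 0"
  shows "(\<Sum>x\<in>cube n. \<bar>walsh_sum n c x\<bar> powr p)
    \<le> (2 * C) ^ n * (\<rho> powr (- 2 * real s) * (\<Sum>\<alpha>\<in>cube n. (c \<alpha>)\<^sup>2)) powr (p / 2)"
proof -
  define d where "d \<alpha> = c \<alpha> / \<rho> ^ weight n \<alpha>" for \<alpha>
  have "c = (\<lambda>\<alpha>. \<rho> ^ weight n \<alpha> * d \<alpha>)"
    using \<rho> by (simp add: d_def)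
  then have "(\<Sum>x\<in>cube n. \<bar>walsh_sum n c x\<bar> powr p)
      \<le> (2 * C) ^ n * (\<Sum>\<alpha>\<in>cube n. (d \<alpha>)\<^sup>2) powr (p / 2)"
    using noise_norm[of n d] by simp
  also have "\<dots> \<le> (2 * C) ^ n * (\<rho> powr (- 2 * real s) * (\<Sum>\<alpha>\<in>cube n. (c \<alpha>)\<^sup>2)) powr (p / 2)"
  proof (intro mult_left_mono powr_mono2)
    show "(\<Sum>\<alpha>\<in>cube n. (d \<alpha>)\<^sup>2) \<le> \<rho> powr (- 2 * real s) * (\<Sum>\<alpha>\<in>cube n. (c \<alpha>)\<^sup>2)"
      unfolding sum_distrib_left
    proof (rule sum_mono)
      fix \<alpha>
      show "(d \<alpha>)\<^sup>2 \<le> \<rho> powr (- 2 * real s) * (c \<alpha>)\<^sup>2"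
      proof (cases "s < weight n \<alpha>")
        case True
        then show ?thesis by (simp add: d_def deg)
      next
        case False
        have "(d \<alpha>)\<^sup>2 = \<rho> powr (- (2 * real (weight n \<alpha>))) * (c \<alpha>)\<^sup>2"
          using \<rho> by (simp add: d_def power_divide powr_minus powr_realpow[symmetric] powr_powr
              power_mult[symmetric] inverse_eq_divide mult.commute)
        also have "\<dots> \<le> \<rho> powr (- 2 * real s) * (c \<alpha>)\<^sup>2"
          using \<rho> False by (intro mult_right_mono powr_mono') auto
        finally show ?thesis .
      qed
    qed
  qed (use C_pos p in \<open>auto intro: sum_nonneg\<close>)
  finally show ?thesis .
qed

section \<open>Tail bounds from moments\<close>

lemma markov_count:
  fixes g :: "'a \<Rightarrow> real"
  assumes "finite A" "0 < L" "0 < p"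
  shows "real (card {x \<in> A. L \<le> \<bar>g x\<bar>}) * L powr p \<le> (\<Sum>x\<in>A. \<bar>g x\<bar> powr p)"
proof -
  have "real (card {x \<in> A. L \<le> \<bar>g x\<bar>}) * L powr p = (\<Sum>x | x \<in> A \<and> L \<le> \<bar>g x\<bar>. L powr p)"
    by simp
  also have "\<dots> \<le> (\<Sum>x | x \<in> A \<and> L \<le> \<bar>g x\<bar>. \<bar>g x\<bar> powr p)"
    using assms by (intro sum_mono powr_mono2) auto
  also have "\<dots> \<le> (\<Sum>x\<in>A. \<bar>g x\<bar> powr p)"
    using assms by (intro sum_mono2) auto
  finally show ?thesis .
qed

lemma cube_norm_pos: "\<exists>x\<in>cube n. f x \<noteq> 0 \<Longrightarrow> 0 < cube_norm n 2 f"
  unfolding cube_norm_2 by (auto intro!: divide_pos_pos sum_pos2)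

text \<open>Past the threshold, \<open>tau\<close> is the exponent of the second moment bound.\<close>

lemma tail_second_moment:
  assumes f: "\<exists>x\<in>cube n. f x \<noteq> 0"
  shows "cube_prob n (\<lambda>x. \<bar>f x\<bar> \<ge> cube_norm n 2 f * 2 powr (((1 + hx - hy) / 2 - 1 / 2 * hx) * real n))
    \<le> 2 powr ((hy - 1) * real n)"
proof -
  define N where "N = cube_norm n 2 f"
  define E where "E = ((1 + hx - hy) / 2 - 1 / 2 * hx) * real n"
  define L where "L = N * 2 powr E"
  have N: "0 < N" unfolding N_def using f by (rule cube_norm_pos)
  have N2: "2 ^ n * N\<^sup>2 = (\<Sum>x\<in>cube n. (f x)\<^sup>2)"
    unfolding N_def cube_norm_2 by (simp add: sum_nonneg)
  have sq: "\<bar>u\<bar> powr 2 = u\<^sup>2" for u :: real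
    by (cases "u = 0") (simp_all add: powr_numeral)
  have "E * 2 = (1 - hy) * real n"
    unfolding E_def by (simp add: algebra_simps add_divide_distrib diff_divide_distrib)
  moreover have "L powr 2 = N\<^sup>2 * 2 powr (E * 2)"
    unfolding L_def using N by (simp add: powr_mult powr_powr powr_numeral)
  ultimately have L2: "L powr 2 = N\<^sup>2 * 2 powr ((1 - hy) * real n)"
    by (simp only:)
  have "real (card {x \<in> cube n. L \<le> \<bar>f x\<bar>}) * L powr 2 \<le> 2 ^ n * N\<^sup>2"
    using markov_count[of "cube n" L 2 f] N unfolding N2 sq by (simp add: L_def)
  then have "real (card {x \<in> cube n. L \<le> \<bar>f x\<bar>}) * 2 powr ((1 - hy) * real n) \<le> 2 ^ n"
    unfolding L2 using N by (simp add: mult.left_commute mult_le_cancel_left)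
  then have "real (card {x \<in> cube n. L \<le> \<bar>f x\<bar>}) / 2 ^ n \<le> 1 / 2 powr ((1 - hy) * real n)"
    by (simp add: field_simps)
  also have "\<dots> = 2 powr ((hy - 1) * real n)"
    by (simp add: powr_minus_divide[symmetric] algebra_simps)
  finally show ?thesis
    unfolding cube_prob_eq L_def N_def E_def .
qed

text \<open>Stands in for the moment argument at \<open>y = 0\<close>, where the exponent
  \<open>p\<close> would be infinite and \<open>tau x 0\<close> is \<open>bin_entropy x\<close>.
  Cauchy-Schwarz over the characters of weight at most \<open>s\<close> puts every value strictly
  below the level.\<close>

lemma tail_at_zero:
  assumes deg: "poly_degree_le n s f" and f: "\<exists>x\<in>cube n. f x \<noteq> 0"
    and s: "0 < s" "real s \<le> real n / 2"
  shows "cube_prob n (\<lambda>x. \<bar>f x\<bar> \<ge> cube_norm n 2 f * 2 powr (bin_entropy (real s / real n) / 2 * real n)) = 0"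
proof -
  obtain c where c: "\<And>x. x \<in> cube n \<Longrightarrow> f x = walsh_sum n c x" "\<And>\<alpha>. s < weight n \<alpha> \<Longrightarrow> c \<alpha> = 0"
    using deg by (rule poly_degree_leE) blast
  define N where "N = cube_norm n 2 f"
  have N: "0 < N" unfolding N_def using f by (rule cube_norm_pos)
  have "(\<Sum>x\<in>cube n. (f x)\<^sup>2) = 2 ^ n * (\<Sum>\<alpha>\<in>cube n. (c \<alpha>)\<^sup>2)"
    unfolding parseval[symmetric] by (intro sum.cong) (auto simp: c)
  then have N2: "N\<^sup>2 = (\<Sum>\<alpha>\<in>cube n. (c \<alpha>)\<^sup>2)"
    unfolding N_def cube_norm_2 by (simp add: sum_nonneg)
  have "\<bar>f x\<bar> < N * 2 powr (bin_entropy (real s / real n) / 2 * real n)" if x: "x \<in> cube n" for x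
  proof (rule power2_less_imp_less)
    let ?w = "\<lambda>\<alpha>. if weight n \<alpha> \<le> s then walsh n \<alpha> x else 0"
    have "(f x)\<^sup>2 = (\<Sum>\<alpha>\<in>cube n. c \<alpha> * ?w \<alpha>)\<^sup>2"
      unfolding c(1)[OF x] walsh_sum_def using c(2) by (intro arg_cong[of _ _ "\<lambda>x. x\<^sup>2"] sum.cong) auto
    also have "\<dots> \<le> (\<Sum>\<alpha>\<in>cube n. (c \<alpha>)\<^sup>2) * (\<Sum>\<alpha>\<in>cube n. (?w \<alpha>)\<^sup>2)"
      by (rule Cauchy_Schwarz_ineq_sum)
    also have "(\<Sum>\<alpha>\<in>cube n. (?w \<alpha>)\<^sup>2) = (\<Sum>\<alpha>\<in>cube n. if weight n \<alpha> \<le> s then 1 else 0)"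
      by (intro sum.cong) (auto simp: walsh_def power_mult[symmetric] mult.commute)
    also have "\<dots> = (\<Sum>k\<le>n. real (n choose k) * (if k \<le> s then 1 else 0))"
      by (rule sum_cube_weight)
    also have "\<dots> = (\<Sum>k\<le>s. real (n choose k))"
      using s by (intro sum.mono_neutral_cong_right) auto
    finally have "(f x)\<^sup>2 \<le> N\<^sup>2 * (\<Sum>k\<le>s. real (n choose k))" unfolding N2 .
    also have "\<dots> < N\<^sup>2 * 2 powr (bin_entropy (real s / real n) * real n)"
      using sum_binomial_less_entropy[OF s] N by simp
    also have "2 powr (bin_entropy (real s / real n) * real n)
        = (2 powr (bin_entropy (real s / real n) / 2 * real n))\<^sup>2"
      by (simp add: powr_numeral[symmetric] powr_powr del: powr_numeral)
    finally show "\<bar>f x\<bar>\<^sup>2 < (N * 2 powr (bin_entropy (real s / real n) / 2 * real n))\<^sup>2"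
      by (simp add: power_mult_distrib)
  qed (use N in simp)
  then have "{x \<in> cube n. N * 2 powr (bin_entropy (real s / real n) / 2 * real n) \<le> \<bar>f x\<bar>} = {}"
    by (auto simp: not_le)
  then show ?thesis
    unfolding cube_prob_eq N_def[symmetric] by simp
qed

lemma ln_cosh: "ln (cosh t) = - (ln (1 + tanh t) + ln (1 - tanh t)) / 2" for t :: real
proof -
  have "(1 + tanh t) * (1 - tanh t) = 1 / (cosh t)\<^sup>2"
  proof -
    have "(1 + tanh t) * (1 - tanh t) = ((cosh t)\<^sup>2 - (sinh t)\<^sup>2) / (cosh t)\<^sup>2"
      by (simp add: tanh_def power2_eq_square algebra_simps diff_divide_distrib)
    then show ?thesis by (simp add: cosh_square_eq)
  qed
  moreover have "0 < 1 + tanh t" "0 < 1 - tanh t"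
    using tanh_real_bounds[of t] by auto
  ultimately have "ln (1 + tanh t) + ln (1 - tanh t) = ln (1 / (cosh t)\<^sup>2)"
    using ln_mult_pos[of "1 + tanh t" "1 - tanh t"] by (simp only:)
  also have "\<dots> = - 2 * ln (cosh t)"
    by (simp add: ln_div ln_realpow)
  finally show ?thesis by simp
qed

text \<open>The exponent \<open>p\<close> is the one for which the maximum of \<open>H(y) + p tau(x, y)\<close> over \<open>y\<close> is attained at
  the given \<open>y\<close>; \<open>\<rho>\<close> makes \<open>t = sqrt (x / (1 - x))\<close> the extremal point of the two-point inequality.\<close>

locale tail_region = saddle_region +
  assumes y_pos: "0 < y"
begin

definition "\<theta> = artanh z"
definition "p = artanh (1 - 2 * y) / \<theta>"
definition "\<rho> = z * sqrt ((1 - x) / x)"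

lemma tanh_\<theta>: "tanh \<theta> = z" and \<theta>_pos: "0 < \<theta>" and tanh_p\<theta>: "tanh (p * \<theta>) = 1 - 2 * y"
proof -
  show t: "tanh \<theta> = z" unfolding \<theta>_def using z_pos z_less_1 by (intro tanh_artanh) auto
  then show \<theta>_pos: "0 < \<theta>" using z_pos by (metis tanh_real_pos_iff)
  then have "p * \<theta> = artanh (1 - 2 * y)" by (simp add: p_def)
  then show "tanh (p * \<theta>) = 1 - 2 * y" using y_pos y_less by (simp add: tanh_artanh)
qed

lemma \<rho>_sq: "\<rho>\<^sup>2 = z\<^sup>2 * (1 - x) / x"
  unfolding \<rho>_def using x by (simp add: power_mult_distrib)

sublocale two_point p \<rho> \<theta>
proof
  show "0 < \<theta>" by (rule \<theta>_pos)
  show "0 < \<rho>" unfolding \<rho>_def using z_pos x by simp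
  have "\<rho>\<^sup>2 \<le> 1\<^sup>2" unfolding \<rho>_sq using z_sq_le x by (simp add: field_simps)
  then show "\<rho> \<le> 1" by (rule power2_le_imp_le) simp
  show "2 \<le> p"
  proof -
    \<comment> \<open>In terms of \<open>tanh\<close> the claim is
      \<open>2 z / (1 + z^2) \<le> 1 - 2 y\<close>. Eliminating \<open>y\<close> by the quadratic
      leaves a product of two nonnegative factors, the second of which vanishes exactly at the
      threshold.\<close>
    have u: "z\<^sup>2 < 1" using z_pos z_less_1 by (simp add: power_less_one_iff)
    have "0 \<le> (1 - z\<^sup>2) * (x - (1 - x) * z\<^sup>2)"
      using u z_sq_le by (intro mult_nonneg_nonneg) auto
    also have "\<dots> = ((1 - x) * z\<^sup>2 + x) * (1 + z\<^sup>2) - 2 * z\<^sup>2"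
      by (simp add: power2_eq_square algebra_simps)
    also have "(1 - x) * z\<^sup>2 + x = (1 - 2 * y) * z" using quadratic by simp
    finally have "z * (2 * z) \<le> z * ((1 - 2 * y) * (1 + z\<^sup>2))"
      by (simp add: power2_eq_square algebra_simps)
    then have "2 * z \<le> (1 - 2 * y) * (1 + z\<^sup>2)" using z_pos by simp
    moreover have "tanh (2 * \<theta>) = 2 * z / (1 + z\<^sup>2)"
      using tanh_add[of \<theta> \<theta>] by (simp add: tanh_\<theta> power2_eq_square)
    ultimately have "tanh (2 * \<theta>) \<le> tanh (p * \<theta>)"
      unfolding tanh_p\<theta> by (simp add: pos_divide_le_eq add_pos_nonneg)
    then show ?thesis using \<theta>_pos by simp
  qed
  show "\<rho>\<^sup>2 * tanh ((p - 1) * \<theta>) = tanh \<theta>"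
  proof -
    \<comment> \<open>By the addition formula the critical equation is
      \<open>(1 - x) z (T - z) = x (1 - T z)\<close>, which is the saddle quadratic once
      more.\<close>
    define T where "T = 1 - 2 * y"
    have "tanh ((p - 1) * \<theta>) = tanh (p * \<theta> + (- \<theta>))" by (simp add: algebra_simps)
    also have "\<dots> = (T - z) / (1 - T * z)"
      by (subst tanh_add) (simp_all add: tanh_\<theta> tanh_p\<theta> T_def)
    finally have 1: "tanh ((p - 1) * \<theta>) = (T - z) / (1 - T * z)" .
    have "T * z < 1 * 1"
      using z_pos z_less_1 y_pos y_less unfolding T_def by (intro mult_strict_mono) auto
    then have 2: "1 - T * z \<noteq> 0" by simp
    have "z * ((1 - x) * z * (T - z)) = z * (x * (1 - T * z))"
    proof -
      have Tz: "T * z = (1 - x) * z\<^sup>2 + x" using quadratic by (simp add: T_def)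
      have "(1 - x) * z * (T - z) = (1 - x) * (T * z) - (1 - x) * z\<^sup>2"
        by (simp add: power2_eq_square algebra_simps)
      also have "\<dots> = x * (1 - T * z)"
        unfolding Tz by (simp add: power2_eq_square algebra_simps)
      finally show ?thesis by simp
    qed
    then show ?thesis
      unfolding \<rho>_sq 1 tanh_\<theta> using 2 x by (simp add: power2_eq_square field_simps)
  qed
qed

text \<open>Stationarity of \<open>H(y) + p tau(x, y)\<close> in \<open>y\<close>: since
  \<open>z\<close> is a critical point of the exponent, the derivative of
  \<open>tau x y * ln 2\<close> in \<open>y\<close> is
  \<open>ln (1 - z) - ln (1 + z)\<close>.\<close>

lemma p_relation: "p * (ln (1 + z) - ln (1 - z)) = ln (1 - y) - ln y"
proof -
  have 1: "2 * \<theta> = ln (1 + z) - ln (1 - z)"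
    unfolding \<theta>_def artanh_def using z_pos z_less_1 by (simp add: ln_div)
  have 2: "2 * (p * \<theta>) = ln (1 - y) - ln y"
  proof -
    have "(1 + (1 - 2 * y)) / (1 - (1 - 2 * y)) = (1 - y) / y"
      using y_pos by (simp add: field_simps)
    then show ?thesis
      unfolding p_def artanh_def using y_pos y_less \<theta>_pos by (simp add: ln_div)
  qed
  show ?thesis unfolding 1[symmetric] 2[symmetric] by simp
qed

lemma ln_\<rho>: "ln \<rho> = ln z + (ln (1 - x) - ln x) / 2"
  unfolding \<rho>_def using z_pos x by (simp add: ln_mult ln_sqrt ln_div)

lemma ln_C: "ln C = - ln 2 - (ln y + ln (1 - y)) / 2 + p / 2 * (ln (1 + z) + ln (1 - z)) + p / 2 * ln (1 - x)"
proof -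
  have "W \<theta> = (cosh \<theta>)\<^sup>2 * (\<rho>\<^sup>2 + z\<^sup>2)"
    unfolding W_def tanh_\<theta>[symmetric] tanh_def by (simp add: power_divide algebra_simps)
  also have "\<rho>\<^sup>2 + z\<^sup>2 = z\<^sup>2 / x"
    unfolding \<rho>_sq using x by (simp add: field_simps)
  finally have "ln (W \<theta>) = 2 * ln (cosh \<theta>) + (2 * ln z - ln x)"
    using z_pos x by (simp add: ln_mult ln_div ln_realpow)
  then have lnW: "ln (W \<theta>) = - (ln (1 + z) + ln (1 - z)) + (2 * ln z - ln x)"
    unfolding ln_cosh tanh_\<theta> by simp
  have y2: "ln (1 + (1 - 2 * y)) = ln 2 + ln (1 - y)" "ln (1 - (1 - 2 * y)) = ln 2 + ln y"
    using y_pos y_less ln_mult[of 2 "1 - y"] ln_mult[of 2 y] by (simp_all add: algebra_simps)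
  have lncosh: "ln (cosh (p * \<theta>)) = - ln 2 - (ln y + ln (1 - y)) / 2"
    unfolding ln_cosh tanh_p\<theta> y2 by (simp add: field_simps)
  have "ln C = ln (cosh (p * \<theta>)) - p / 2 * ln (W \<theta>) + p * ln \<rho>"
    unfolding C_def using W_pos[of \<theta>] \<rho> by (simp add: ln_mult ln_div ln_powr)
  then show ?thesis
    unfolding lnW lncosh ln_\<rho> by (simp add: field_simps)
qed

text \<open>The left-hand side is the exponent, per coordinate, of the moment bound divided by the
  p-th power of the level. The terms in \<open>z\<close> combine into the left side of
  \<open>p_relation\<close>, so exactly the entropy rate remains.\<close>

lemma exponent_identity:
  "ln C - x * p * ln \<rho> - p * ((tau x y - 1 / 2 * bin_entropy x) * ln 2) = (bin_entropy y - 1) * ln 2"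
proof -
  have "ln C - x * p * ln \<rho> - p * ((tau x y - 1 / 2 * bin_entropy x) * ln 2)
     = ln C - x * p * ln \<rho> - p * (tau x y * ln 2) + p / 2 * (bin_entropy x * ln 2)"
    by (simp add: algebra_simps)
  also have "\<dots> = - ln 2 - (ln y + ln (1 - y)) / 2 - (1 / 2 - y) * (p * (ln (1 + z) - ln (1 - z)))"
    unfolding ln_C ln_\<rho> tau_eq bin_entropy_ln by (simp add: field_simps)
  also have "\<dots> = bin_entropy y * ln 2 - ln 2"
    unfolding p_relation bin_entropy_ln by (simp add: field_simps)
  finally show ?thesis by (simp add: left_diff_distrib)
qed

lemma tail_bound:
  assumes deg: "poly_degree_le n s f" and f: "\<exists>w\<in>cube n. f w \<noteq> 0"
    and n: "0 < n" and xs: "x = real s / real n"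
  shows "cube_prob n (\<lambda>w. \<bar>f w\<bar> \<ge> cube_norm n 2 f * 2 powr ((tau x y - 1 / 2 * bin_entropy x) * real n))
    \<le> 2 powr ((bin_entropy y - 1) * real n)"
proof -
  obtain c where c: "\<And>w. w \<in> cube n \<Longrightarrow> f w = walsh_sum n c w" "\<And>\<alpha>. s < weight n \<alpha> \<Longrightarrow> c \<alpha> = 0"
    using deg by (rule poly_degree_leE) blast
  define N where "N = cube_norm n 2 f"
  define e where "e = (tau x y - 1 / 2 * bin_entropy x) * real n"
  define m where "m = real (card {w \<in> cube n. N * 2 powr e \<le> \<bar>f w\<bar>})"
  have N: "0 < N" unfolding N_def using f by (rule cube_norm_pos)
  have "(\<Sum>w\<in>cube n. (f w)\<^sup>2) = 2 ^ n * (\<Sum>\<alpha>\<in>cube n. (c \<alpha>)\<^sup>2)"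
    unfolding parseval[symmetric] by (intro sum.cong) (auto simp: c)
  then have N2: "N\<^sup>2 = (\<Sum>\<alpha>\<in>cube n. (c \<alpha>)\<^sup>2)"
    unfolding N_def cube_norm_2 by (simp add: sum_nonneg)
  have "m * (N * 2 powr e) powr p \<le> (\<Sum>w\<in>cube n. \<bar>f w\<bar> powr p)"
    unfolding m_def using N p by (intro markov_count) auto
  also have "\<dots> = (\<Sum>w\<in>cube n. \<bar>walsh_sum n c w\<bar> powr p)"
    by (intro sum.cong) (auto simp: c)
  also have "\<dots> \<le> (2 * C) ^ n * (\<rho> powr (- 2 * real s) * N\<^sup>2) powr (p / 2)"
    unfolding N2 using c(2) by (rule moment_bound)
  also have "\<dots> = (2 * C) ^ n * \<rho> powr (- real s * p) * N powr p"
    using N \<rho> by (simp add: powr_mult power2_powr_half powr_powr)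
  finally have "m * 2 powr (e * p) * N powr p \<le> (2 * C) ^ n * \<rho> powr (- real s * p) * N powr p"
    using N by (simp add: powr_mult powr_powr mult_ac)
  then have "m * 2 powr (e * p) \<le> (2 * C) ^ n * \<rho> powr (- real s * p)"
    using N by simp
  then have "m / 2 ^ n \<le> C ^ n * \<rho> powr (- real s * p) / 2 powr (e * p)"
    by (simp add: field_simps power_mult_distrib)
  also have "C ^ n * \<rho> powr (- real s * p) / 2 powr (e * p)
      = exp (real n * (ln C - x * p * ln \<rho> - p * ((tau x y - 1 / 2 * bin_entropy x) * ln 2)))"
  proof -
    have "C ^ n = exp (real n * ln C)" using C_pos by (simp add: exp_of_nat_mult)
    moreover have "\<rho> powr (- real s * p) = exp (- (real n * (x * p * ln \<rho>)))"
      using \<rho> n unfolding xs by (simp add: powr_def)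
    moreover have "2 powr (e * p) = exp (real n * (p * ((tau x y - 1 / 2 * bin_entropy x) * ln 2)))"
      unfolding e_def by (simp add: powr_def mult_ac)
    ultimately show ?thesis
      by (simp only: exp_add[symmetric] exp_diff[symmetric] right_diff_distrib) simp
  qed
  also have "\<dots> = 2 powr ((bin_entropy y - 1) * real n)"
    unfolding exponent_identity powr_2_eq_exp by (simp add: mult_ac)
  finally show ?thesis
    unfolding cube_prob_eq m_def e_def N_def .
qed

end

theorem tail_bound_poly:
  assumes "1 \<le> n" "real s \<le> real n / 2" "poly_degree_le n s f" "\<exists>x\<in>cube n. f x \<noteq> 0"
    and i: "0 \<le> i" "i \<le> real n / 2" "0 < s \<or> i = real n / 2"
  shows "cube_prob n (\<lambda>x. \<bar>f x\<bar> \<ge> cube_norm n 2 f *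
            2 powr ((tau (real s / real n) (i / real n) - 1 / 2 * bin_entropy (real s / real n)) * real n))
          \<le> 2 powr ((bin_entropy (i / real n) - 1) * real n)"
proof -
  let ?x = "real s / real n" and ?y = "i / real n"
  have n: "0 < n" using assms by simp
  consider "i = real n / 2" | "0 < s" "i = 0" | "0 < s" "0 < i" "?y \<le> 1 / 2 - sqrt (?x * (1 - ?x))"
    | "?y > 1 / 2 - sqrt (?x * (1 - ?x))"
    using i by linarith
  then show ?thesis
  proof cases
    case 1
    have "bin_entropy (1 / 2) = 1"
      by (simp add: bin_entropy_def log_def ln_div)
    moreover have "?y = 1 / 2" using 1 n by simp
    moreover have "cube_prob n P \<le> 1" for P
      by (simp add: cube_prob_def)
    ultimately show ?thesis by simp
  next
    case 2
    have "tau ?x 0 = bin_entropy ?x"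
      using 2 n assms(2) by (intro tau_0) (auto simp: field_simps)
    then have "tau ?x ?y - 1 / 2 * bin_entropy ?x = bin_entropy ?x / 2" using 2 by simp
    then show ?thesis
      using tail_at_zero[OF assms(3,4) 2(1) assms(2)] by simp
  next
    case 3
    \<comment> \<open>For \<open>x = 1 / 2\<close> the threshold is 0, so no positive
      \<open>y\<close> lies below it.\<close>
    have "?x \<noteq> 1 / 2"
    proof
      assume "?x = 1 / 2"
      then have "sqrt (?x * (1 - ?x)) = 1 / 2" by (simp add: real_sqrt_divide)
      then have "?y \<le> 0" using 3(3) by simp
      moreover have "0 < ?y" using 3(2) n by simp
      ultimately show False by simp
    qed
    moreover have "?x \<le> 1 / 2" using assms(2) n by (simp add: field_simps)
    ultimately interpret tail_region ?x ?y
      using 3 n by unfold_locales auto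
    show ?thesis
      using assms(3,4) n by (rule tail_bound) simp
  next
    case 4
    then have "tau ?x ?y = (1 + bin_entropy ?x - bin_entropy ?y) / 2"
      by (simp add: tau_def)
    then show ?thesis
      using tail_second_moment[OF assms(4), of "bin_entropy ?x" "bin_entropy ?y"] by (simp only:)
  qed
qed

section \<open>Krawtchouk polynomials\<close>

text \<open>The power series of \<open>(1 - X)^t\<close>. The exponent is real because the
  difference equation is also needed at points between the integers, for the spacing of the
  roots.\<close>

definition alt_binomial :: "real \<Rightarrow> real fps" where
  "alt_binomial t = Abs_fps (\<lambda>k. (-1) ^ k * (t gchoose k))"

definition krawtchouk_fps :: "nat \<Rightarrow> real \<Rightarrow> real fps" where
  "krawtchouk_fps n t = alt_binomial t * fps_binomial (real n - t)"

lemma krawtchouk_fps_nth: "fps_nth (krawtchouk_fps n t) s = krawtchouk n s t"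
  by (simp add: krawtchouk_fps_def krawtchouk_def alt_binomial_def fps_mult_nth)

lemma alt_binomial_Suc: "alt_binomial (t + 1) = (1 - fps_X) * alt_binomial t"
proof (rule fps_ext)
  fix k show "fps_nth (alt_binomial (t + 1)) k = fps_nth ((1 - fps_X) * alt_binomial t) k"
    by (cases k) (simp_all add: alt_binomial_def left_diff_distrib gbinomial_Suc_Suc distrib_left)
qed

lemma fps_binomial_Suc: "fps_binomial (a + 1) = (1 + fps_X) * fps_binomial (a :: real)"
  by (simp add: fps_binomial_add_mult fps_binomial_1 mult.commute)

lemma alt_binomial_deriv: "fps_deriv (alt_binomial t) = - fps_const t * alt_binomial (t - 1)"
proof (rule fps_ext)
  fix k
  have "real (Suc k) * (t gchoose Suc k) = t * ((t - 1) gchoose k)"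
    by (rule gbinomial_absorption)
  then show "fps_nth (fps_deriv (alt_binomial t)) k = fps_nth (- fps_const t * alt_binomial (t - 1)) k"
    by (simp add: alt_binomial_def del: of_nat_Suc)
qed

lemma fps_binomial_deriv': "fps_deriv (fps_binomial a) = fps_const a * fps_binomial (a - 1 :: real)"
proof (rule fps_ext)
  fix k
  have "real (Suc k) * (a gchoose Suc k) = a * ((a - 1) gchoose k)"
    by (rule gbinomial_absorption)
  then show "fps_nth (fps_deriv (fps_binomial a)) k = fps_nth (fps_const a * fps_binomial (a - 1)) k"
    by (simp del: of_nat_Suc)
qed

text \<open>\<open>D\<close> is \<open>(1 - X)^(t - 1) (1 + X)^(n - t - 1)\<close>. The series
  \<open>B (t - 1)\<close>, \<open>B t\<close>, \<open>B (t + 1)\<close> and the derivative of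
  \<open>B t\<close> are all polynomial multiples of it, so both recurrences reduce to polynomial
  identities in \<open>X\<close>.\<close>

context
  fixes n :: nat and t :: real and B :: "real \<Rightarrow> real fps" and D :: "real fps"
  defines "B \<equiv> krawtchouk_fps n" and "D \<equiv> alt_binomial (t - 1) * fps_binomial (real n - t - 1)"
begin

private lemma A: "alt_binomial t = (1 - fps_X) * alt_binomial (t - 1)"
  using alt_binomial_Suc[of "t - 1"] by simp

private lemma F: "fps_binomial (real n - t) = (1 + fps_X) * fps_binomial (real n - t - 1)"
  using fps_binomial_Suc[of "real n - t - 1"] by simp

private lemma B_mid: "B t = (1 - fps_X) * (1 + fps_X) * D"
  unfolding B_def D_def krawtchouk_fps_def A F by (simp add: mult_ac)

private lemma B_plus: "B (t + 1) = (1 - fps_X) * (1 - fps_X) * D"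
proof -
  have "real n - (t + 1) = real n - t - 1" by simp
  then show ?thesis
    unfolding B_def D_def krawtchouk_fps_def alt_binomial_Suc A by (simp only: mult_ac)
qed

private lemma B_minus: "B (t - 1) = (1 + fps_X) * (1 + fps_X) * D"
proof -
  have "real n - (t - 1) = real n - t + 1" by simp
  then show ?thesis
    unfolding B_def D_def krawtchouk_fps_def by (simp only: fps_binomial_Suc F mult_ac)
qed

private lemma B_deriv:
  "fps_deriv (B t) = (fps_const (real n - t) * (1 - fps_X) - fps_const t * (1 + fps_X)) * D"
proof -
  have "fps_deriv (B t) = alt_binomial t * (fps_const (real n - t) * fps_binomial (real n - t - 1))
      + - fps_const t * alt_binomial (t - 1) * fps_binomial (real n - t)"
    unfolding B_def krawtchouk_fps_def fps_deriv_mult alt_binomial_deriv fps_binomial_deriv' ..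
  also have "\<dots> = (fps_const (real n - t) * (1 - fps_X) - fps_const t * (1 + fps_X)) * D"
    unfolding A F D_def by (simp add: algebra_simps del: fps_const_neg)
  finally show ?thesis .
qed

text \<open>Coefficient of \<open>X^s\<close> in
  \<open>(n - t) B (t + 1) + t B (t - 1) = n B t - 2 X (B t)'\<close>. At integers \<open>t\<close>
  it expresses that \<open>K_s\<close> is an eigenfunction of the sum over neighbours on the
  cube.\<close>

lemma krawtchouk_difference:
  "(real n - t) * krawtchouk n s (t + 1) + t * krawtchouk n s (t - 1)
    = (real n - 2 * real s) * krawtchouk n s t"
proof -
  have nt: "fps_const (real n - t) = fps_const (real n) - fps_const t" by simp
  have "fps_const (real n - t) * B (t + 1) + fps_const t * B (t - 1)
      = fps_const (real n) * B t - 2 * (fps_X * fps_deriv (B t))"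
    unfolding B_deriv unfolding B_mid B_plus B_minus nt by (simp add: algebra_simps del: fps_const_sub)
  then have "fps_nth (fps_const (real n - t) * B (t + 1) + fps_const t * B (t - 1)) s
      = fps_nth (fps_const (real n) * B t - 2 * (fps_X * fps_deriv (B t))) s"
    by simp
  moreover have "fps_nth (2 * (fps_X * fps_deriv (B t))) s = 2 * (real s * fps_nth (B t) s)"
    by (cases s) (simp_all add: numeral_fps_const)
  ultimately show ?thesis
    by (simp add: B_def krawtchouk_fps_nth algebra_simps)
qed

private lemma recurrence_fps:
  "fps_deriv (B t) - fps_X * (fps_X * fps_deriv (B t))
    = fps_const (real n - 2 * t) * B t - fps_const (real n) * (fps_X * B t)"
proof -
  have nt: "fps_const (real n - t) = fps_const (real n) - fps_const t"
    "fps_const (real n - 2 * t) = fps_const (real n) - 2 * fps_const t"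
    by (simp_all add: fps_const_sub[symmetric] fps_const_mult[symmetric] fps_numeral_fps_const
        del: fps_const_sub fps_const_mult)
  show ?thesis
    unfolding B_deriv unfolding B_mid nt by (simp add: algebra_simps del: fps_const_sub)
qed

text \<open>Coefficient of \<open>X^(s + 1)\<close> in the differential equation
  \<open>(1 - X^2) (B t)' = (n - 2 t - n X) B t\<close>.\<close>

lemma krawtchouk_recurrence:
  "(real s + 2) * krawtchouk n (Suc (Suc s)) t
    = (real n - 2 * t) * krawtchouk n (Suc s) t - (real n - real s) * krawtchouk n s t"
proof -
  have "fps_nth (fps_deriv (B t) - fps_X * (fps_X * fps_deriv (B t))) (Suc s)
    = fps_nth (fps_const (real n - 2 * t) * B t - fps_const (real n) * (fps_X * B t)) (Suc s)"
    unfolding recurrence_fps ..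
  moreover have "fps_nth (fps_X * (fps_X * fps_deriv (B t))) (Suc s) = real s * fps_nth (B t) s"
    by (cases s) simp_all
  ultimately show ?thesis
    by (simp add: B_def krawtchouk_fps_nth algebra_simps)
qed

end

lemma krawtchouk_0 [simp]: "krawtchouk n 0 t = 1"
  by (simp add: krawtchouk_def)

lemma krawtchouk_1: "krawtchouk n (Suc 0) t = real n - 2 * t"
  by (simp add: krawtchouk_def)

lemma krawtchouk_Suc_n: "krawtchouk (Suc n) (Suc s) t = krawtchouk n (Suc s) t + krawtchouk n s t"
proof -
  have "real (Suc n) - t = real n - t + 1" by simp
  then have "krawtchouk_fps (Suc n) t = (1 + fps_X) * krawtchouk_fps n t"
    unfolding krawtchouk_fps_def by (simp only: fps_binomial_Suc mult_ac)
  then show ?thesis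
    unfolding krawtchouk_fps_nth[symmetric] by (simp add: distrib_right)
qed

lemma krawtchouk_Suc_Suc_n:
  "krawtchouk (Suc n) (Suc s) (t + 1) = krawtchouk n (Suc s) t - krawtchouk n s t"
proof -
  have "real (Suc n) - (t + 1) = real n - t" by simp
  then have "krawtchouk_fps (Suc n) (t + 1) = (1 - fps_X) * krawtchouk_fps n t"
    unfolding krawtchouk_fps_def by (simp only: alt_binomial_Suc mult_ac)
  then show ?thesis
    unfolding krawtchouk_fps_nth[symmetric] by (simp add: left_diff_distrib)
qed

lemma krawtchouk_0_0: "krawtchouk 0 s 0 = (if s = 0 then 1 else 0)"
proof -
  have "alt_binomial 0 = 1"
  proof (rule fps_ext)
    fix k show "fps_nth (alt_binomial 0) k = fps_nth 1 k"
      by (cases k) (auto simp: alt_binomial_def)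
  qed
  then have "krawtchouk_fps 0 0 = 1" by (simp add: krawtchouk_fps_def)
  then show ?thesis unfolding krawtchouk_fps_nth[symmetric] by simp
qed

lemma krawtchouk_cube_eq: "x \<in> cube n \<Longrightarrow> krawtchouk_cube n s x = krawtchouk n s (real (weight n x))"
proof (induction n arbitrary: s x)
  case 0
  then show ?case
    by (simp add: krawtchouk_cube_walsh_sum walsh_sum_def sum_cube_0 krawtchouk_0_0 card_cube)
next
  case (Suc n)
  from Suc.prems obtain b y where x: "x = y(n := b)" and y: "y \<in> cube n" and b: "b = 0 \<or> b = 1"
    unfolding cube_Suc by auto
  have IH: "walsh_sum n (\<lambda>\<alpha>. if weight n \<alpha> = k then 1 else 0) y = krawtchouk n k (real (weight n y))" for k
    using Suc.IH[OF y, of k] by (simp add: krawtchouk_cube_walsh_sum)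
  show ?case
  proof (cases s)
    case 0
    have "walsh_sum n (\<lambda>\<alpha>. 0) y = 0" by (simp add: walsh_sum_def)
    then show ?thesis
      unfolding x krawtchouk_cube_walsh_sum walsh_sum_Suc weight_upd 0 using IH[of 0] by simp
  next
    case (Suc k)
    show ?thesis
      unfolding x krawtchouk_cube_walsh_sum walsh_sum_Suc weight_upd Suc
      using b IH[of k] IH[of "Suc k"] krawtchouk_Suc_n[of n k "real (weight n y)"]
        krawtchouk_Suc_Suc_n[of n k "real (weight n y)"]
      by (auto simp: add.commute)
  qed
qed

lemma sum_krawtchouk_sq: "(\<Sum>i\<le>n. real (n choose i) * (krawtchouk n s (real i))\<^sup>2) = 2 ^ n * real (n choose s)"
proof -
  have "(\<Sum>i\<le>n. real (n choose i) * (krawtchouk n s (real i))\<^sup>2)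
      = (\<Sum>x\<in>cube n. (krawtchouk n s (real (weight n x)))\<^sup>2)"
    by (rule sum_cube_weight[symmetric])
  also have "\<dots> = (\<Sum>x\<in>cube n. (krawtchouk_cube n s x)\<^sup>2)"
    by (intro sum.cong) (auto simp: krawtchouk_cube_eq)
  finally show ?thesis by (simp add: sum_krawtchouk_cube_sq)
qed

text \<open>The recurrence in \<open>s\<close> turns multiplication by \<open>i\<close> into a
  combination of the indices \<open>k\<close>, \<open>k + 1\<close>, \<open>k + 2\<close>, where
  \<open>s = k + 1\<close>. Even the smallest of them exceeds \<open>m\<close>, so an induction with
  varying \<open>s\<close> goes through.\<close>

lemma krawtchouk_moment:
  "m < s \<Longrightarrow> (\<Sum>i\<le>n. real (n choose i) * krawtchouk n s (real i) * real i ^ m) = 0"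
proof (induction m arbitrary: s)
  case 0
  have "(\<Sum>i\<le>n. real (n choose i) * krawtchouk n s (real i)) = (\<Sum>x\<in>cube n. krawtchouk_cube n s x)"
    unfolding sum_cube_weight[symmetric] by (intro sum.cong) (auto simp: krawtchouk_cube_eq)
  with 0 show ?case by (simp add: sum_krawtchouk_cube)
next
  case (Suc m)
  then obtain k where s: "s = Suc k" "m < k" by (cases s) auto
  let ?M = "\<lambda>s. \<Sum>i\<le>n. real (n choose i) * krawtchouk n s (real i) * real i ^ m"
  have "(\<Sum>i\<le>n. real (n choose i) * krawtchouk n s (real i) * real i ^ Suc m)
      = (\<Sum>i\<le>n. real n / 2 * (real (n choose i) * krawtchouk n (Suc k) (real i) * real i ^ m)
        - (real k + 2) / 2 * (real (n choose i) * krawtchouk n (Suc (Suc k)) (real i) * real i ^ m)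
        - (real n - real k) / 2 * (real (n choose i) * krawtchouk n k (real i) * real i ^ m))"
  proof (intro sum.cong refl)
    fix i
    have "real i * krawtchouk n (Suc k) (real i) = real n / 2 * krawtchouk n (Suc k) (real i)
        - (real k + 2) / 2 * krawtchouk n (Suc (Suc k)) (real i)
        - (real n - real k) / 2 * krawtchouk n k (real i)"
      using krawtchouk_recurrence[of k n "real i"] by (simp add: field_simps)
    then have "real (n choose i) * real i ^ m * (real i * krawtchouk n (Suc k) (real i))
        = real (n choose i) * real i ^ m * (real n / 2 * krawtchouk n (Suc k) (real i)
        - (real k + 2) / 2 * krawtchouk n (Suc (Suc k)) (real i)
        - (real n - real k) / 2 * krawtchouk n k (real i))"
      by simp
    then show "real (n choose i) * krawtchouk n s (real i) * real i ^ Suc m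
        = real n / 2 * (real (n choose i) * krawtchouk n (Suc k) (real i) * real i ^ m)
        - (real k + 2) / 2 * (real (n choose i) * krawtchouk n (Suc (Suc k)) (real i) * real i ^ m)
        - (real n - real k) / 2 * (real (n choose i) * krawtchouk n k (real i) * real i ^ m)"
      unfolding s right_diff_distrib by (simp add: mult_ac)
  qed
  also have "\<dots> = real n / 2 * ?M (Suc k) - (real k + 2) / 2 * ?M (Suc (Suc k)) - (real n - real k) / 2 * ?M k"
    by (simp only: sum_subtractf sum_distrib_left)
  also have "\<dots> = 0"
    using s Suc.IH[of k] Suc.IH[of "Suc k"] Suc.IH[of "Suc (Suc k)"] by simp
  finally show ?case .
qed

lemma krawtchouk_orthogonal:
  assumes "degree P < s"
  shows "(\<Sum>i\<le>n. real (n choose i) * krawtchouk n s (real i) * poly P (real i)) = 0"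
proof -
  have "(\<Sum>i\<le>n. real (n choose i) * krawtchouk n s (real i) * poly P (real i))
      = (\<Sum>i\<le>n. \<Sum>m\<le>degree P. coeff P m * (real (n choose i) * krawtchouk n s (real i) * real i ^ m))"
    by (simp add: poly_altdef sum_distrib_left mult_ac)
  also have "\<dots> = (\<Sum>m\<le>degree P. coeff P m * (\<Sum>i\<le>n. real (n choose i) * krawtchouk n s (real i) * real i ^ m))"
    by (subst sum.swap) (simp add: sum_distrib_left)
  also have "\<dots> = 0"
    using assms by (intro sum.neutral) (auto simp: krawtchouk_moment)
  finally show ?thesis .
qed

text \<open>Built from the recurrence instead of the defining sum because each step visibly raises
  the degree by one.\<close>

fun krawtchouk_poly :: "nat \<Rightarrow> nat \<Rightarrow> real poly" where
  "krawtchouk_poly n 0 = 1"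
| "krawtchouk_poly n (Suc 0) = [:real n, -2:]"
| "krawtchouk_poly n (Suc (Suc s)) = smult (1 / (real s + 2))
     ([:real n, -2:] * krawtchouk_poly n (Suc s) - smult (real n - real s) (krawtchouk_poly n s))"

lemma poly_krawtchouk_poly: "poly (krawtchouk_poly n s) t = krawtchouk n s t"
proof (induction n s rule: krawtchouk_poly.induct)
  case (3 n s)
  have "real s + 2 \<noteq> 0" by linarith
  then have K: "krawtchouk n (Suc (Suc s)) t = ((real n - 2 * t) * krawtchouk n (Suc s) t
      - (real n - real s) * krawtchouk n s t) / (real s + 2)"
    unfolding krawtchouk_recurrence[symmetric] by simp
  show ?case unfolding K by (simp add: 3 algebra_simps add_divide_distrib diff_divide_distrib)
qed (simp_all add: krawtchouk_1)

lemma krawtchouk_poly_degree: "degree (krawtchouk_poly n s) = s \<and> krawtchouk_poly n s \<noteq> 0"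
proof (induction n s rule: krawtchouk_poly.induct)
  case (3 n s)
  have "degree ([:real n, -2:] * krawtchouk_poly n (Suc s)) = Suc (Suc s)"
    using 3 by (subst degree_mult_eq) auto
  moreover have "degree (smult (real n - real s) (krawtchouk_poly n s)) < Suc (Suc s)"
    using 3 degree_smult_le[of "real n - real s" "krawtchouk_poly n s"] by linarith
  ultimately have "degree ([:real n, -2:] * krawtchouk_poly n (Suc s)
      + - smult (real n - real s) (krawtchouk_poly n s)) = Suc (Suc s)"
    by (subst degree_add_eq_left) auto
  then have "degree (krawtchouk_poly n (Suc (Suc s))) = Suc (Suc s)"
    by (simp add: add_nonneg_eq_0_iff)
  moreover from this have "krawtchouk_poly n (Suc (Suc s)) \<noteq> 0"
    by (metis degree_0 nat.distinct(1))
  ultimately show ?case by blast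
qed simp_all

text \<open>For \<open>t \<le> 0\<close> the sign in front of \<open>t gchoose k\<close> makes the
  product nonnegative, so no term is negative and the one for \<open>k = 0\<close> is positive.
  Together with the reflection at \<open>n / 2\<close> this confines the roots to the open interval
  from 0 to \<open>n\<close>.\<close>

lemma krawtchouk_pos:
  assumes "t \<le> 0" "s \<le> n"
  shows "0 < krawtchouk n s t"
proof -
  have "0 \<le> (-1) ^ k * (t gchoose k)" for k
  proof -
    have "(-1) ^ k * (t gchoose k) = (of_nat k - t - 1) gchoose k"
      by (subst gbinomial_negated_upper) (simp add: power_add[symmetric] mult.assoc[symmetric])
    also have "\<dots> \<ge> 0"
      unfolding gbinomial_prod_rev using assms by (intro divide_nonneg_nonneg prod_nonneg) auto
    finally show ?thesis .
  qed
  moreover have pos: "0 < (real n - t) gchoose k" if "k \<le> s" for k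
    unfolding gbinomial_prod_rev using assms that by (intro divide_pos_pos prod_pos) auto
  ultimately have "0 \<le> (-1) ^ k * (t gchoose k) * ((real n - t) gchoose (s - k))" if "k \<in> {0..s}" for k
    using that mult_nonneg_nonneg[of "(-1) ^ k * (t gchoose k)" "(real n - t) gchoose (s - k)"]
    by (simp add: less_imp_le)
  then have "0 < (\<Sum>k\<in>{0..s}. (-1) ^ k * (t gchoose k) * ((real n - t) gchoose (s - k)))"
    using pos[of s] by (intro sum_pos2[where i = 0]) auto
  then show ?thesis by (simp add: krawtchouk_def)
qed

lemma krawtchouk_reflect: "krawtchouk n s (real n - t) = (-1) ^ s * krawtchouk n s t"
proof -
  have "krawtchouk n s (real n - t)
      = (\<Sum>k=0..s. (-1) ^ k * ((real n - t) gchoose k) * (t gchoose (s - k)))"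
    by (simp add: krawtchouk_def)
  also have "\<dots> = (\<Sum>k=0..s. (-1) ^ (s - k) * ((real n - t) gchoose (s - k)) * (t gchoose (s - (s - k))))"
    by (rule sum.atLeastAtMost_rev[of _ 0 s, simplified])
  also have "\<dots> = (\<Sum>k=0..s. (-1) ^ s * ((-1) ^ k * (t gchoose k) * ((real n - t) gchoose (s - k))))"
  proof (intro sum.cong refl)
    fix k assume "k \<in> {0..s}"
    then have "s = (s - k) + k" by simp
    then have "(-1) ^ s * (-1) ^ k = (-1 :: real) ^ (s - k) * ((-1) ^ k * (-1) ^ k)"
      by (metis mult.assoc power_add)
    then have "(-1) ^ s * (-1) ^ k = (-1 :: real) ^ (s - k)"
      by (simp add: power_add[symmetric])
    then show "(-1) ^ (s - k) * ((real n - t) gchoose (s - k)) * (t gchoose (s - (s - k)))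
        = (-1) ^ s * ((-1) ^ k * (t gchoose k) * ((real n - t) gchoose (s - k)))"
      using \<open>k \<in> {0..s}\<close> by (simp add: mult.assoc[symmetric]) 
  qed
  finally show ?thesis by (simp add: krawtchouk_def sum_distrib_left)
qed

section \<open>Roots of Krawtchouk polynomials\<close>

text \<open>A root \<open>a\<close> of even order lets \<open>(X - a)^2\<close> be divided out,
  which preserves the parity of all orders and costs only a nonnegative factor. Without roots the
  intermediate value theorem applies.\<close>

lemma poly_same_sign:
  fixes p :: "real poly"
  assumes "p \<noteq> 0" "\<And>x. even (order x p)"
  shows "(\<forall>x. 0 \<le> poly p x) \<or> (\<forall>x. poly p x \<le> 0)"
  using assms
proof (induction "degree p" arbitrary: p rule: less_induct)
  case less
  show ?case
  proof (cases "\<exists>a. poly p a = 0")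
    case True
    then obtain a where a: "poly p a = 0" by blast
    then have "order a p \<noteq> 0" using less.prems order_root by blast
    with less.prems have "2 \<le> order a p" by (metis dvd_imp_le neq0_conv)
    then have "[:- a, 1:] ^ 2 dvd p" using order_1 power_le_dvd by blast
    then obtain q where p: "p = [:- a, 1:] ^ 2 * q" by (elim dvdE)
    have q0: "q \<noteq> 0" using less.prems p by auto
    have "degree p = 2 + degree q"
      unfolding p using q0 by (subst degree_mult_eq) (auto simp: degree_power_eq)
    moreover have "even (order x q)" for x
    proof -
      have "order x p = order x ([:- a, 1:] ^ 2) + order x q"
        unfolding p using less.prems(1) p by (intro order_mult) simp
      moreover have "even (order x ([:- a, 1:] ^ 2))"
      proof (cases "x = a")
        case True
        then show ?thesis by (simp add: order_power_n_n)
      next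
        case False
        then have "poly ([:- a, 1:] ^ 2) x \<noteq> 0" by simp
        then show ?thesis by (simp add: order_0I)
      qed
      ultimately show ?thesis using less.prems(2)[of x] by simp
    qed
    ultimately have "(\<forall>x. 0 \<le> poly q x) \<or> (\<forall>x. poly q x \<le> 0)"
      using less.hyps[of q] q0 by simp
    moreover have "poly p x = (x - a)\<^sup>2 * poly q x" for x
      unfolding p by simp
    ultimately show ?thesis
      by (auto intro: mult_nonneg_nonneg mult_nonneg_nonpos)
  next
    case False
    show ?thesis
    proof (rule ccontr)
      assume "\<not> ?thesis"
      then obtain x y where xy: "poly p x < 0" "0 < poly p y" by (auto simp: not_le)
      then have "x \<noteq> y" by auto
      then consider "x < y" | "y < x" by linarith
      then show False
        using poly_IVT_pos[of x y p] poly_IVT_neg[of y x p] xy False by cases blast+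
    qed
  qed
qed

lemma order_prod_linear:
  fixes A :: "real set"
  assumes "finite A"
  shows "order x (\<Prod>a\<in>A. [:- a, 1:]) = (if x \<in> A then 1 else 0)"
  using assms
proof (induction A rule: finite_induct)
  case (insert b A)
  have "(\<Prod>a\<in>A. [:- a, 1:]) \<noteq> 0" using insert by simp
  then have nz: "[:- b, 1:] * (\<Prod>a\<in>A. [:- a, 1:]) \<noteq> 0"
    by (intro no_zero_divisors) simp_all
  have "order x [:- b, 1:] = (if x = b then 1 else 0)"
    using order_power_n_n[of b 1] by (auto simp: order_0I)
  then show ?case
    using insert order_mult[OF nz, of x] by (simp only: prod.insert) auto
qed simp

lemma degree_prod_linear: "degree (\<Prod>a\<in>A. [:- a, 1:]) = card A" for A :: "real set"
  by (subst degree_prod_eq_sum_degree) auto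

lemma prod_linear_dvd:
  fixes p :: "real poly"
  assumes "finite A" "\<And>a. a \<in> A \<Longrightarrow> poly p a = 0"
  shows "(\<Prod>a\<in>A. [:- a, 1:]) dvd p"
  using assms
proof (induction A rule: finite_induct)
  case (insert b A)
  then obtain q where p: "p = (\<Prod>a\<in>A. [:- a, 1:]) * q" by auto
  have "poly p b = 0" using insert by simp
  moreover have "poly (\<Prod>a\<in>A. [:- a, 1:]) b \<noteq> 0"
    using insert by (auto simp: poly_prod)
  ultimately have "poly q b = 0" unfolding p by simp
  then have "[:- b, 1:] dvd q" by (simp add: poly_eq_0_iff_dvd)
  then show ?case
    unfolding p prod.insert[OF insert.hyps] by (subst mult.commute) (rule mult_dvd_mono[OF dvd_refl])
qed simp

lemma sum_same_sign_zero:
  fixes f :: "'a \<Rightarrow> real"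
  assumes "finite A" "sum f A = 0" "(\<forall>i\<in>A. 0 \<le> f i) \<or> (\<forall>i\<in>A. f i \<le> 0)"
  shows "\<forall>i\<in>A. f i = 0"
  using assms(3)
proof
  assume "\<forall>i\<in>A. 0 \<le> f i"
  then show ?thesis using sum_nonneg_eq_0_iff[OF assms(1), of f] assms(2) by simp
next
  assume "\<forall>i\<in>A. f i \<le> 0"
  then show ?thesis using sum_nonneg_eq_0_iff[OF assms(1), of "\<lambda>i. - f i"] assms(2) by (simp add: sum_negf)
qed

text \<open>The \<open>k\<close>-th smallest element \<open>b\<close> is at least
  \<open>2 k + 1/2\<close>, which gives \<open>(1 + 1/b)^2 \<le> (k + 1) / k\<close>; the product of
  these bounds telescopes. The second conjunct carries the lower bound for the next element through
  the induction.\<close>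

lemma spaced_prod:
  fixes A :: "real set"
  assumes "finite A" "\<And>a. a \<in> A \<Longrightarrow> 5 / 2 \<le> a" "\<And>a b. a \<in> A \<Longrightarrow> b \<in> A \<Longrightarrow> a < b \<Longrightarrow> a + 2 \<le> b"
  shows "(\<Prod>a\<in>A. (a + 1)\<^sup>2) \<le> (real (card A) + 1) * (\<Prod>a\<in>A. a\<^sup>2)
    \<and> (\<forall>b. 5 / 2 \<le> b \<and> (\<forall>a\<in>A. a + 2 \<le> b) \<longrightarrow> 2 * real (card A) + 5 / 2 \<le> b)"
  using assms
proof (induction A rule: finite_linorder_max_induct)
  case empty
  then show ?case by simp
next
  case (insert b A)
  define k where "k = real (card A) + 1"
  have notin: "b \<notin> A" using insert.hyps by auto
  have IH: "(\<Prod>a\<in>A. (a + 1)\<^sup>2) \<le> k * (\<Prod>a\<in>A. a\<^sup>2)"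
    "\<And>b. 5 / 2 \<le> b \<Longrightarrow> \<forall>a\<in>A. a + 2 \<le> b \<Longrightarrow> 2 * real (card A) + 5 / 2 \<le> b"
    using insert.IH insert.prems unfolding k_def by auto
  have b: "2 * k + 1 / 2 \<le> b"
    using IH(2)[of b] insert.prems insert.hyps unfolding k_def by auto
  have k: "1 \<le> k" unfolding k_def by simp
  have "2 * k * b + k \<le> (2 * k + 1 / 2) * b"
    using b k by (simp add: algebra_simps)
  also have "\<dots> \<le> b * b"
    using b k by (intro mult_right_mono) auto
  finally have step: "(b + 1)\<^sup>2 * k \<le> (k + 1) * b\<^sup>2"
    by (simp add: power2_eq_square algebra_simps)
  have "(\<Prod>a\<in>insert b A. (a + 1)\<^sup>2) = (b + 1)\<^sup>2 * (\<Prod>a\<in>A. (a + 1)\<^sup>2)"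
    using insert.hyps notin by simp
  also have "\<dots> \<le> (b + 1)\<^sup>2 * (k * (\<Prod>a\<in>A. a\<^sup>2))"
    using IH(1) by (intro mult_left_mono) auto
  also have "\<dots> \<le> ((k + 1) * b\<^sup>2) * (\<Prod>a\<in>A. a\<^sup>2)"
    using mult_right_mono[OF step, of "\<Prod>a\<in>A. a\<^sup>2"] by (simp add: prod_nonneg mult_ac)
  also have "\<dots> = (real (card (insert b A)) + 1) * (\<Prod>a\<in>insert b A. a\<^sup>2)"
    using insert.hyps notin by (simp add: k_def mult_ac)
  finally have 1: "(\<Prod>a\<in>insert b A. (a + 1)\<^sup>2) \<le> (real (card (insert b A)) + 1) * (\<Prod>a\<in>insert b A. a\<^sup>2)" .
  have "2 * real (card (insert b A)) + 5 / 2 \<le> c" if "\<forall>a\<in>insert b A. a + 2 \<le> c" for c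
  proof -
    have "b + 2 \<le> c" using that by simp
    with b show ?thesis using insert.hyps notin by (simp add: k_def)
  qed
  with 1 show ?case by blast
qed

text \<open>The step to \<open>t + 1\<close> moves away from the points on the left. Distances to
  those on the right shrink from \<open>b + 1\<close> to \<open>b\<close>, where the
  \<open>b\<close> are at least \<open>5/2\<close> and 2 apart, so \<open>spaced_prod\<close> bounds
  the loss.\<close>

lemma compare_right:
  fixes A :: "real set" and t :: real
  assumes "finite A" and far: "\<And>a. a \<in> A \<Longrightarrow> a \<le> t \<or> t + 7 / 2 \<le> a"
    and spaced: "\<And>a b. a \<in> A \<Longrightarrow> b \<in> A \<Longrightarrow> a < b \<Longrightarrow> a + 2 \<le> b"
  shows "(\<Prod>a\<in>A. (t - a)\<^sup>2) \<le> (real (card A) + 1) * (\<Prod>a\<in>A. (t + 1 - a)\<^sup>2)"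
proof -
  define L U where "L = {a \<in> A. a \<le> t}" and "U = {a \<in> A. t + 7 / 2 \<le> a}"
  have A: "A = L \<union> U" "L \<inter> U = {}" "finite L" "finite U"
    using far assms(1) by (auto simp: L_def U_def)
  have prods: "(\<Prod>a\<in>A. g a) = (\<Prod>a\<in>L. g a) * (\<Prod>a\<in>U. g a)" for g :: "real \<Rightarrow> real"
    unfolding A(1) using A by (intro prod.union_disjoint) auto
  have 1: "(\<Prod>a\<in>L. (t - a)\<^sup>2) \<le> (\<Prod>a\<in>L. (t + 1 - a)\<^sup>2)"
    by (intro prod_mono) (auto simp: L_def intro!: power_mono)
  define V where "V = (\<lambda>a. a - (t + 1)) ` U"
  have inj: "inj_on (\<lambda>a. a - (t + 1)) U" by (auto simp: inj_on_def)
  have "(\<Prod>b\<in>V. (b + 1)\<^sup>2) \<le> (real (card V) + 1) * (\<Prod>b\<in>V. b\<^sup>2)"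
  proof (rule spaced_prod[THEN conjunct1])
    show "finite V" unfolding V_def using A by simp
    show "5 / 2 \<le> b" if "b \<in> V" for b using that by (auto simp: V_def U_def)
    show "a + 2 \<le> b" if "a \<in> V" "b \<in> V" "a < b" for a b
    proof -
      from that obtain a' b' where ab: "a = a' - (t + 1)" "b = b' - (t + 1)" "a' \<in> A" "b' \<in> A"
        by (auto simp: V_def U_def)
      with that(3) have "a' + 2 \<le> b'" by (intro spaced) auto
      with ab show ?thesis by simp
    qed
  qed
  then have "(\<Prod>a\<in>U. (a - t)\<^sup>2) \<le> (real (card U) + 1) * (\<Prod>a\<in>U. (a - (t + 1))\<^sup>2)"
    unfolding V_def by (simp add: prod.reindex[OF inj] card_image[OF inj])
  also have "\<dots> \<le> (real (card A) + 1) * (\<Prod>a\<in>U. (a - (t + 1))\<^sup>2)"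
    using assms(1) by (intro mult_right_mono prod_nonneg) (auto simp: U_def intro!: card_mono)
  finally have 2: "(\<Prod>a\<in>U. (t - a)\<^sup>2) \<le> (real (card A) + 1) * (\<Prod>a\<in>U. (t + 1 - a)\<^sup>2)"
    by (simp add: power2_commute)
  have "(\<Prod>a\<in>L. (t - a)\<^sup>2) * (\<Prod>a\<in>U. (t - a)\<^sup>2)
      \<le> (\<Prod>a\<in>L. (t + 1 - a)\<^sup>2) * ((real (card A) + 1) * (\<Prod>a\<in>U. (t + 1 - a)\<^sup>2))"
    using 1 2 by (intro mult_mono) (auto intro: prod_nonneg)
  then show ?thesis unfolding prods by (simp add: mult_ac)
qed

lemma compare_left:
  fixes A :: "real set" and t :: real
  assumes "finite A" and far: "\<And>a. a \<in> A \<Longrightarrow> t \<le> a \<or> a \<le> t - 7 / 2"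
    and spaced: "\<And>a b. a \<in> A \<Longrightarrow> b \<in> A \<Longrightarrow> a < b \<Longrightarrow> a + 2 \<le> b"
  shows "(\<Prod>a\<in>A. (t - a)\<^sup>2) \<le> (real (card A) + 1) * (\<Prod>a\<in>A. (t - 1 - a)\<^sup>2)"
proof -
  have inj: "inj_on uminus A" by simp
  have "(\<Prod>a\<in>uminus ` A. (- t - a)\<^sup>2) \<le> (real (card (uminus ` A)) + 1) * (\<Prod>a\<in>uminus ` A. (- t + 1 - a)\<^sup>2)"
    using assms(1)
  proof (intro compare_right)
    show "a \<le> - t \<or> - t + 7 / 2 \<le> a" if "a \<in> uminus ` A" for a
      using that far by force
    show "a + 2 \<le> b" if "a \<in> uminus ` A" "b \<in> uminus ` A" "a < b" for a b
      using that spaced[of "- b" "- a"] by auto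
  qed simp
  moreover have "(- t - - a)\<^sup>2 = (t - a)\<^sup>2" "(- t + 1 - - a)\<^sup>2 = (t - 1 - a)\<^sup>2" for a
    by (simp_all add: power2_eq_square algebra_simps)
  ultimately show ?thesis
    by (simp only: prod.reindex[OF inj] card_image[OF inj] o_def)
qed

locale krawtchouk_roots =
  fixes n s :: nat
  assumes s_le: "2 * s \<le> n"
begin

abbreviation "K \<equiv> krawtchouk n s"
definition "R = {t. K t = 0}"

lemma R_poly: "R = {t. poly (krawtchouk_poly n s) t = 0}"
  by (simp add: R_def poly_krawtchouk_poly)

lemma finite_R: "finite R"
  unfolding R_poly using krawtchouk_poly_degree poly_roots_finite by blast

lemma nonvanishing: "\<exists>i\<le>n. K (real i) \<noteq> 0"
proof (rule ccontr)
  assume "\<not> ?thesis"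
  then have "(\<Sum>i\<le>n. real (n choose i) * (K (real i))\<^sup>2) = 0" by simp
  then have "n choose s = 0" by (simp add: sum_krawtchouk_sq)
  then show False using s_le by simp
qed

text \<open>The classical argument for orthogonal polynomials: if fewer than \<open>s\<close> roots
  had odd order, \<open>K\<close> times the product of their linear factors would have constant sign
  and weighted sum zero over \<open>0..n\<close>. It would vanish at these \<open>n + 1\<close>
  points, too many for a degree below \<open>2 s\<close>.\<close>

lemma card_R: "card R = s"
proof (rule antisym)
  let ?P = "krawtchouk_poly n s"
  have P: "degree ?P = s" "?P \<noteq> 0" using krawtchouk_poly_degree by auto
  show "card R \<le> s"
    unfolding R_poly using card_poly_roots_bound[OF P(2)] P(1) by simp
  define A where "A = {a \<in> R. odd (order a ?P)}"
  have A: "A \<subseteq> R" "finite A" using finite_R by (auto simp: A_def)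
  define p where "p = (\<Prod>a\<in>A. [:- a, 1:])"
  have p: "p \<noteq> 0" "degree p = card A" "\<And>x. order x p = (if x \<in> A then 1 else 0)"
    unfolding p_def using A by (auto simp: order_prod_linear degree_prod_linear)
  have even: "even (order x (?P * p))" for x
  proof -
    have "order x (?P * p) = order x ?P + order x p"
      using P p by (intro order_mult) simp
    moreover have "x \<notin> R \<Longrightarrow> order x ?P = 0"
      by (intro order_0I) (simp add: R_poly)
    ultimately show ?thesis
      using p(3)[of x] by (auto simp: A_def)
  qed
  have sign: "(\<forall>x. 0 \<le> poly (?P * p) x) \<or> (\<forall>x. poly (?P * p) x \<le> 0)"
    using even P p by (intro poly_same_sign) auto
  have "s \<le> card A"
  proof (rule ccontr)
    assume "\<not> s \<le> card A"
    then have less: "degree p < s" using p by simp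
    have "(\<Sum>i\<le>n. real (n choose i) * poly (?P * p) (real i)) = 0"
      using krawtchouk_orthogonal[OF less, of n] by (simp add: poly_krawtchouk_poly mult.assoc)
    moreover have "(\<forall>i\<le>n. 0 \<le> real (n choose i) * poly (?P * p) (real i))
        \<or> (\<forall>i\<le>n. real (n choose i) * poly (?P * p) (real i) \<le> 0)"
      using sign
    proof
      assume "\<forall>x. 0 \<le> poly (?P * p) x"
      then show ?thesis by (intro disjI1 allI impI mult_nonneg_nonneg) (simp_all del: poly_mult)
    next
      assume "\<forall>x. poly (?P * p) x \<le> 0"
      then show ?thesis by (intro disjI2 allI impI mult_nonneg_nonpos) (simp_all del: poly_mult)
    qed
    ultimately have "\<forall>i\<in>{..n}. real (n choose i) * poly (?P * p) (real i) = 0"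
      by (intro sum_same_sign_zero) auto
    then have zero: "poly (?P * p) (real i) = 0" if "i \<le> n" for i
      using that by (simp del: poly_mult)
    have "real ` {..n} \<subseteq> {x. poly (?P * p) x = 0}"
      using zero by (auto simp del: poly_mult)
    then have "card (real ` {..n}) \<le> card {x. poly (?P * p) x = 0}"
      using P p by (intro card_mono poly_roots_finite) auto
    also have "\<dots> \<le> degree (?P * p)"
      using P p by (intro card_poly_roots_bound) simp
    also have "\<dots> < 2 * s"
      using P p less by (simp add: degree_mult_eq)
    finally show False using s_le by (simp add: card_image)
  qed
  also have "\<dots> \<le> card R"
    using A finite_R by (intro card_mono) auto
  finally show "s \<le> card R" .
qed

definition "lc = lead_coeff (krawtchouk_poly n s)"

lemma K_factor: "K t = lc * (\<Prod>a\<in>R. t - a)"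
proof -
  let ?P = "krawtchouk_poly n s"
  have P: "degree ?P = s" "?P \<noteq> 0" using krawtchouk_poly_degree by auto
  have "(\<Prod>a\<in>R. [:- a, 1:]) dvd ?P"
    using finite_R by (intro prod_linear_dvd) (auto simp: R_poly)
  then obtain q where q: "?P = (\<Prod>a\<in>R. [:- a, 1:]) * q" by (elim dvdE)
  have "q \<noteq> 0" using P q by auto
  then have "degree ?P = card R + degree q"
    unfolding q using finite_R by (subst degree_mult_eq) (auto simp: degree_prod_linear)
  then have "degree q = 0" using P card_R by simp
  then obtain c where c: "q = [:c:]" by (rule degree_eq_zeroE)
  have "lc = lead_coeff (\<Prod>a\<in>R. [:- a, 1:]) * lead_coeff q"
    unfolding lc_def q by (rule lead_coeff_mult)
  also have "\<dots> = c"
    unfolding lead_coeff_prod c by simp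
  finally have "poly ?P t = lc * (\<Prod>a\<in>R. t - a)"
    unfolding q c by (simp add: poly_prod)
  then show ?thesis by (simp only: poly_krawtchouk_poly)
qed

lemma lc_nonzero: "lc \<noteq> 0"
  unfolding lc_def leading_coeff_0_iff using krawtchouk_poly_degree by blast

lemma K_prod: "K t * K u = lc\<^sup>2 * (\<Prod>a\<in>R. (t - a) * (u - a))"
proof -
  have "K t * K u = (lc * (\<Prod>a\<in>R. t - a)) * (lc * (\<Prod>a\<in>R. u - a))"
    by (simp only: K_factor)
  then show ?thesis by (simp only: prod.distrib power2_eq_square mult_ac)
qed

lemma sign_flip:
  assumes "r \<in> R" "t < r" "r < u" "\<And>a. a \<in> R \<Longrightarrow> t \<le> a \<Longrightarrow> a \<le> u \<Longrightarrow> a = r"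
  shows "K t * K u < 0"
proof -
  have "0 < (\<Prod>a\<in>R - {r}. (t - a) * (u - a))"
  proof (rule prod_pos)
    fix a assume "a \<in> R - {r}"
    then have "a < t \<or> u < a" using assms(4)[of a] by (cases "a < t"; cases "u < a") auto
    then show "0 < (t - a) * (u - a)"
      using assms(2,3) by (auto intro: mult_pos_pos mult_neg_neg)
  qed
  moreover have "(t - r) * (u - r) < 0" using assms(2,3) by (intro mult_neg_pos) auto
  ultimately have "(\<Prod>a\<in>R. (t - a) * (u - a)) < 0"
    by (subst prod.remove[OF finite_R assms(1)]) (rule mult_neg_pos)
  then show ?thesis
    unfolding K_prod using lc_nonzero by (simp add: mult_pos_neg)
qed

lemma root_bounds:
  assumes "r \<in> R"
  shows "0 < r" "r < real n"
proof -
  show "0 < r"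
    using krawtchouk_pos[of r s n] s_le assms by (force simp: R_def)
  have "K (real n - r) = 0" using assms by (simp add: krawtchouk_reflect R_def)
  then show "r < real n"
    using krawtchouk_pos[of "real n - r" s n] s_le by force
qed

text \<open>The quotient \<open>K t / ((t - r) * (t - r'))\<close>, written as a product so that it
  also makes sense at \<open>r\<close> and \<open>r'\<close>.\<close>

definition G :: "real \<Rightarrow> real \<Rightarrow> real \<Rightarrow> real" where
  "G r r' t = lc * (\<Prod>a\<in>R - {r, r'}. t - a)"

lemma K_G:
  assumes "r \<in> R" "r' \<in> R" "r < r'"
  shows "K t = (t - r) * (t - r') * G r r' t"
proof -
  have "(\<Prod>a\<in>R. t - a) = (t - r) * ((t - r') * (\<Prod>a\<in>R - {r} - {r'}. t - a))"
  proof -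
    have "r' \<in> R - {r}" "finite (R - {r})" using assms finite_R by auto
    then show ?thesis
      by (simp only: prod.remove[OF finite_R assms(1)] prod.remove[of "R - {r}" r'])
  qed
  moreover have "R - {r} - {r'} = R - {r, r'}" by auto
  ultimately show ?thesis
    unfolding K_factor G_def by simp
qed

text \<open>\<open>K / ((t - r) (t - r'))\<close> has degree \<open>s - 2\<close>, so \<open>K\<close> is orthogonal to it; in the resulting sum
  exactly the integers between \<open>r\<close> and \<open>r'\<close> contribute negatively.\<close>

lemma quadrature:
  assumes "r \<in> R" "r' \<in> R" "r < r'"
  shows "(\<Sum>i\<le>n. real (n choose i) * ((real i - r) * (real i - r') * (G r r' (real i))\<^sup>2)) = 0"
proof -
  define Q where "Q = smult lc (\<Prod>a\<in>R - {r, r'}. [:- a, 1:])"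
  have Q: "poly Q t = G r r' t" for t
    unfolding Q_def G_def by (simp add: poly_prod)
  have "degree Q \<le> card (R - {r, r'})"
    unfolding Q_def degree_prod_linear[symmetric] by (rule degree_smult_le)
  also have "\<dots> < card R"
    using assms finite_R by (intro psubset_card_mono) auto
  finally have "(\<Sum>i\<le>n. real (n choose i) * K (real i) * poly Q (real i)) = 0"
    unfolding card_R by (rule krawtchouk_orthogonal)
  then show ?thesis
    unfolding Q K_G[OF assms] by (simp add: power2_eq_square mult.assoc)
qed

text \<open>Otherwise every term of the quadrature sum is nonnegative, hence zero, and
  \<open>K\<close> vanishes on all of \<open>0..n\<close>, against
  \<open>nonvanishing\<close>.\<close>

lemma integer_between:
  assumes "r \<in> R" "r' \<in> R" "r < r'"
  obtains i :: nat where "r < real i" "real i < r'"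
proof -
  have "\<exists>i::nat. r < real i \<and> real i < r'"
  proof (rule ccontr)
    assume none: "\<not> ?thesis"
    have "0 \<le> (real i - r) * (real i - r')" for i
    proof (cases "real i \<le> r")
      case True
      then show ?thesis using assms by (intro mult_nonpos_nonpos) auto
    next
      case False
      then have "r' \<le> real i" using none by (meson not_le)
      with False show ?thesis by (intro mult_nonneg_nonneg) auto
    qed
    then have nn: "0 \<le> real (n choose i) * ((real i - r) * (real i - r') * (G r r' (real i))\<^sup>2)" for i
      by (simp only: mult_nonneg_nonneg of_nat_0_le_iff zero_le_power2)
    have "\<forall>i\<in>{..n}. real (n choose i) * ((real i - r) * (real i - r') * (G r r' (real i))\<^sup>2) = 0"
      using quadrature[OF assms] nn by (subst (asm) sum_nonneg_eq_0_iff) auto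
    then have "K (real i) = 0" if "i \<le> n" for i
      using that unfolding K_G[OF assms] by auto
    then show False using nonvanishing by blast
  qed
  then show ?thesis using that by blast
qed

text \<open>If the leftmost gap shorter than 2 lies between \<open>r\<close> and \<open>r'\<close>, then for some \<open>t\<close> in it both \<open>K (t - 1)\<close>
  and \<open>K (t + 1)\<close> have the sign opposite to \<open>K t\<close>, which contradicts the difference equation.\<close>

lemma root_gap:
  assumes "r0 \<in> R" "r0' \<in> R" "r0 < r0'"
  shows "r0 + 2 \<le> r0'"
proof (rule ccontr)
  assume close: "\<not> r0 + 2 \<le> r0'"
  define Bad where "Bad = {r \<in> R. \<exists>r'\<in>R. r < r' \<and> r' < r + 2}"
  have Bad: "finite Bad" "Bad \<noteq> {}"
    using finite_R assms close by (auto simp: Bad_def not_le)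
  define r where "r = Min Bad"
  have "r \<in> Bad" unfolding r_def using Bad by (rule Min_in)
  then obtain r1 where r1: "r \<in> R" "r1 \<in> R" "r < r1" "r1 < r + 2" by (auto simp: Bad_def)
  define r' where "r' = Min {a \<in> R. r < a}"
  have fin: "finite {a \<in> R. r < a}" "{a \<in> R. r < a} \<noteq> {}" using finite_R r1 by auto
  have r': "r' \<in> R" "r < r'" using Min_in[OF fin] by (auto simp: r'_def)
  have next_r: "r' \<le> a" if "a \<in> R" "r < a" for a
    unfolding r'_def using fin that by (intro Min_le) auto
  have r'2: "r' < r + 2" using next_r[of r1] r1 by simp
  have prev: "q + 2 \<le> r" if "q \<in> R" "q < r" for q
  proof -
    have "q \<notin> Bad" using Min_le[OF Bad(1), of q] that by (auto simp: r_def)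
    then show ?thesis using that r1 by (auto simp: Bad_def)
  qed
  \<comment> \<open>Two successive gaps contain integers \<open>i < j\<close>, so \<open>a\<close>
    exceeds \<open>r\<close> by more than 1 however short both gaps are.\<close>
  have after: "r + 1 < a" if a: "a \<in> R" "r' < a" for a
  proof -
    obtain i where i: "r < real i" "real i < r'" using integer_between[OF r1(1) r'(1,2)] .
    obtain j where j: "r' < real j" "real j < a" using integer_between[OF r'(1) a] .
    have "real i < real j" using i j by linarith
    then have "real i + 1 \<le> real j" by simp
    with i j show ?thesis by linarith
  qed
  \<comment> \<open>The point \<open>t = v - 1\<close> has to satisfy
    \<open>t - 1 < r < t < r' < t + 1\<close>, with no further root in this range. \<open>m\<close>
    and \<open>U\<close> collect the lower and upper bounds on \<open>v\<close>; they are compatible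
    by \<open>after\<close> and because the gap is shorter than 2.\<close>
  define m where "m = max (r + 1) r'"
  define U where "U = {a \<in> R. r' < a} \<union> {r + 2, r' + 1}"
  have U: "finite U" "U \<noteq> {}" "\<And>a. a \<in> U \<Longrightarrow> m < a"
    using finite_R after r'2 r'(2) by (auto simp: U_def m_def)
  then have "m < Min U" by simp
  then obtain v where v: "m < v" "v < Min U" using dense by blast
  have vU: "v < a" if "a \<in> U" for a
    using v(2) Min_le[OF U(1) that] by linarith
  have v': "r + 1 < v" "r' < v" "v < r + 2" "v < r' + 1"
    using v(1) vU[of "r + 2"] vU[of "r' + 1"] by (auto simp: m_def U_def)
  define t where "t = v - 1"
  have 1: "K (t - 1) * K t < 0"
  proof (rule sign_flip[OF r1(1)])
    fix a assume a: "a \<in> R" "t - 1 \<le> a" "a \<le> t"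
    show "a = r"
    proof (rule ccontr)
      assume "a \<noteq> r"
      then consider "a < r" | "r < a" by linarith
      then show False
        using prev[of a] next_r[of a] a v' by cases (auto simp: t_def)
    qed
  qed (use v' in \<open>auto simp: t_def\<close>)
  have 2: "K t * K (t + 1) < 0"
  proof (rule sign_flip[OF r'(1)])
    fix a assume a: "a \<in> R" "t \<le> a" "a \<le> t + 1"
    show "a = r'"
    proof (rule ccontr)
      assume "a \<noteq> r'"
      moreover have "r' \<le> a" using next_r[of a] a v' by (simp add: t_def)
      ultimately have "v < a" using vU[of a] a by (auto simp: U_def)
      then show False using a by (simp add: t_def)
    qed
  qed (use v' in \<open>auto simp: t_def\<close>)
  have t: "0 < t" "t < real n"
    using root_bounds[OF r1(1)] root_bounds[OF r'(1)] v' by (auto simp: t_def)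
  have "(real n - t) * (K t * K (t + 1)) + t * (K (t - 1) * K t)
      = K t * ((real n - t) * K (t + 1) + t * K (t - 1))"
    by (simp add: algebra_simps)
  also have "\<dots> = (real n - 2 * real s) * (K t * K t)"
    unfolding krawtchouk_difference by (simp add: mult_ac)
  also have "\<dots> \<ge> 0"
    using s_le by (intro mult_nonneg_nonneg[OF _ zero_le_square]) simp
  finally show False
    using mult_pos_neg[of "real n - t" "K t * K (t + 1)"] mult_pos_neg[of t "K (t - 1) * K t"] 1 2 t
    by linarith
qed

end

section \<open>Values of Krawtchouk polynomials at integers\<close>

lemma (in saddle_region) z_alt: "z = 2 * x / (1 - 2 * y + b)"
proof -
  have "(1 - 2 * y - b) * (1 - 2 * y + b) = (1 - 2 * y)\<^sup>2 - b\<^sup>2"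
    by (simp add: power2_eq_square algebra_simps)
  also have "\<dots> = 4 * (x * (1 - x))" using b_sq by simp
  finally have "2 * (1 - x) * (z * (1 - 2 * y + b)) = 2 * (1 - x) * (2 * x)"
    unfolding z_eq[symmetric] by (simp add: mult_ac)
  then have "z * (1 - 2 * y + b) = 2 * x"
    using x by (simp only: mult_cancel_left) auto
  moreover have "0 < 1 - 2 * y + b" using y_less b_nonneg by linarith
  ultimately show ?thesis by (simp add: eq_divide_eq)
qed

text \<open>In the form of \<open>z_alt\<close> the denominator \<open>1 - 2 * y + b\<close>
  decreases with \<open>y\<close>.\<close>

lemma saddle_mono:
  assumes "saddle_region x y" "saddle_region x y'" "y \<le> y'"
  shows "saddle x y \<le> saddle x y'"
proof -
  interpret a: saddle_region x y by fact
  interpret b: saddle_region x y' by fact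
  have "y' * (1 - y') - y * (1 - y) = (y' - y) * (1 - y - y')"
    by (simp add: algebra_simps)
  also have "\<dots> \<ge> 0"
    using assms(3) a.y_less b.y_less by (intro mult_nonneg_nonneg) auto
  finally have "b.b \<le> a.b" by (intro real_sqrt_le_mono) simp
  then have le: "1 - 2 * y' + b.b \<le> 1 - 2 * y + a.b" using assms(3) by linarith
  moreover have "0 < 1 - 2 * y' + b.b" using b.y_less b.b_nonneg by linarith
  ultimately have "2 * x / (1 - 2 * y + a.b) \<le> 2 * x / (1 - 2 * y' + b.b)"
    using a.x by (intro divide_left_mono mult_pos_pos) linarith+
  then show ?thesis unfolding a.z_alt b.z_alt .
qed

text \<open>The exponent decreases on \<open>(0, z]\<close>, so any smaller \<open>t\<close> gives
  an upper bound. It is used with the saddle of the previous integer.\<close>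

lemma (in saddle_region) tau_le:
  assumes "0 < t" "t \<le> z"
  shows "tau x y * ln 2 \<le> (1 - y) * ln (1 + t) + y * ln (1 - t) - x * ln t"
  unfolding tau_eq
proof (rule DERIV_nonpos_imp_nonincreasing[OF assms(2)])
  fix u assume u: "t \<le> u" "u \<le> z"
  then have u01: "0 < u" "u < 1" using assms z_less_1 by auto
  define D where "D = (1 - y) / (1 + u) - y / (1 - u) - x / u"
  have "((\<lambda>u. (1 - y) * ln (1 + u) + y * ln (1 - u) - x * ln u) has_real_derivative D) (at u)"
    using u01 unfolding D_def by (auto intro!: derivative_eq_intros)
  moreover have "D = - ((1 - x) * u\<^sup>2 - (1 - 2 * y) * u + x) / (u * (1 - u) * (1 + u))"
    using u01 unfolding D_def by (simp add: divide_simps) (simp add: power2_eq_square algebra_simps)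
  moreover have "\<dots> \<le> 0"
    using quadratic_nonneg[of u] u u01 by (intro divide_nonpos_pos) auto
  ultimately show "\<exists>D. ((\<lambda>u. (1 - y) * ln (1 + u) + y * ln (1 - u) - x * ln u) has_real_derivative D) (at u) \<and> D \<le> 0"
    by auto
qed

text \<open>This map carries the saddle quadratic into
  \<open>(1 - y) d^2 - (1 - 2 x) d + y = 0\<close>, the characteristic equation of the difference
  equation. It is decreasing, so the smaller saddle goes to the larger root.\<close>

definition (in saddle_region) "decay = (1 - z) / (1 + z)"

lemma (in saddle_region) decay_pos: "0 < decay"
  unfolding decay_def using z_pos z_less_1 by simp

lemma (in saddle_region) decay_quadratic: "(1 - y) * decay = (1 - 2 * x) - y / decay"
proof -
  have z: "0 < z" "z < 1" using z_pos z_less_1 by auto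
  have "(1 - y) * (1 - z)\<^sup>2 - (1 - 2 * x) * (1 - z) * (1 + z) + y * (1 + z)\<^sup>2
     = 2 * ((1 - x) * z\<^sup>2 - (1 - 2 * y) * z + x)"
    by (simp add: power2_eq_square algebra_simps)
  then have "(1 - y) * (1 - z)\<^sup>2 = (1 - 2 * x) * (1 - z) * (1 + z) - y * (1 + z)\<^sup>2"
    using quadratic by simp
  then show ?thesis
    unfolding decay_def using z by (simp add: divide_simps) (simp add: power2_eq_square algebra_simps)
qed

lemma decay_antimono:
  assumes "saddle_region x y" "saddle_region x y'" "y \<le> y'"
  shows "saddle_region.decay x y' \<le> saddle_region.decay x y"
proof -
  interpret a: saddle_region x y by fact
  interpret b: saddle_region x y' by fact
  show ?thesis
    unfolding a.decay_def b.decay_def using saddle_mono[OF assms] a.z_pos b.z_pos b.z_less_1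
    by (intro frac_le) auto
qed

section \<open>Lower bound up to the threshold\<close>

lemma (in krawtchouk_roots) K_0: "K 0 = real (n choose s)"
proof -
  have "K 0 = (\<Sum>k=0..s. if k = 0 then (real n gchoose s) else 0)"
    unfolding krawtchouk_def by (intro sum.cong) (auto simp: gr0_conv_Suc)
  also have "\<dots> = real (n choose s)"
    by (simp add: binomial_gbinomial)
  finally show ?thesis .
qed

locale krawtchouk_head = krawtchouk_roots +
  assumes s: "0 < s" "2 * s < n"
begin

abbreviation "x \<equiv> real s / real n"
abbreviation "edge \<equiv> real n / 2 - sqrt (real s * (real n - real s))"

lemma edge_scaled: "edge / real n = 1 / 2 - sqrt (x * (1 - x))"
proof -
  have "x * (1 - x) = real s * (real n - real s) / (real n)\<^sup>2"
    using s by (simp add: power2_eq_square field_simps)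
  then have "sqrt (x * (1 - x)) = sqrt (real s * (real n - real s)) / real n"
    by (simp add: real_sqrt_divide)
  then show ?thesis using s by (simp add: field_simps)
qed

lemma region: "real i \<le> edge \<Longrightarrow> saddle_region x (real i / real n)"
proof
  assume "real i \<le> edge"
  then have "real i / real n \<le> edge / real n" by (intro divide_right_mono) auto
  then show "real i / real n \<le> 1 / 2 - sqrt (x * (1 - x))" unfolding edge_scaled .
qed (use s in \<open>auto simp: field_simps\<close>)

abbreviation "\<zeta> i \<equiv> saddle_region.decay x (real i / real n)"

lemma \<zeta>_eq:
  assumes "real i \<le> edge"
  shows "(real n - real i) * \<zeta> i = (real n - 2 * real s) - real i / \<zeta> i" "0 < \<zeta> i"
proof -
  interpret saddle_region x "real i / real n" using assms by (rule region)
  show "0 < \<zeta> i" by (rule decay_pos)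
  have "real n * ((1 - real i / real n) * \<zeta> i) = real n * ((1 - 2 * x) - real i / real n / \<zeta> i)"
    by (simp only: decay_quadratic)
  then show "(real n - real i) * \<zeta> i = (real n - 2 * real s) - real i / \<zeta> i"
    using s by (simp add: right_diff_distrib left_diff_distrib)
qed

lemma edge_less: "edge < real n"
  using s by (simp add: add_pos_nonneg field_simps)

text \<open>The bound \<open>\<zeta> i\<close> for one quotient implies the bound
  \<open>\<zeta> (Suc i)\<close> for the next: \<open>\<zeta>\<close> is nonincreasing, so
  \<open>K i / K (Suc i) \<le> 1 / \<zeta> (Suc i)\<close>, and inserting this into the difference
  equation produces the characteristic equation at \<open>Suc i\<close>.\<close>

lemma ratio:
  "real i \<le> edge \<Longrightarrow> 0 < K (real i) \<and> \<zeta> i * K (real i) \<le> K (real (Suc i))"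
proof (induction i)
  case 0
  have "0 < K 0" using s by (intro krawtchouk_pos) auto
  moreover have "real n * K 1 = (real n - 2 * real s) * K 0"
    using krawtchouk_difference[of n 0 s] by simp
  moreover have "real n * \<zeta> 0 = real n - 2 * real s" using \<zeta>_eq(1)[OF 0] by simp
  ultimately have "real n * (\<zeta> 0 * K 0) = real n * K 1" by (simp add: mult.assoc[symmetric])
  then show ?case using \<open>0 < K 0\<close> s by simp
next
  case (Suc i)
  have i: "real i \<le> edge" using Suc.prems by simp
  have IH: "0 < K (real i)" "\<zeta> i * K (real i) \<le> K (real (Suc i))" using Suc.IH[OF i] by auto
  have \<zeta>: "0 < \<zeta> i" "0 < \<zeta> (Suc i)" using \<zeta>_eq(2)[OF i] \<zeta>_eq(2)[OF Suc.prems] by auto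
  have pos: "0 < K (real (Suc i))"
    using IH \<zeta> by (intro less_le_trans[OF mult_pos_pos[OF \<zeta>(1) IH(1)] IH(2)])
  have anti: "\<zeta> (Suc i) \<le> \<zeta> i"
    using region[OF i] region[OF Suc.prems] by (intro decay_antimono divide_right_mono) auto
  have "K (real i) \<le> K (real (Suc i)) / \<zeta> i"
    using IH(2) \<zeta> by (simp add: pos_le_divide_eq mult.commute)
  also have "\<dots> \<le> K (real (Suc i)) / \<zeta> (Suc i)"
    using anti \<zeta> pos by (intro divide_left_mono) auto
  finally have Ki: "real (Suc i) * K (real i) \<le> real (Suc i) * (K (real (Suc i)) / \<zeta> (Suc i))"
    by (intro mult_left_mono) auto
  have "(real n - real (Suc i)) * (\<zeta> (Suc i) * K (real (Suc i)))
      = ((real n - 2 * real s) - real (Suc i) / \<zeta> (Suc i)) * K (real (Suc i))"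
    unfolding \<zeta>_eq(1)[OF Suc.prems, symmetric] by simp
  also have "\<dots> = (real n - 2 * real s) * K (real (Suc i)) - real (Suc i) * (K (real (Suc i)) / \<zeta> (Suc i))"
    by (simp add: left_diff_distrib)
  also have "\<dots> \<le> (real n - 2 * real s) * K (real (Suc i)) - real (Suc i) * K (real i)"
    using Ki by simp
  also have "\<dots> = (real n - real (Suc i)) * K (real (Suc (Suc i)))"
    using krawtchouk_difference[of n "real (Suc i)" s] by (simp add: add.commute)
  finally have "(real n - real (Suc i)) * (\<zeta> (Suc i) * K (real (Suc i)))
      \<le> (real n - real (Suc i)) * K (real (Suc (Suc i)))" .
  moreover have "0 < real n - real (Suc i)" using Suc.prems edge_less by linarith
  ultimately show ?case using pos by (simp only: mult_le_cancel_left_pos simp_thms)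
qed

text \<open>Equality holds at \<open>i = 0\<close>. For the increment, \<open>tau\<close> at
  \<open>i + 1\<close> is bounded by its exponent at the saddle of \<open>i\<close>, which is affine
  in \<open>y\<close>: so \<open>n tau ln 2\<close> changes by at most
  \<open>ln (\<zeta> i)\<close>, and \<open>ln K\<close> by at least that.\<close>

lemma K_ge:
  "real i \<le> edge \<Longrightarrow>
    real (n choose s) / 2 powr (bin_entropy x * real n) * 2 powr (tau x (real i / real n) * real n) \<le> K (real i)"
proof (induction i)
  case 0
  have "tau x 0 = bin_entropy x" using s by (intro tau_0) (auto simp: field_simps)
  then show ?case by (simp add: K_0)
next
  case (Suc i)
  have i: "real i \<le> edge" using Suc.prems by simp
  interpret a: saddle_region x "real i / real n" using i by (rule region)
  interpret b: saddle_region x "real (Suc i) / real n" using Suc.prems by (rule region)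
  let ?c = "real (n choose s) / 2 powr (bin_entropy x * real n)"
  have "a.z \<le> b.z"
    using a.saddle_region_axioms b.saddle_region_axioms by (rule saddle_mono) (simp add: divide_right_mono)
  then have "real n * (tau x (real (Suc i) / real n) * ln 2)
      \<le> real n * ((1 - real (Suc i) / real n) * ln (1 + a.z) + real (Suc i) / real n * ln (1 - a.z) - x * ln a.z)"
    using a.z_pos by (intro mult_left_mono b.tau_le) auto
  also have "\<dots> = real n * (tau x (real i / real n) * ln 2) + (ln (1 - a.z) - ln (1 + a.z))"
    unfolding a.tau_eq using s by (simp add: field_simps)
  also have "ln (1 - a.z) - ln (1 + a.z) = ln (\<zeta> i)"
    unfolding a.decay_def using a.z_pos a.z_less_1 by (simp add: ln_div)
  finally have "exp (real n * (tau x (real (Suc i) / real n) * ln 2))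
      \<le> exp (real n * (tau x (real i / real n) * ln 2) + ln (\<zeta> i))" by simp
  also have "\<dots> = exp (real n * (tau x (real i / real n) * ln 2)) * \<zeta> i"
    using a.decay_pos by (simp add: exp_add)
  finally have "2 powr (tau x (real (Suc i) / real n) * real n)
      \<le> 2 powr (tau x (real i / real n) * real n) * \<zeta> i"
    unfolding powr_2_eq_exp by (simp only: mult_ac)
  then have "?c * 2 powr (tau x (real (Suc i) / real n) * real n)
      \<le> ?c * (2 powr (tau x (real i / real n) * real n) * \<zeta> i)"
    by (intro mult_left_mono) auto
  also have "\<dots> \<le> \<zeta> i * K (real i)"
    using mult_left_mono[OF Suc.IH[OF i] less_imp_le[OF a.decay_pos]] by (simp only: mult_ac)
  also have "\<dots> \<le> K (real (Suc i))"
    using ratio[OF i] by blast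
  finally show ?case .
qed

end

section \<open>Large values between consecutive roots\<close>

lemma binomial_step: "k < n \<Longrightarrow> real (n choose k) \<le> real n * real (n choose Suc k)"
  and binomial_step': "k < n \<Longrightarrow> real (n choose Suc k) \<le> real n * real (n choose k)"
proof -
  assume k: "k < n"
  have "Suc k * (n choose Suc k) = (n - k) * (n choose k)"
    by (metis Suc_times_binomial_add add.commute binomial_absorb_comp binomial_absorption k)
  then have eq: "real (Suc k) * real (n choose Suc k) = real (n - k) * real (n choose k)"
    by (metis of_nat_mult)
  have "1 * real (n choose k) \<le> real (n - k) * real (n choose k)"
    using k by (intro mult_right_mono) auto
  also have "\<dots> \<le> real n * real (n choose Suc k)"
    unfolding eq[symmetric] using k by (intro mult_right_mono) auto
  finally show "real (n choose k) \<le> real n * real (n choose Suc k)" by simp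
  have "1 * real (n choose Suc k) \<le> real (Suc k) * real (n choose Suc k)"
    by (intro mult_right_mono) auto
  also have "\<dots> \<le> real n * real (n choose k)"
    unfolding eq by (intro mult_right_mono) auto
  finally show "real (n choose Suc k) \<le> real n * real (n choose k)" by simp
qed

context krawtchouk_roots
begin

lemma G_sq: "(G r r' t)\<^sup>2 = lc\<^sup>2 * (\<Prod>a\<in>R - {r, r'}. (t - a)\<^sup>2)"
  by (simp add: G_def power_mult_distrib prod_power_distrib)

context
  fixes r r' :: real
  assumes r: "r \<in> R" "r' \<in> R" "r < r'" and consecutive: "\<And>a. a \<in> R \<Longrightarrow> a \<le> r \<or> r' \<le> a"
begin

lemma gap: "r + 2 \<le> r'"
  using r by (rule root_gap)

lemma card_others: "real (card (R - {r, r'})) + 1 \<le> real n / 2"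
proof -
  have "card (R - {r, r'}) < card R" using r finite_R by (intro psubset_card_mono) auto
  then have "card (R - {r, r'}) < s" by (simp only: card_R)
  then have "2 * (card (R - {r, r'}) + 1) \<le> n" using s_le by simp
  then have "real (2 * (card (R - {r, r'}) + 1)) \<le> real n" by (simp only: of_nat_le_iff)
  then show ?thesis by simp
qed

lemma others: "a \<in> R - {r, r'} \<Longrightarrow> a \<le> r - 2 \<or> r' + 2 \<le> a"
proof -
  assume a: "a \<in> R - {r, r'}"
  then consider "a < r" | "r' < a" using consecutive[of a] by force
  then show ?thesis using root_gap[of a r] root_gap[of r' a] a r by cases auto
qed

lemma G_right:
  assumes "r < t" "t < r + 1 / 2"
  shows "(G r r' t)\<^sup>2 \<le> real n / 2 * (G r r' (t + 1))\<^sup>2"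
proof -
  have "(\<Prod>a\<in>R - {r, r'}. (t - a)\<^sup>2)
      \<le> (real (card (R - {r, r'})) + 1) * (\<Prod>a\<in>R - {r, r'}. (t + 1 - a)\<^sup>2)"
  proof (rule compare_right)
    \<comment> \<open>A root beyond \<open>r'\<close> is at least \<open>r' + 2 \<ge> r + 4\<close>,
      and \<open>t < r + 1/2\<close>: this is the origin of \<open>7 / 2\<close>.\<close>
    show "a \<le> t \<or> t + 7 / 2 \<le> a" if "a \<in> R - {r, r'}" for a
      using others[OF that] assms gap by auto
    show "a + 2 \<le> b" if "a \<in> R - {r, r'}" "b \<in> R - {r, r'}" "a < b" for a b
      using that by (intro root_gap) auto
  qed (use finite_R in simp)
  also have "\<dots> \<le> real n / 2 * (\<Prod>a\<in>R - {r, r'}. (t + 1 - a)\<^sup>2)"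
    using card_others by (intro mult_right_mono prod_nonneg) auto
  finally show ?thesis
    unfolding G_sq mult.left_commute[of "real n / 2" "lc\<^sup>2"] by (rule mult_left_mono[OF _ zero_le_power2])
qed

lemma G_left:
  assumes "r' - 1 / 2 < t" "t < r'"
  shows "(G r r' t)\<^sup>2 \<le> real n / 2 * (G r r' (t - 1))\<^sup>2"
proof -
  have "(\<Prod>a\<in>R - {r, r'}. (t - a)\<^sup>2)
      \<le> (real (card (R - {r, r'})) + 1) * (\<Prod>a\<in>R - {r, r'}. (t - 1 - a)\<^sup>2)"
  proof (rule compare_left)
    show "t \<le> a \<or> a \<le> t - 7 / 2" if "a \<in> R - {r, r'}" for a
      using others[OF that] assms gap by auto
    show "a + 2 \<le> b" if "a \<in> R - {r, r'}" "b \<in> R - {r, r'}" "a < b" for a b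
      using that by (intro root_gap) auto
  qed (use finite_R in simp)
  also have "\<dots> \<le> real n / 2 * (\<Prod>a\<in>R - {r, r'}. (t - 1 - a)\<^sup>2)"
    using card_others by (intro mult_right_mono prod_nonneg) auto
  finally show ?thesis
    unfolding G_sq mult.left_commute[of "real n / 2" "lc\<^sup>2"] by (rule mult_left_mono[OF _ zero_le_power2])
qed

text \<open>An integer close to a root has a large weight \<open>1 / ((i - r) (r' - i))\<close> in the quadrature identity;
  its contribution is then controlled by the neighbour on the other side.\<close>

lemma inside_term:
  assumes bound: "\<And>j. r < real j \<Longrightarrow> real j < r' \<Longrightarrow> real (n choose j) * (K (real j))\<^sup>2 \<le> B"
    and i: "r < real i" "real i < r'"
  shows "real (n choose i) * ((real i - r) * (r' - real i) * (G r r' (real i))\<^sup>2) \<le> 3 / 2 * (real n)\<^sup>2 * B"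
proof -
  let ?G = "G r r'"
  have B: "0 \<le> B" using order_trans[OF _ bound[OF i]] by simp
  have in_n: "real i < real n" using i root_bounds(2)[OF r(2)] by simp
  have n1: "1 \<le> real n" using in_n by simp
  have KG: "(K t)\<^sup>2 = ((t - r) * (r' - t))\<^sup>2 * (?G t)\<^sup>2" for t
    unfolding K_G[OF r] by (simp add: power2_eq_square algebra_simps)
  \<comment> \<open>\<open>e\<close> is the distance from \<open>i\<close> to the root it is close
    to, \<open>d + 1\<close> its distance to the other root, and \<open>d\<close> the distance of
    the neighbour \<open>j\<close> to that other root. Replacing \<open>i\<close> by
    \<open>j\<close> costs \<open>n / 2\<close> in \<open>G^2\<close>, \<open>n\<close> in the
    binomial coefficient and 3 from \<open>e (d + 1) \<le> 3 d^2\<close>.\<close>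
  have neighbour: "real (n choose i) * (e * (d + 1) * (?G (real i))\<^sup>2) \<le> 3 / 2 * (real n)\<^sup>2 * B"
    if "0 \<le> e" "e \<le> 1 / 2" "1 / 2 \<le> d" "(?G (real i))\<^sup>2 \<le> real n / 2 * (?G (real j))\<^sup>2"
      "real (n choose i) \<le> real n * real (n choose j)" "r < real j" "real j < r'"
      "d\<^sup>2 * (?G (real j))\<^sup>2 \<le> (K (real j))\<^sup>2" for e d j
  proof -
    have "0 \<le> (3 * d + 1) * (2 * d - 1)" using that by (intro mult_nonneg_nonneg) auto
    then have d: "d + 1 \<le> 6 * d\<^sup>2" by (simp add: power2_eq_square algebra_simps)
    have ed: "e * (d + 1) \<le> 1 / 2 * (6 * d\<^sup>2)" using d that by (intro mult_mono) auto
    have "e * (d + 1) * (?G (real i))\<^sup>2 \<le> (1 / 2 * (6 * d\<^sup>2)) * (real n / 2 * (?G (real j))\<^sup>2)"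
      by (rule mult_mono[OF ed that(4)]) auto
    also have "\<dots> = 3 / 2 * real n * (d\<^sup>2 * (?G (real j))\<^sup>2)" by simp
    also have "\<dots> \<le> 3 / 2 * real n * (K (real j))\<^sup>2"
      using that by (intro mult_left_mono) auto
    finally have "e * (d + 1) * (?G (real i))\<^sup>2 \<le> 3 / 2 * real n * (K (real j))\<^sup>2" .
    from mult_mono[OF that(5) this]
    have "real (n choose i) * (e * (d + 1) * (?G (real i))\<^sup>2)
        \<le> (real n * real (n choose j)) * (3 / 2 * real n * (K (real j))\<^sup>2)"
      using that(1,3) by simp
    also have "\<dots> = 3 / 2 * (real n)\<^sup>2 * (real (n choose j) * (K (real j))\<^sup>2)"
      by (simp add: power2_eq_square)
    also have "\<dots> \<le> 3 / 2 * (real n)\<^sup>2 * B"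
      using bound[OF that(6,7)] by (intro mult_left_mono) auto
    finally show ?thesis .
  qed
  consider "real i < r + 1 / 2" | "r' - 1 / 2 < real i" | "r + 1 / 2 \<le> real i" "real i \<le> r' - 1 / 2"
    by linarith
  then show ?thesis
  proof cases
    case 1
    have Suc: "real (Suc i) = real i + 1" by simp
    have "real (n choose i) * ((real i - r) * ((r' - real i - 1) + 1) * (?G (real i))\<^sup>2) \<le> 3 / 2 * (real n)\<^sup>2 * B"
    proof (rule neighbour[where j = "Suc i"])
      show "(?G (real i))\<^sup>2 \<le> real n / 2 * (?G (real (Suc i)))\<^sup>2"
        unfolding Suc using i(1) 1 by (rule G_right)
      show "real (n choose i) \<le> real n * real (n choose Suc i)"
        using in_n by (intro binomial_step) simp
      have "1 * (r' - real i - 1) \<le> (real (Suc i) - r) * (r' - real (Suc i))"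
        unfolding Suc using i 1 gap by (intro mult_mono) auto
      then have "(r' - real i - 1)\<^sup>2 \<le> ((real (Suc i) - r) * (r' - real (Suc i)))\<^sup>2"
        using 1 gap by (intro power_mono) auto
      then show "(r' - real i - 1)\<^sup>2 * (?G (real (Suc i)))\<^sup>2 \<le> (K (real (Suc i)))\<^sup>2"
        unfolding KG by (intro mult_right_mono) auto
    qed (use i 1 gap in auto)
    then show ?thesis by simp
  next
    case 2
    have "0 < real i" using i root_bounds(1)[OF r(1)] by simp
    then obtain j where j: "i = Suc j" by (cases i) auto
    have Suc: "real j = real i - 1" using j by simp
    have "real (n choose i) * ((r' - real i) * ((real i - 1 - r) + 1) * (?G (real i))\<^sup>2) \<le> 3 / 2 * (real n)\<^sup>2 * B"
    proof (rule neighbour[where j = j])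
      show "(?G (real i))\<^sup>2 \<le> real n / 2 * (?G (real j))\<^sup>2"
        unfolding Suc using 2 i(2) by (rule G_left)
      show "real (n choose i) \<le> real n * real (n choose j)"
        unfolding j using in_n j by (intro binomial_step') simp
      have "(real i - 1 - r) * 1 \<le> (real j - r) * (r' - real j)"
        unfolding Suc using i 2 gap by (intro mult_mono) auto
      then have "(real i - 1 - r)\<^sup>2 \<le> ((real j - r) * (r' - real j))\<^sup>2"
        using 2 gap by (intro power_mono) auto
      then show "(real i - 1 - r)\<^sup>2 * (?G (real j))\<^sup>2 \<le> (K (real j))\<^sup>2"
        unfolding KG by (intro mult_right_mono) auto
    qed (use i 2 gap Suc in auto)
    then show ?thesis by (simp add: mult_ac)
  next
    case 3
    define X where "X = (real i - r) * (r' - real i)"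
    \<comment> \<open>Both distances are at least \<open>1/2\<close> and their sum is at least 2, so
      their product is at least \<open>3/4\<close>.\<close>
    have "0 \<le> (real i - r - 1 / 2) * (r' - real i - 1 / 2)" using 3 by (intro mult_nonneg_nonneg) auto
    then have X: "3 / 4 \<le> X" using gap by (simp add: X_def algebra_simps)
    have "X \<le> 4 / 3 * X\<^sup>2"
      using mult_right_mono[OF X, of X] X by (simp add: power2_eq_square)
    then have "real (n choose i) * (X * (?G (real i))\<^sup>2) \<le> real (n choose i) * ((4 / 3 * X\<^sup>2) * (?G (real i))\<^sup>2)"
      by (intro mult_left_mono mult_right_mono) auto
    also have "\<dots> = 4 / 3 * (real (n choose i) * (K (real i))\<^sup>2)"
      unfolding KG X_def by simp
    also have "\<dots> \<le> 4 / 3 * B" using bound[OF i] by simp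
    also have "\<dots> \<le> 3 / 2 * (real n)\<^sup>2 * B"
    proof (rule mult_right_mono[OF _ B])
      have "1 \<le> (real n)\<^sup>2" using n1 by simp
      then show "4 / 3 \<le> 3 / 2 * (real n)\<^sup>2" by linarith
    qed
    finally show ?thesis unfolding X_def .
  qed
qed

text \<open>If all terms inside were below \<open>B\<close>, then the terms outside, each at most
  \<open>n^2\<close> times its quadrature term, would be paid for by at most \<open>n\<close> inner
  quadrature terms of size at most \<open>3/2 n^2 B\<close>. With the inner terms themselves the
  total is at most \<open>5/2 n^5 B\<close>, only \<open>5/18\<close> of the full sum. The 9 leaves
  room and has a rational square root.\<close>

lemma large_value_between:
  obtains i :: nat where "r < real i" "real i < r'"
    "2 ^ n * real (n choose s) / (9 * real n ^ 5) \<le> real (n choose i) * (K (real i))\<^sup>2"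
proof -
  let ?G = "G r r'"
  define S where "S = 2 ^ n * real (n choose s)"
  define B where "B = S / (9 * real n ^ 5)"
  have S: "0 < S" using s_le by (simp add: S_def)
  have n1: "1 \<le> real n" using root_bounds[OF r(1)] by (cases n) auto
  have "\<exists>i. r < real i \<and> real i < r' \<and> B \<le> real (n choose i) * (K (real i))\<^sup>2"
  proof (rule ccontr)
    assume "\<not> ?thesis"
    then have bound: "real (n choose j) * (K (real j))\<^sup>2 \<le> B" if "r < real j" "real j < r'" for j
      using that by (meson not_le less_imp_le)
    define I where "I = {i \<in> {..n}. r < real i \<and> real i < r'}"
    let ?Y = "\<lambda>i. real (n choose i) * ((real i - r) * (real i - r') * (?G (real i))\<^sup>2)"
    let ?F = "\<lambda>i. real (n choose i) * (K (real i))\<^sup>2"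
    have I: "finite I" "I \<subseteq> {..n}" by (auto simp: I_def)
    have "0 \<notin> I" using root_bounds[OF r(1)] by (auto simp: I_def)
    then have "I \<subseteq> {1..n}" by (auto simp: I_def Suc_le_eq intro!: Nat.gr0I)
    then have cardI: "real (card I) \<le> real n" using card_mono[of "{1..n}" I] by simp
    have B: "0 \<le> B" using S by (simp add: B_def)
    have out: "?F i \<le> (real n)\<^sup>2 * ?Y i" if "i \<in> {..n} - I" for i
    proof -
      define X where "X = (real i - r) * (real i - r')"
      have rb: "0 < r" "r < real n" "0 < r'" "r' < real n" using root_bounds r by auto
      have i: "real i \<le> real n" "real i \<le> r \<or> r' \<le> real i"
        using that by (auto simp: I_def not_less)
      have "0 \<le> X"
        unfolding X_def using i(2) r(3) by (auto intro: mult_nonneg_nonneg mult_nonpos_nonpos)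
      moreover have "\<bar>X\<bar> \<le> real n * real n"
        unfolding X_def abs_mult using rb i(1) by (intro mult_mono) auto
      ultimately have "X * (X * (?G (real i))\<^sup>2) \<le> (real n)\<^sup>2 * (X * (?G (real i))\<^sup>2)"
        by (intro mult_right_mono mult_nonneg_nonneg) (auto simp: power2_eq_square)
      then have "real (n choose i) * (X * (X * (?G (real i))\<^sup>2))
          \<le> real (n choose i) * ((real n)\<^sup>2 * (X * (?G (real i))\<^sup>2))"
        by (intro mult_left_mono) auto
      moreover have "(K (real i))\<^sup>2 = X * (X * (?G (real i))\<^sup>2)"
        unfolding K_G[OF r] X_def by (simp add: power2_eq_square mult_ac)
      ultimately show ?thesis
        unfolding X_def by (simp only: mult_ac)
    qed
    have "S = (\<Sum>i\<in>{..n} - I. ?F i) + (\<Sum>i\<in>I. ?F i)"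
      unfolding S_def sum_krawtchouk_sq[symmetric] by (rule sum.subset_diff) (use I in auto)
    also have "\<dots> \<le> (\<Sum>i\<in>{..n} - I. (real n)\<^sup>2 * ?Y i) + (\<Sum>i\<in>I. B)"
      using out bound by (intro add_mono sum_mono) (auto simp: I_def)
    also have "\<dots> \<le> (real n)\<^sup>2 * (\<Sum>i\<in>{..n} - I. ?Y i) + real n * B"
      using cardI B by (simp add: sum_distrib_left mult_right_mono)
    also have "(\<Sum>i\<in>{..n} - I. ?Y i) = (\<Sum>i\<in>I. - ?Y i)"
      using quadrature[OF r] sum.subset_diff[OF I(2), of ?Y] by (simp add: sum_negf)
    also have "(\<Sum>i\<in>I. - ?Y i) \<le> (\<Sum>i\<in>I. 3 / 2 * (real n)\<^sup>2 * B)"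
    proof (rule sum_mono)
      fix i assume "i \<in> I"
      then have i: "r < real i" "real i < r'" by (auto simp: I_def)
      have "- ?Y i = real (n choose i) * ((real i - r) * (r' - real i) * (?G (real i))\<^sup>2)"
        by (simp add: algebra_simps)
      then show "- ?Y i \<le> 3 / 2 * (real n)\<^sup>2 * B"
        using inside_term[OF bound i] by simp
    qed
    also have "\<dots> \<le> real n * (3 / 2 * (real n)\<^sup>2 * B)"
    proof -
      have "real (card I) * (3 / 2 * (real n)\<^sup>2 * B) \<le> real n * (3 / 2 * (real n)\<^sup>2 * B)"
        using cardI B by (intro mult_right_mono) auto
      then show ?thesis by simp
    qed
    finally have "S \<le> (real n)\<^sup>2 * (real n * (3 / 2 * (real n)\<^sup>2 * B)) + real n * B"
      by (simp add: mult_left_mono)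
    also have "\<dots> = (3 / 2 * real n ^ 5 + real n) * B"
      by (simp add: power2_eq_square power_numeral_reduce algebra_simps)
    also have "\<dots> \<le> (3 / 2 * real n ^ 5 + real n ^ 5) * B"
      using n1 B self_le_power[of "real n" 5] by (intro mult_right_mono add_left_mono) auto
    also have "\<dots> = 5 / 18 * S"
      using n1 by (simp add: B_def field_simps)
    finally show False using S by simp
  qed
  then show ?thesis using that unfolding B_def S_def by blast
qed

end

lemma head_positive:
  assumes "0 < s" "real i \<le> real n / 2 - sqrt (real s * (real n - real s))"
  shows "0 < K (real i)"
proof (cases "2 * s = n")
  case True
  then have "real n - real s = real s" by auto
  then have "sqrt (real s * (real n - real s)) = real s" by simp
  then have "real i \<le> 0" using assms True by simp
  then show ?thesis using s_le by (intro krawtchouk_pos) auto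
next
  case False
  then interpret krawtchouk_head n s using assms s_le by unfold_locales auto
  show ?thesis using ratio[of i] assms by blast
qed

text \<open>\<open>K\<close> is positive at the integers up to the threshold but negative at an
  integer \<open>k \<le> i\<close> between the first two roots, or just past the first root with
  \<open>k = i\<close>. The detour through \<open>k\<close> is needed because \<open>K\<close> may
  be positive at \<open>i\<close> itself.\<close>

lemma beyond_edge:
  assumes r: "r \<in> R" "r' \<in> R" "r < r'" and consecutive: "\<And>a. a \<in> R \<Longrightarrow> a \<le> r \<or> r' \<le> a"
    and i: "r < real i" "real i < r'"
  shows "real n / 2 - sqrt (real s * (real n - real s)) < real i"
proof (rule ccontr)
  assume "\<not> ?thesis"
  then have le: "real i \<le> real n / 2 - sqrt (real s * (real n - real s))" by simp
  have "0 < s" using r card_R finite_R by (metis card_gt_0_iff empty_iff)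
  define q where "q = Min R"
  have q: "q \<in> R" "\<And>a. a \<in> R \<Longrightarrow> q \<le> a"
    unfolding q_def using finite_R r by (auto intro: Min_in)
  obtain k where k: "q < real k" "k \<le> i" "\<And>a. a \<in> R \<Longrightarrow> a \<le> real k \<Longrightarrow> a = q"
  proof (cases "q = r")
    case True
    show ?thesis
    proof (rule that[of i])
      show "a = q" if "a \<in> R" "a \<le> real i" for a
        using consecutive[OF that(1)] q(2)[OF that(1)] that i True by auto
    qed (use i True in auto)
  next
    case False
    then have "q < r" using q(2)[OF r(1)] by simp
    define q' where "q' = Min {a \<in> R. q < a}"
    have fin: "finite {a \<in> R. q < a}" "{a \<in> R. q < a} \<noteq> {}" using finite_R r \<open>q < r\<close> by auto
    have q': "q' \<in> R" "q < q'" using Min_in[OF fin] by (auto simp: q'_def)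
    have q'_le: "q' \<le> a" if "a \<in> R" "q < a" for a
      unfolding q'_def using fin that by (intro Min_le) auto
    obtain j where j: "q < real j" "real j < q'" using integer_between[OF q(1) q'] .
    show ?thesis
    proof (rule that[of j])
      have "real j < real i" using j q'_le[OF r(1) \<open>q < r\<close>] i by linarith
      then show "j \<le> i" by simp
      show "a = q" if "a \<in> R" "a \<le> real j" for a
        using q(2)[OF that(1)] q'_le[OF that(1)] that j by fastforce
    qed (rule j)
  qed
  have "K 0 * K (real k) < 0"
  proof (rule sign_flip[OF q(1)])
    show "0 < q" by (rule root_bounds[OF q(1)])
    show "a = q" if "a \<in> R" "0 \<le> a" "a \<le> real k" for a using k(3) that by blast
  qed (rule k)
  moreover have "0 < K 0" using s_le by (intro krawtchouk_pos) auto
  moreover have "0 < K (real k)" using k(2) le \<open>0 < s\<close> by (intro head_positive) auto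
  ultimately show False using mult_pos_pos by (metis less_asym)
qed

end

section \<open>From values at integers to probabilities\<close>

lemma cube_prob_krawtchouk_ge:
  assumes i: "i \<le> n" and n: "0 < n" and L: "L \<le> \<bar>krawtchouk n s (real i)\<bar>"
  shows "exp (- 1) / sqrt (max (real i) 1) * 2 powr ((bin_entropy (real i / real n) - 1) * real n)
    \<le> cube_prob n (\<lambda>x. L \<le> \<bar>krawtchouk_cube n s x\<bar>)"
proof -
  have "2 powr ((bin_entropy (real i / real n) - 1) * real n)
      = 2 powr (bin_entropy (real i / real n) * real n) / 2 ^ n"
    by (simp add: left_diff_distrib powr_diff powr_realpow)
  then have "exp (- 1) / sqrt (max (real i) 1) * 2 powr ((bin_entropy (real i / real n) - 1) * real n)
      = exp (- 1) / sqrt (max (real i) 1) * 2 powr (bin_entropy (real i / real n) * real n) / 2 ^ n"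
    by simp
  also have "\<dots> \<le> real (n choose i) / 2 ^ n"
    using binomial_ge_entropy[OF i n] by (intro divide_right_mono) auto
  also have "\<dots> = real (card {x \<in> cube n. weight n x = i}) / 2 ^ n"
    by (simp only: card_weight)
  also have "\<dots> \<le> real (card {x \<in> cube n. L \<le> \<bar>krawtchouk_cube n s x\<bar>}) / 2 ^ n"
    using L by (intro divide_right_mono of_nat_mono card_mono) (auto simp: krawtchouk_cube_eq)
  finally show ?thesis unfolding cube_prob_eq .
qed

lemma cube_norm_krawtchouk: "cube_norm n 2 (krawtchouk_cube n s) = sqrt (real (n choose s))"
  unfolding cube_norm_2 sum_krawtchouk_cube_sq by simp

text \<open>Two degenerate cases lie outside \<open>krawtchouk_head\<close>: for
  \<open>s = 0\<close> both values of \<open>I_fun\<close> are -1 and \<open>tau\<close> vanishes;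
  for \<open>2 * s = n\<close> the threshold is 0 and only \<open>i = 0\<close> remains.\<close>

lemma krawtchouk_head_value:
  assumes "1 \<le> n" "real s \<le> real n / 2" "real i \<le> real n / 2 - sqrt (real s * (real n - real s))"
  shows "real (n choose s) / 2 powr (bin_entropy (real s / real n) * real n)
      * 2 powr (tau (real s / real n) (real i / real n) * real n) \<le> krawtchouk n s (real i)"
proof -
  consider "s = 0" | "0 < s" "2 * s = n" | "0 < s" "2 * s < n" using assms(2) by linarith
  then show ?thesis
  proof cases
    case 1
    then have "real i / real n \<le> 1 / 2" using assms by (simp add: field_simps)
    then have "tau 0 (real i / real n) = 0" by (simp add: tau_def I_fun_def bin_entropy_def)
    then show ?thesis using 1 by (simp add: bin_entropy_def)
  next
    case 2
    interpret krawtchouk_roots n s using 2 by unfold_locales simp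
    have "real n - real s = real s" using 2 by auto
    then have "sqrt (real s * (real n - real s)) = real s" by simp
    then have "i = 0" using assms(3) 2 by auto
    moreover have "tau (real s / real n) 0 = bin_entropy (real s / real n)"
      using 2 by (intro tau_0) auto
    ultimately show ?thesis by (simp add: K_0)
  next
    case 3
    then interpret krawtchouk_head n s by unfold_locales auto
    show ?thesis using assms(3) by (rule K_ge)
  qed
qed

lemma krawtchouk_tail_head:
  assumes "1 \<le> n" "real s \<le> real n / 2" "real i \<le> real n / 2 - sqrt (real s * (real n - real s))"
  shows "exp (- 1) / sqrt (max (real i) 1) * 2 powr ((bin_entropy (real i / real n) - 1) * real n)
    \<le> cube_prob n (\<lambda>x. \<bar>krawtchouk_cube n s x\<bar> \<ge>
         sqrt (real (n choose s) / 2 powr (bin_entropy (real s / real n) * real n)) *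
         cube_norm n 2 (krawtchouk_cube n s) *
         2 powr ((tau (real s / real n) (real i / real n) - 1 / 2 * bin_entropy (real s / real n)) * real n))"
proof (rule cube_prob_krawtchouk_ge)
  define h where "h = bin_entropy (real s / real n) * real n"
  define T where "T = tau (real s / real n) (real i / real n) * real n"
  have "0 \<le> sqrt (real s * (real n - real s))" using assms(2) by simp
  then have "real i \<le> real n" using assms(3) by linarith
  then show "i \<le> n" by simp
  \<comment> \<open>The norm is \<open>sqrt (n choose s)\<close>, so the correction factor completes
    it to \<open>n choose s\<close> and supplies the other half of the entropy exponent.\<close>
  have "sqrt (real (n choose s) / 2 powr h) = sqrt (real (n choose s)) / 2 powr (h / 2)"
    by (simp add: real_sqrt_divide powr_half_sqrt[symmetric] powr_powr)
  moreover have "(tau (real s / real n) (real i / real n) - 1 / 2 * bin_entropy (real s / real n)) * real n = T - h / 2"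
    by (simp add: T_def h_def algebra_simps)
  moreover have "2 powr (h / 2) * 2 powr (h / 2) = 2 powr h"
    by (simp add: powr_add[symmetric])
  ultimately have "sqrt (real (n choose s) / 2 powr (bin_entropy (real s / real n) * real n)) *
         cube_norm n 2 (krawtchouk_cube n s) *
         2 powr ((tau (real s / real n) (real i / real n) - 1 / 2 * bin_entropy (real s / real n)) * real n)
      = real (n choose s) / 2 powr h * 2 powr T"
    unfolding cube_norm_krawtchouk h_def[symmetric] by (simp add: powr_diff)
  also have "\<dots> \<le> krawtchouk n s (real i)"
    unfolding h_def T_def by (rule krawtchouk_head_value[OF assms])
  finally show "sqrt (real (n choose s) / 2 powr (bin_entropy (real s / real n) * real n)) *
         cube_norm n 2 (krawtchouk_cube n s) *
         2 powr ((tau (real s / real n) (real i / real n) - 1 / 2 * bin_entropy (real s / real n)) * real n)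
      \<le> \<bar>krawtchouk n s (real i)\<bar>" by linarith
qed (use assms in simp)

lemma krawtchouk_tail_bulk:
  assumes n: "1 \<le> n" "real s \<le> real n / 2" and roots: "consecutive_roots (krawtchouk n s) r r'"
  shows "\<exists>i::nat. r < real i \<and> real i < r' \<and>
    exp (- 1) / sqrt (real i) * 2 powr ((bin_entropy (real i / real n) - 1) * real n)
    \<le> cube_prob n (\<lambda>x. \<bar>krawtchouk_cube n s x\<bar> \<ge>
         1 / 3 / real n powr (5 / 2) * cube_norm n 2 (krawtchouk_cube n s) *
         2 powr ((tau (real s / real n) (real i / real n) - 1 / 2 * bin_entropy (real s / real n)) * real n))"
proof -
  interpret krawtchouk_roots n s using n by unfold_locales linarith
  have r: "r \<in> R" "r' \<in> R" "r < r'" and cons: "\<And>a. a \<in> R \<Longrightarrow> a \<le> r \<or> r' \<le> a"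
    using roots by (force simp: R_def consecutive_roots_def)+
  obtain i where i: "r < real i" "real i < r'"
    and large: "2 ^ n * real (n choose s) / (9 * real n ^ 5) \<le> real (n choose i) * (K (real i))\<^sup>2"
    using large_value_between[OF r cons] by blast
  have i0: "0 < i" "i \<le> n"
    using i root_bounds(1)[OF r(1)] root_bounds(2)[OF r(2)] by (auto intro: Nat.gr0I)
  define h where "h = bin_entropy (real i / real n) * real n"
  define L where "L = 1 / 3 / real n powr (5 / 2) * cube_norm n 2 (krawtchouk_cube n s) *
         2 powr ((tau (real s / real n) (real i / real n) - 1 / 2 * bin_entropy (real s / real n)) * real n)"
  have "real s * (real n - real s) / (real n)\<^sup>2 = real s / real n * (1 - real s / real n)"
    using n by (simp add: power2_eq_square field_simps)
  then have sq: "sqrt (real s * (real n - real s)) / real n = sqrt (real s / real n * (1 - real s / real n))"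
    by (metis of_nat_0_le_iff real_sqrt_divide real_sqrt_unique)
  \<comment> \<open>Past the threshold \<open>tau\<close> takes its second branch, whose exponent is
    exactly what remains of \<open>large\<close> after division by the upper bound
    \<open>2 powr h\<close> for \<open>n choose i\<close>.\<close>
  have "(real n / 2 - sqrt (real s * (real n - real s))) / real n < real i / real n"
    using beyond_edge[OF r cons i] n by (intro divide_strict_right_mono) auto
  then have "1 / 2 - sqrt (real s / real n * (1 - real s / real n)) < real i / real n"
    unfolding sq[symmetric] using n by (simp add: diff_divide_distrib)
  then have "tau (real s / real n) (real i / real n)
      = (1 + bin_entropy (real s / real n) - bin_entropy (real i / real n)) / 2"
    by (simp add: tau_def)
  then have "(tau (real s / real n) (real i / real n) - 1 / 2 * bin_entropy (real s / real n)) * real n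
      = (real n - h) / 2"
    by (simp only:) (simp add: h_def field_simps)
  then have L: "L = 1 / 3 / real n powr (5 / 2) * sqrt (real (n choose s)) * 2 powr ((real n - h) / 2)"
    unfolding L_def cube_norm_krawtchouk by (simp only:)
  have "L \<le> \<bar>K (real i)\<bar>"
  proof (rule power2_le_imp_le)
    have "(real n powr (5 / 2))\<^sup>2 = real n ^ 5"
      using n by (simp add: powr_powr powr_realpow[symmetric] powr_numeral[symmetric] del: powr_numeral)
    moreover have "(2 powr ((real n - h) / 2))\<^sup>2 = 2 ^ n / 2 powr h"
      by (simp add: power2_eq_square powr_add[symmetric] powr_diff powr_realpow)
    ultimately have "L\<^sup>2 = 2 ^ n * real (n choose s) / (9 * real n ^ 5) / 2 powr h"
      unfolding L by (simp add: power_mult_distrib power_divide mult_ac)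
    also have "\<dots> \<le> real (n choose i) * (K (real i))\<^sup>2 / 2 powr h"
      using large by (intro divide_right_mono) auto
    also have "\<dots> \<le> 2 powr h * (K (real i))\<^sup>2 / 2 powr h"
      using binomial_le_entropy[of i n] i0 n unfolding h_def
      by (intro divide_right_mono mult_right_mono) auto
    finally show "L\<^sup>2 \<le> \<bar>K (real i)\<bar>\<^sup>2" by simp
  qed simp
  then have "exp (- 1) / sqrt (max (real i) 1) * 2 powr ((bin_entropy (real i / real n) - 1) * real n)
    \<le> cube_prob n (\<lambda>x. L \<le> \<bar>krawtchouk_cube n s x\<bar>)"
    using i0 n by (intro cube_prob_krawtchouk_ge) auto
  moreover have "max (real i) 1 = real i" using i0 by simp
  ultimately show ?thesis
    using i unfolding L_def by auto
qed

(* In the first part the instances s = 0, i < n/2 are left out: there f is a nonzero constant,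
   tau 0 (i / n) = 0, so the event has probability 1, while the bound is less than 1. *)
theorem theorem1p5:
  shows
    "(\<forall>(n::nat) (s::nat) (f :: (nat \<Rightarrow> nat) \<Rightarrow> real) (i::real).
        1 \<le> n \<and> real s \<le> real n / 2 \<and>
        poly_degree_le n s f \<and> (\<exists>x\<in>cube n. f x \<noteq> 0) \<and>
        0 \<le> i \<and> i \<le> real n / 2 \<and> (0 < s \<or> i = real n / 2) \<longrightarrow>
        cube_prob n (\<lambda>x. \<bar>f x\<bar> \<ge> cube_norm n 2 f *
            2 powr ((tau (real s / real n) (i / real n)
                      - 1 / 2 * bin_entropy (real s / real n)) * real n))
          \<le> 2 powr ((bin_entropy (i / real n) - 1) * real n))
     \<and>
     (\<exists>(c1::real) (c2::real). c1 > 0 \<and> c2 > 0 \<and>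
       (\<forall>(n::nat) (s::nat). 1 \<le> n \<and> real s \<le> real n / 2 \<longrightarrow>
          (\<forall>i::int. 0 \<le> i \<and> real_of_int i \<le> real n / 2 - sqrt (real s * (real n - real s)) \<longrightarrow>
             cube_prob n (\<lambda>x. \<bar>krawtchouk_cube n s x\<bar> \<ge>
                 sqrt (real (n choose s) / 2 powr (bin_entropy (real s / real n) * real n)) *
                 cube_norm n 2 (krawtchouk_cube n s) *
                 2 powr ((tau (real s / real n) (real_of_int i / real n)
                           - 1 / 2 * bin_entropy (real s / real n)) * real n))
               \<ge> c1 / sqrt (max (real_of_int i) 1) *
                   2 powr ((bin_entropy (real_of_int i / real n) - 1) * real n))
          \<and>
          (\<forall>r r'. consecutive_roots (krawtchouk n s) r r' \<longrightarrow>
             (\<exists>i::int. r < real_of_int i \<and> real_of_int i < r' \<and>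
               cube_prob n (\<lambda>x. \<bar>krawtchouk_cube n s x\<bar> \<ge>
                   c2 / real n powr (5 / 2) * cube_norm n 2 (krawtchouk_cube n s) *
                   2 powr ((tau (real s / real n) (real_of_int i / real n)
                             - 1 / 2 * bin_entropy (real s / real n)) * real n))
                 \<ge> c1 / sqrt (real_of_int i) *
                     2 powr ((bin_entropy (real_of_int i / real n) - 1) * real n)))))"
proof (rule conjI, goal_cases)
  case 1
  show ?case by (blast intro: tail_bound_poly)
next
  case 2
  show ?case
  \<comment> \<open>\<open>exp (- 1)\<close> is the constant of the Stirling bound,
    \<open>1 / 3\<close> the square root of the \<open>1 / 9\<close> in
    \<open>large_value_between\<close>.\<close>
  proof (rule exI[of _ "exp (- 1)"], rule exI[of _ "1 / 3"], intro conjI allI impI, goal_cases)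
    case (3 n s i)
    then obtain k where "i = int k" using zero_le_imp_eq_int by blast
    with 3 show ?case using krawtchouk_tail_head[of n s k] by simp
  next
    case (4 n s r r')
    then obtain k where "r < real k \<and> real k < r' \<and>
      exp (- 1) / sqrt (real k) * 2 powr ((bin_entropy (real k / real n) - 1) * real n)
      \<le> cube_prob n (\<lambda>x. \<bar>krawtchouk_cube n s x\<bar> \<ge>
         1 / 3 / real n powr (5 / 2) * cube_norm n 2 (krawtchouk_cube n s) *
         2 powr ((tau (real s / real n) (real k / real n) - 1 / 2 * bin_entropy (real s / real n)) * real n))"
      using krawtchouk_tail_bulk[of n s r r'] by blast
    then show ?case by (intro exI[of _ "int k"]) (simp only: of_int_of_nat_eq)
  qed simp_all
qed

end
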